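(* Let $\mathbb{G}$ be an H-type group with homogeneous dimension $Q$, let $X_1,\dots,X_m$ be the fixed orthonormal basis of its horizontal layer, and let $\lambda,\Lambda,\delta$ be real numbers with $0<\lambda\le\Lambda$ and $0<\delta\le 2$. There exist constants $C>0$ and $\eta\ge 1$, depending only on $\Lambda,\lambda,\delta$ and on the structure of $\mathbb{G}$, such that the following holds. Let $\Omega\subseteq\mathbb{G}$ be open and let $A=(a_{ij})_{i,j=1}^m$ be a matrix-valued function on $\Omega$ with smooth coefficients such that $A(x)\in M_m(\lambda,\Lambda)$ for every $x\in\Omega$ and such that $A$ satisfies the $\delta$-Landis condition in $\Omega$. If $x_0\in\mathbb{G}$ and $R>0$ are such that $B_{\eta R}(x_0)\subset\Omega$, and $u\in C^2(B_{\eta R}(x_0),\mathbb{R})$ satisfies $$u\ge 0\quad\text{and}\quad \mathcal{L}_A u=0\quad\text{in } B_{\eta R}(x_0),$$ then $$\sup_{B_R(x_0)}u\le C\inf_{B_R(x_0)}u .$$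
   Context: H-type groups. An H-type algebra is a finite-dimensional real Lie algebra $(\mathfrak{g},[\cdot,\cdot])$ which can be endowed with an inner product $\langle\cdot,\cdot\rangle$ such that, with $\mathfrak{z}$ the center of $\mathfrak{g}$ and $\mathfrak{b}:=\mathfrak{z}^\perp$, one has $[\mathfrak{b},\mathfrak{b}]=\mathfrak{z}$, and such that for each $z\in\mathfrak{z}$ with $\langle z,z\rangle=1$ the map $J_z:\mathfrak{b}\to\mathfrak{b}$ defined by $\langle J_z(v),w\rangle=\langle z,[v,w]\rangle$ for all $w\in\mathfrak{b}$ is orthogonal. An H-type group is a simply connected Lie group whose Lie algebra (of left-invariant vector fields) is an H-type algebra. Such an inner product is fixed, and $\|q\|=\langle q,q\rangle^{1/2}$ for $q\in\mathfrak{g}$. Setting. $\mathbb{G}=(\mathbb{R}^N,\circ,\delta_\lambda)$ is a homogeneous Lie group which is an H-type group. Put $m=\dim\mathfrak{b}$, $n=\dim\mathfrak{z}$, $N=m+n$. It is a step-two Carnot group with stratification $\mathfrak{g}=\mathfrak{b}\oplus\mathfrak{z}$ ($\mathfrak{b}$ is the horizontal layer), dilations $\delta_\lambda(x_{(1)},x_{(2)})=(\lambda x_{(1)},\lambda^2x_{(2)})$ for $(x_{(1)},x_{(2)})\in\mathbb{R}^m\times\mathbb{R}^n$, and homogeneous dimension $Q=m+2n$. Fix an orthonormal basis $X_1,\dots,X_m$ of $\mathfrak{b}$ with respect to $\langle\cdot,\cdot\rangle$. Norm and balls. The exponential map $Exp:\mathfrak{g}\to\mathbb{G}$ is a global diffeomorphism;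 define $v:\mathbb{G}\to\mathfrak{b}$ and $z:\mathbb{G}\to\mathfrak{z}$ by $x=Exp(v(x)+z(x))$. Put $d(x)=(\|v(x)\|^4+16\|z(x)\|^2)^{1/4}$ and $d(\xi,x)=d(x^{-1}\circ\xi)$. The ball is $B_R(x_0)=\{\xi\in\mathbb{G}: d(x_0^{-1}\circ\xi)<R\}$. Operators. $M_m(\lambda,\Lambda)$ is the set of real symmetric $m\times m$ matrices $M$ with $\lambda\|\xi\|^2\le\langle M\xi,\xi\rangle\le\Lambda\|\xi\|^2$ for every $\xi\in\mathbb{R}^m$ (Euclidean inner product and norm). For $A=(a_{ij})$ as in the claim, $\mathcal{L}_A=\sum_{i,j=1}^m a_{ij}(x)X_iX_j$ for $x\in\Omega$. $\delta$-Landis condition: for all $x\in\Omega$, $$\mathrm{Tr}(A(x))+(Q+2-m)\max_{\|\xi\|=1}\langle A(x)\xi,\xi\rangle\le(Q+4-\delta)\min_{\|\xi\|=1}\langle A(x)\xi,\xi\rangle .$$ *)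

theory Defs
  imports "HOL-Analysis.Analysis" "HOL-Library.Function_Algebras"
begin

text \<open>Vector fields on \<open>\<real>\<^sup>N\<close> are maps from \<open>\<real>\<^sup>N\<close> to itself. The pointwise structure makes
  \<^const>\<open>span\<close>, \<^const>\<open>subspace\<close> and \<^const>\<open>dim\<close> available for them.\<close>

instantiation "fun" :: (type, real_vector) real_vector
begin

definition scaleR_fun :: "real \<Rightarrow> ('a \<Rightarrow> 'b) \<Rightarrow> 'a \<Rightarrow> 'b" where
  "scaleR_fun c f = (\<lambda>x. c *\<^sub>R f x)"

instance
  by standard (auto simp: scaleR_fun_def fun_eq_iff scaleR_add_right scaleR_add_left)

end

text \<open>Meant for open \<open>S\<close> only: every iterated directional derivative of order less than \<open>k\<close>
  is differentiable at each point of \<open>S\<close>, and those of order \<open>k\<close> are continuous on \<open>S\<close>.\<close>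

primrec Ck_on :: "nat \<Rightarrow> 'a::euclidean_space set \<Rightarrow> ('a \<Rightarrow> 'b::real_normed_vector) \<Rightarrow> bool" where
  "Ck_on 0 S f \<longleftrightarrow> continuous_on S f"
| "Ck_on (Suc k) S f \<longleftrightarrow>
     (\<forall>x\<in>S. f differentiable (at x)) \<and>
     (\<forall>v. Ck_on k S (\<lambda>x. frechet_derivative f (at x) v))"

definition smooth_on :: "'a::euclidean_space set \<Rightarrow> ('a \<Rightarrow> 'b::real_normed_vector) \<Rightarrow> bool" where
  "smooth_on S f \<longleftrightarrow> (\<forall>k. Ck_on k S f)"

text \<open>\<open>\<real>\<^sup>N\<close> is \<open>(real ^ 'm) \<times> (real ^ 'n)\<close>, with \<open>m = CARD('m)\<close> and \<open>n = CARD('n)\<close>.\<close>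

type_synonym ('m, 'n) pt = "(real ^ 'm) \<times> (real ^ 'n)"

definition dilation :: "real \<Rightarrow> ('m::finite, 'n::finite) pt \<Rightarrow> ('m, 'n) pt" where
  "dilation t x = (t *\<^sub>R fst x, t\<^sup>2 *\<^sub>R snd x)"

text \<open>The neutral element is taken to be the origin: it is fixed by every automorphism, hence by
  all dilations, and the origin is their only common fixed point.\<close>

definition homogeneous_lie_group ::
  "(('m::finite, 'n::finite) pt \<Rightarrow> ('m, 'n) pt \<Rightarrow> ('m, 'n) pt) \<Rightarrow> (('m, 'n) pt \<Rightarrow> ('m, 'n) pt) \<Rightarrow> bool"
  where
  "homogeneous_lie_group mul iv \<longleftrightarrow>
     group mul 0 iv \<and>
     smooth_on UNIV (\<lambda>p. mul (fst p) (snd p)) \<and>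
     smooth_on UNIV iv \<and>
     (\<forall>t>0. \<forall>x y. dilation t (mul x y) = mul (dilation t x) (dilation t y))"

definition homogeneous_dimension :: "('m::finite, 'n::finite) pt itself \<Rightarrow> nat" where
  "homogeneous_dimension _ = CARD('m) + 2 * CARD('n)"

definition lie_algebra :: "('a::euclidean_space \<Rightarrow> 'a \<Rightarrow> 'a) \<Rightarrow> ('a \<Rightarrow> 'a) set" where
  "lie_algebra mul =
     {V. smooth_on UNIV V \<and> (\<forall>a x. frechet_derivative (mul a) (at x) (V x) = V (mul a x))}"

definition deriv_along :: "('a::euclidean_space \<Rightarrow> 'a) \<Rightarrow> ('a \<Rightarrow> real) \<Rightarrow> 'a \<Rightarrow> real" where
  "deriv_along V u x = frechet_derivative u (at x) (V x)"

text \<open>The commutator \<open>V W - W V\<close> of the derivations, expressed on the coefficient functions.\<close>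

definition lie_bracket :: "('a::euclidean_space \<Rightarrow> 'a) \<Rightarrow> ('a \<Rightarrow> 'a) \<Rightarrow> 'a \<Rightarrow> 'a" where
  "lie_bracket V W x =
     frechet_derivative W (at x) (V x) - frechet_derivative V (at x) (W x)"

definition lie_center :: "('a::euclidean_space \<Rightarrow> 'a \<Rightarrow> 'a) \<Rightarrow> ('a \<Rightarrow> 'a) set" where
  "lie_center mul = {Z \<in> lie_algebra mul. \<forall>V\<in>lie_algebra mul. lie_bracket Z V = 0}"

definition lie_exp :: "('a::euclidean_space \<Rightarrow> 'a) \<Rightarrow> 'a" where
  "lie_exp V =
     (THE y. \<exists>\<gamma>::real \<Rightarrow> 'a. \<gamma> 0 = 0 \<and>
        (\<forall>t. (\<gamma> has_vector_derivative V (\<gamma> t)) (at t)) \<and> \<gamma> 1 = y)"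

definition inner_product_on :: "'v::real_vector set \<Rightarrow> ('v \<Rightarrow> 'v \<Rightarrow> real) \<Rightarrow> bool" where
  "inner_product_on S ip \<longleftrightarrow>
     (\<forall>x\<in>S. \<forall>y\<in>S. ip x y = ip y x) \<and>
     (\<forall>x\<in>S. \<forall>y\<in>S. \<forall>w\<in>S. ip (x + y) w = ip x w + ip y w) \<and>
     (\<forall>c. \<forall>x\<in>S. \<forall>y\<in>S. ip (c *\<^sub>R x) y = c * ip x y) \<and>
     (\<forall>x\<in>S. x \<noteq> 0 \<longrightarrow> ip x x > 0)"

definition horizontal ::
  "('a::euclidean_space \<Rightarrow> 'a \<Rightarrow> 'a) \<Rightarrow> (('a \<Rightarrow> 'a) \<Rightarrow> ('a \<Rightarrow> 'a) \<Rightarrow> real) \<Rightarrow> ('a \<Rightarrow> 'a) set" where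
  "horizontal mul ip = {V \<in> lie_algebra mul. \<forall>Z\<in>lie_center mul. ip V Z = 0}"

definition J_map ::
  "('a::euclidean_space \<Rightarrow> 'a \<Rightarrow> 'a) \<Rightarrow> (('a \<Rightarrow> 'a) \<Rightarrow> ('a \<Rightarrow> 'a) \<Rightarrow> real) \<Rightarrow>
   ('a \<Rightarrow> 'a) \<Rightarrow> ('a \<Rightarrow> 'a) \<Rightarrow> ('a \<Rightarrow> 'a)" where
  "J_map mul ip Z V =
     (THE U. U \<in> horizontal mul ip \<and>
        (\<forall>W\<in>horizontal mul ip. ip U W = ip Z (lie_bracket V W)))"

text \<open>Orthogonality of \<open>J_map mul ip Z\<close> on the horizontal layer is preservation of the inner product,
  the layer being finite-dimensional.\<close>

definition h_type_inner_product ::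
  "('a::euclidean_space \<Rightarrow> 'a \<Rightarrow> 'a) \<Rightarrow> (('a \<Rightarrow> 'a) \<Rightarrow> ('a \<Rightarrow> 'a) \<Rightarrow> real) \<Rightarrow> bool" where
  "h_type_inner_product mul ip \<longleftrightarrow>
     inner_product_on (lie_algebra mul) ip \<and>
     span {lie_bracket V W | V W. V \<in> horizontal mul ip \<and> W \<in> horizontal mul ip} = lie_center mul \<and>
     (\<forall>Z\<in>lie_center mul. ip Z Z = 1 \<longrightarrow>
        (\<forall>V\<in>horizontal mul ip. \<forall>W\<in>horizontal mul ip.
           ip (J_map mul ip Z V) (J_map mul ip Z W) = ip V W))"

text \<open>The last conjunct says that the stratification whose first layer is \<^const>\<open>horizontal\<close> is the
  one belonging to the dilations: a left-invariant field \<open>V\<close> is horizontal iff it is homogeneous of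
  degree one, \<open>V (\<phi> \<circ> \<delta>\<^sub>t) = t (V \<phi>) \<circ> \<delta>\<^sub>t\<close> for all smooth \<open>\<phi>\<close> and \<open>t > 0\<close>.\<close>

definition h_type_group ::
  "(('m::finite, 'n::finite) pt \<Rightarrow> ('m, 'n) pt \<Rightarrow> ('m, 'n) pt) \<Rightarrow>
   (('m, 'n) pt \<Rightarrow> ('m, 'n) pt) \<Rightarrow>
   ((('m, 'n) pt \<Rightarrow> ('m, 'n) pt) \<Rightarrow> (('m, 'n) pt \<Rightarrow> ('m, 'n) pt) \<Rightarrow> real) \<Rightarrow> bool" where
  "h_type_group mul iv ip \<longleftrightarrow>
     homogeneous_lie_group mul iv \<and>
     h_type_inner_product mul ip \<and>
     horizontal mul ip =
       {V \<in> lie_algebra mul. \<forall>t>0. \<forall>x. dilation t (V x) = t *\<^sub>R V (dilation t x)}"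

definition orthonormal_horizontal_basis ::
  "('a::euclidean_space \<Rightarrow> 'a \<Rightarrow> 'a) \<Rightarrow> (('a \<Rightarrow> 'a) \<Rightarrow> ('a \<Rightarrow> 'a) \<Rightarrow> real) \<Rightarrow>
   ('m::finite \<Rightarrow> 'a \<Rightarrow> 'a) \<Rightarrow> bool" where
  "orthonormal_horizontal_basis mul ip X \<longleftrightarrow>
     (\<forall>i j. ip (X i) (X j) = (if i = j then 1 else 0)) \<and>
     span (range X) = horizontal mul ip"

definition v_part ::
  "('a::euclidean_space \<Rightarrow> 'a \<Rightarrow> 'a) \<Rightarrow> (('a \<Rightarrow> 'a) \<Rightarrow> ('a \<Rightarrow> 'a) \<Rightarrow> real) \<Rightarrow> 'a \<Rightarrow> ('a \<Rightarrow> 'a)" where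
  "v_part mul ip x =
     (THE V. V \<in> horizontal mul ip \<and> (\<exists>Z\<in>lie_center mul. x = lie_exp (V + Z)))"

definition z_part ::
  "('a::euclidean_space \<Rightarrow> 'a \<Rightarrow> 'a) \<Rightarrow> (('a \<Rightarrow> 'a) \<Rightarrow> ('a \<Rightarrow> 'a) \<Rightarrow> real) \<Rightarrow> 'a \<Rightarrow> ('a \<Rightarrow> 'a)" where
  "z_part mul ip x =
     (THE Z. Z \<in> lie_center mul \<and> (\<exists>V\<in>horizontal mul ip. x = lie_exp (V + Z)))"

definition ip_norm :: "('v \<Rightarrow> 'v \<Rightarrow> real) \<Rightarrow> 'v \<Rightarrow> real" where
  "ip_norm ip q = sqrt (ip q q)"

definition gauge ::
  "('a::euclidean_space \<Rightarrow> 'a \<Rightarrow> 'a) \<Rightarrow> (('a \<Rightarrow> 'a) \<Rightarrow> ('a \<Rightarrow> 'a) \<Rightarrow> real) \<Rightarrow> 'a \<Rightarrow> real" where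
  "gauge mul ip x =
     root 4 (ip_norm ip (v_part mul ip x) ^ 4 + 16 * (ip_norm ip (z_part mul ip x))\<^sup>2)"

definition gauge_ball ::
  "('a::euclidean_space \<Rightarrow> 'a \<Rightarrow> 'a) \<Rightarrow> ('a \<Rightarrow> 'a) \<Rightarrow> (('a \<Rightarrow> 'a) \<Rightarrow> ('a \<Rightarrow> 'a) \<Rightarrow> real) \<Rightarrow>
   'a \<Rightarrow> real \<Rightarrow> 'a set" where
  "gauge_ball mul iv ip x0 R = {\<xi>. gauge mul ip (mul (iv x0) \<xi>) < R}"

definition elliptic_matrices :: "real \<Rightarrow> real \<Rightarrow> (real ^ 'm ^ 'm) set" where
  "elliptic_matrices lam Lam =
     {M. transpose M = M \<and>
         (\<forall>\<xi>. lam * (norm \<xi>)\<^sup>2 \<le> (M *v \<xi>) \<bullet> \<xi> \<and> (M *v \<xi>) \<bullet> \<xi> \<le> Lam * (norm \<xi>)\<^sup>2)}"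

definition nondiv_op ::
  "('m::finite \<Rightarrow> 'a::euclidean_space \<Rightarrow> 'a) \<Rightarrow> ('a \<Rightarrow> real ^ 'm ^ 'm) \<Rightarrow> ('a \<Rightarrow> real) \<Rightarrow> 'a \<Rightarrow> real" where
  "nondiv_op X A u x =
     (\<Sum>i\<in>UNIV. \<Sum>j\<in>UNIV. A x $ i $ j * deriv_along (X i) (deriv_along (X j) u) x)"

text \<open>The supremum and infimum over the unit sphere are attained, by compactness.\<close>

definition landis_condition ::
  "real \<Rightarrow> ('m::finite, 'n::finite) pt set \<Rightarrow> (('m, 'n) pt \<Rightarrow> real ^ 'm ^ 'm) \<Rightarrow> bool" where
  "landis_condition \<delta> \<Omega> A \<longleftrightarrow>
     (let Q = real (homogeneous_dimension TYPE(('m, 'n) pt)); m = real CARD('m) in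
      \<forall>x\<in>\<Omega>. trace (A x) + (Q + 2 - m) * (SUP \<xi>\<in>sphere 0 1. (A x *v \<xi>) \<bullet> \<xi>)
              \<le> (Q + 4 - \<delta>) * (INF \<xi>\<in>sphere 0 1. (A x *v \<xi>) \<bullet> \<xi>))"

end

theory Submission
  imports Defs
begin

text \<open>
  The proof rests on one explicit barrier and on a comparison argument that is used twice.

  \<^bold>\<open>Reduction.\<close> Smoothness and homogeneity force the group law to be
  \<open>(x\<^sub>1 + y\<^sub>1, x\<^sub>2 + y\<^sub>2 + B(x\<^sub>1, y\<^sub>1))\<close> with \<open>B\<close> bilinear (\<open>group_law\<close>), so the Lie algebra, its
  centre, the exponential map and the gauge can all be written down. In exponential coordinates
  taken with respect to orthonormal bases, the group becomes the model \<open>\<real>\<^sup>m \<times> \<real>\<^sup>n\<close> of the locale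
  \<open>htype\<close>, and the gauge distance \<open>d\<close> becomes a left-invariant metric (\<open>gnorm_triangle\<close>) whose
  balls have volume a constant times \<open>r\<^sup>Q\<close> (\<open>emeasure_gcball\<close>). Writing \<open>A(x)\<close> as a sum of rank-one
  matrices \<open>\<Sum> b b\<^sup>T\<close> turns \<open>L\<^sub>A u(x)\<close> into a sum of second derivatives of \<open>u\<close> along the
  one-parameter curves \<open>x \<circ> Exp(t b)\<close> (\<open>landis_solution_transfer\<close>). From then on only
  calculus in one variable is used.

  \<^bold>\<open>The barrier.\<close> Along such a curve the fourth power of the gauge is a polynomial in \<open>t\<close>, and the
  \<open>\<delta>\<close>-Landis condition is the inequality that makes \<open>x \<mapsto> d(y, x)\<^bsup>-s\<^esup>\<close> a subsolution off \<open>y\<close>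
  for \<open>s = Q - \<delta>\<close> (\<open>barrier_subsolution\<close>). Because \<open>s < Q\<close>, this function is locally integrable, with
  integral at most \<open>C r\<^sup>\<delta>\<close> over a ball of radius \<open>r\<close> (\<open>potential_bound\<close>).

  \<^bold>\<open>Weak-type estimate.\<close> If \<open>u \<ge> 0\<close> is a solution on a ball of radius \<open>6 r\<close> and
  \<open>K = {u \<ge> t}\<close> inside the concentric ball of radius \<open>r\<close>, then \<open>u\<close> dominates a multiple of the
  potential \<open>\<integral>\<^sub>K d(y, x)\<^bsup>-s\<^esup> dy\<close>, up to a constant, by the maximum principle; a Riemann sum in place of the integral avoids differentiating the singular
  potential. This gives \<open>t |K| \<le> C r\<^sup>Q inf u\<close>, the infimum being over the smaller ball (\<open>weak_estimate\<close>).

  \<^bold>\<open>From weak type to Harnack.\<close> Let \<open>p\<close> maximise \<open>u(x) (2R - d(x\<^sub>0, x))\<^sup>Q\<close>. Near \<open>p\<close>, at the scale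
  of \<open>\<sigma> = 2R - d(x\<^sub>0, p)\<close>, the solution is at most \<open>(1 + \<nu>) u(p)\<close>. The weak-type estimate for the nonnegative
  solution \<open>(1 + \<nu>) u(p) - u\<close>, which is only \<open>\<nu> u(p)\<close> at \<open>p\<close>, says that \<open>u \<ge> u(p)/2\<close> on a set
  of measure comparable to \<open>\<sigma>\<^sup>Q\<close>. The weak-type estimate for \<open>u\<close> itself then bounds
  \<open>u(p) \<sigma>\<^sup>Q\<close> by \<open>C R\<^sup>Q inf u\<close>, and the choice of \<open>p\<close> bounds \<open>R\<^sup>Q sup u\<close> by \<open>u(p) \<sigma>\<^sup>Q\<close> (\<open>harnack\<close>).
\<close>

section \<open>Second derivatives of functions of one variable\<close>

text \<open>The second derivative at \<open>0\<close>. It will be applied to restrictions of functions to curves that pass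
  through a given point at time \<open>0\<close>; this keeps the comparison argument free of differentiability in
  several variables.\<close>

definition has_second_deriv :: "(real \<Rightarrow> real) \<Rightarrow> real \<Rightarrow> bool" where
  "has_second_deriv f D \<longleftrightarrow>
     (\<exists>g. (\<forall>\<^sub>F t in nhds 0. (f has_real_derivative g t) (at t)) \<and>
          (g has_real_derivative D) (at 0))"

lemma has_second_deriv_const: "has_second_deriv (\<lambda>t. c) 0"
  unfolding has_second_deriv_def by (rule exI[of _ "\<lambda>t. 0"]) auto

lemma has_second_deriv_add:
  assumes "has_second_deriv f D" "has_second_deriv h E"
  shows "has_second_deriv (\<lambda>t. f t + h t) (D + E)"
proof -
  obtain f' h' where *: "\<forall>\<^sub>F t in nhds 0. (f has_real_derivative f' t) (at t)"
    "(f' has_real_derivative D) (at 0)"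
    "\<forall>\<^sub>F t in nhds 0. (h has_real_derivative h' t) (at t)"
    "(h' has_real_derivative E) (at 0)"
    using assms unfolding has_second_deriv_def by blast
  show ?thesis unfolding has_second_deriv_def
  proof (intro exI conjI)
    show "\<forall>\<^sub>F t in nhds 0. ((\<lambda>t. f t + h t) has_real_derivative f' t + h' t) (at t)"
      using *(1) *(3) by eventually_elim (rule DERIV_add)
    show "((\<lambda>t. f' t + h' t) has_real_derivative D + E) (at 0)"
      using *(2) *(4) by (rule DERIV_add)
  qed
qed

lemma has_second_deriv_cmult:
  assumes "has_second_deriv f D"
  shows "has_second_deriv (\<lambda>t. c * f t) (c * D)"
proof -
  obtain f' where *: "\<forall>\<^sub>F t in nhds 0. (f has_real_derivative f' t) (at t)"
    "(f' has_real_derivative D) (at 0)"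
    using assms unfolding has_second_deriv_def by blast
  show ?thesis unfolding has_second_deriv_def
  proof (intro exI conjI)
    show "\<forall>\<^sub>F t in nhds 0. ((\<lambda>t. c * f t) has_real_derivative c * f' t) (at t)"
      using *(1) by eventually_elim (rule DERIV_cmult)
    show "((\<lambda>t. c * f' t) has_real_derivative c * D) (at 0)"
      using *(2) by (rule DERIV_cmult)
  qed
qed

lemma has_second_deriv_sum:
  assumes "\<And>k. k \<in> S \<Longrightarrow> has_second_deriv (f k) (D k)"
  shows "has_second_deriv (\<lambda>t. \<Sum>k\<in>S. f k t) (\<Sum>k\<in>S. D k)"
  using assms
  by (induction S rule: infinite_finite_induct)
    (auto intro: has_second_deriv_const has_second_deriv_add)

lemma has_second_deriv_local_max:
  assumes "has_second_deriv f D" and max: "\<forall>\<^sub>F t in nhds 0. f t \<le> f 0"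
  shows "D \<le> 0"
proof (rule ccontr)
  assume "\<not> D \<le> 0"
  then have D: "D > 0" by simp
  obtain f' where f': "\<forall>\<^sub>F t in nhds 0. (f has_real_derivative f' t) (at t)"
    and D': "(f' has_real_derivative D) (at 0)"
    using assms unfolding has_second_deriv_def by blast
  obtain e where e: "e > 0" "\<And>t. \<bar>t\<bar> < e \<Longrightarrow> (f has_real_derivative f' t) (at t)"
    "\<And>t. \<bar>t\<bar> < e \<Longrightarrow> f t \<le> f 0"
    using eventually_conj[OF f' max] unfolding eventually_nhds_metric by (auto simp: dist_real_def)
  have "f' 0 = 0"
    using DERIV_local_max[OF e(2)[of 0] e(1)] e by auto
  obtain d where d: "d > 0" "\<And>h. 0 < h \<Longrightarrow> h < d \<Longrightarrow> f' 0 < f' (0 + h)"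
    using DERIV_pos_inc_right[OF D' D] by blast
  define h where "h = min d e / 2"
  have h: "0 < h" "h < d" "h < e" using d e by (auto simp: h_def)
  have "\<exists>z>0. z < h \<and> f h - f 0 = (h - 0) * f' z"
    using h by (intro MVT2) (auto intro!: e(2))
  then obtain z where z: "0 < z" "z < h" "f h - f 0 = h * f' z" by auto
  then have "f h - f 0 > 0" using d(2)[of z] h \<open>f' 0 = 0\<close> by auto
  moreover have "f h \<le> f 0" using e(3)[of h] h by auto
  ultimately show False by simp
qed

text \<open>\<open>F\<close> stands for the fourth power of the gauge along a curve; of its coefficients only those of order
  up to two reach the second derivative at \<open>0\<close>.\<close>

lemma has_second_deriv_powr:
  fixes F0 F1 F2 F3 F4 a :: real
  assumes "F0 > 0"
  defines "F \<equiv> \<lambda>t. F0 + F1 * t + F2 * t^2 + F3 * t^3 + F4 * t^4"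
  shows "has_second_deriv (\<lambda>t. F t powr (-a))
          (a * F0 powr (-a - 2) * ((a + 1) * F1\<^sup>2 - F0 * (2 * F2)))"
proof -
  define F' where "F' = (\<lambda>t. F1 + 2 * F2 * t + 3 * F3 * t^2 + 4 * F4 * t^3)"
  have dF: "(F has_real_derivative F' t) (at t)" for t
    unfolding F_def F'_def by (auto intro!: derivative_eq_intros simp: field_simps power2_eq_square power3_eq_cube)
  have dF': "(F' has_real_derivative 2 * F2) (at 0)"
    unfolding F'_def by (auto intro!: derivative_eq_intros)
  have F0: "F 0 = F0" "F' 0 = F1" by (auto simp: F_def F'_def)
  have "isCont F 0" using dF DERIV_isCont by blast
  then have "\<forall>\<^sub>F t in nhds 0. F t > 0"
    using assms(1) F0 unfolding isCont_def
    by (metis order_tendstoD(1) tendsto_at_iff_tendsto_nhds)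
  then have 1: "\<forall>\<^sub>F t in nhds 0. ((\<lambda>t. F t powr (-a)) has_real_derivative
        (-a) * F t powr (-a - 1) * F' t) (at t)"
    by eventually_elim (auto intro!: derivative_eq_intros dF)
  have 2: "((\<lambda>t. (-a) * F t powr (-a - 1) * F' t) has_real_derivative
     a * F0 powr (-a - 2) * ((a + 1) * F1\<^sup>2 - F0 * (2 * F2))) (at 0)"
  proof -
    have "((\<lambda>t. (-a) * F t powr (-a - 1) * F' t) has_real_derivative
      (-a) * ((-a - 1) * F 0 powr (-a - 1 - 1) * F' 0) * F' 0 + (-a) * F 0 powr (-a - 1) * (2 * F2)) (at 0)"
      using assms(1) F0 by (auto intro!: derivative_eq_intros dF dF' simp: )
    moreover have "F0 powr (-a - 1) = F0 powr (-a - 2) * F0"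
    proof -
      have "-a - 1 = (-a - 2) + 1" by simp
      then show ?thesis using assms(1) by (simp only: powr_add) simp
    qed
    ultimately show ?thesis unfolding F0 by (simp add: algebra_simps power2_eq_square)
  qed
  show ?thesis unfolding has_second_deriv_def
    by (intro exI[of _ "\<lambda>t. (-a) * F t powr (-a - 1) * F' t"] conjI 1 2)
qed

lemma has_second_deriv_quadratic: "has_second_deriv (\<lambda>t. a + b * t + c * t\<^sup>2) (2 * c)"
  unfolding has_second_deriv_def
  by (rule exI[of _ "\<lambda>t. b + 2 * c * t"]) (auto intro!: derivative_eq_intros always_eventually)

section \<open>Positive semidefinite forms and measurable partitions\<close>

text \<open>Gaussian elimination. If \<open>P e e > 0\<close>, subtracting the square of \<open>P e x / sqrt (P e e)\<close> completes
  the square in the direction \<open>e\<close>, so the rest is still positive semidefinite and now vanishes on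
  \<open>e\<close>; if \<open>P e e = 0\<close>, semidefiniteness already makes \<open>P\<close> vanish on \<open>e\<close>. Indexing the vectors by the
  pivots \<open>e \<in> Basis\<close> makes the same lemma a square root \<open>P x y = M x \<bullet> M y\<close> of the form, with values in the
  space itself.\<close>

lemma psd_form_sum_of_squares:
  fixes P :: "'a::euclidean_space \<Rightarrow> 'a \<Rightarrow> real"
  assumes bil: "bilinear P" and sym: "\<And>x y. P x y = P y x" and psd: "\<And>x. P x x \<ge> 0"
  shows "\<exists>b. \<forall>x y. P x y = (\<Sum>e\<in>(Basis::'a set). (b e \<bullet> x) * (b e \<bullet> y))"
proof -
  have "\<exists>b. \<forall>x y. P x y = (\<Sum>e\<in>S. (b e \<bullet> x) * (b e \<bullet> y))"
    if "finite S" "(S::'a set) \<subseteq> Basis" "\<And>e y. e \<in> Basis - S \<Longrightarrow> P e y = 0"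
      "bilinear P" "\<And>x y. P x y = P y x" "\<And>x. P x x \<ge> 0"
    for S and P :: "'a \<Rightarrow> 'a \<Rightarrow> real"
    using that
  proof (induction S arbitrary: P rule: finite_induct)
    case empty
    have "P x y = 0" for x y
    proof -
      have "linear (\<lambda>x. P x y)" using \<open>bilinear P\<close> unfolding bilinear_def by blast
      moreover have "P e y = 0" if "e \<in> Basis" for e using empty.prems(2) that by simp
      ultimately show ?thesis by (metis (mono_tags) linear_eq_stdbasis[of "\<lambda>x. P x y" "\<lambda>x. 0"] linear_zero)
    qed
    then show ?case by auto
  next
    case (insert e S)
    note P = \<open>bilinear P\<close>
    have lin1: "linear (\<lambda>x. P x y)" and lin2: "linear (P x)" for x y
      using P unfolding bilinear_def by blast+
    note simps = linear_add[OF lin1] linear_add[OF lin2] linear_cmul[OF lin1] linear_cmul[OF lin2]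
      linear_diff[OF lin1] linear_diff[OF lin2]
    have sy: "P x y = P y x" for x y by fact
    have ps: "P x x \<ge> 0" for x by fact
    have eB: "e \<in> Basis" using insert.prems by auto
    have sq: "P (x + t *\<^sub>R e) (x + t *\<^sub>R e) = P x x + 2 * t * P e x + t\<^sup>2 * P e e" for x t
      by (simp add: simps sy[of x e] power2_eq_square algebra_simps)
    show ?case
    proof (cases "P e e = 0")
      case True
      have e0: "P e y = 0" for y
      proof (rule ccontr)
        assume "P e y \<noteq> 0"
        (* P is affine in t along y + t e, hence negative for this t unless its slope is zero *)
        moreover have "0 \<le> P y y + 2 * (- (P y y + 1) / (2 * P e y)) * P e y"
          using ps[of "y + (- (P y y + 1) / (2 * P e y)) *\<^sub>R e"] sq True by simp
        ultimately show False by (simp add: field_simps)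
      qed
      have "\<exists>b. \<forall>x y. P x y = (\<Sum>e\<in>S. (b e \<bullet> x) * (b e \<bullet> y))"
      proof (rule insert.IH)
        show "P e' y = 0" if "e' \<in> Basis - S" for e' y
          using that insert.prems(2) e0 by (cases "e' = e") auto
      qed (use insert.prems in auto)
      then obtain b where b: "\<And>x y. P x y = (\<Sum>e\<in>S. (b e \<bullet> x) * (b e \<bullet> y))" by blast
      have "P x y = (\<Sum>i\<in>insert e S. ((b(e := 0)) i \<bullet> x) * ((b(e := 0)) i \<bullet> y))" for x y
      proof -
        have "(\<Sum>i\<in>insert e S. ((b(e := 0)) i \<bullet> x) * ((b(e := 0)) i \<bullet> y))
            = (\<Sum>i\<in>S. ((b(e := 0)) i \<bullet> x) * ((b(e := 0)) i \<bullet> y))"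
          using insert.hyps by (subst sum.insert) auto
        also have "\<dots> = P x y"
          unfolding b using insert.hyps by (intro sum.cong) auto
        finally show ?thesis ..
      qed
      then show ?thesis by blast
    next
      case False
      with ps[of e] have pos: "P e e > 0" by simp
      define P' where "P' = (\<lambda>x y. P x y - P e x * P e y / P e e)"
      have "bilinear P'"
        unfolding bilinear_def P'_def
        by (auto intro!: linearI simp: simps add_divide_distrib diff_divide_distrib algebra_simps)
      moreover have "P' x x \<ge> 0" for x
      proof -
        have "P' x x = P (x + (- P e x / P e e) *\<^sub>R e) (x + (- P e x / P e e) *\<^sub>R e)"
          using pos unfolding sq P'_def by (simp add: field_simps power2_eq_square)
        then show ?thesis using ps by simp
      qed
      moreover have "P' e' y = 0" if "e' \<in> Basis - S" for e' y
      proof (cases "e' = e")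
        case True then show ?thesis using pos by (simp add: P'_def)
      next
        case False
        then have "P e' z = 0" for z using insert.prems(2) that by auto
        then show ?thesis by (simp add: P'_def sy[of e e'])
      qed
      moreover have "P' x y = P' y x" for x y unfolding P'_def using sy by simp
      ultimately have "\<exists>b. \<forall>x y. P' x y = (\<Sum>e\<in>S. (b e \<bullet> x) * (b e \<bullet> y))"
        using insert.prems(1) by (intro insert.IH) auto
      then obtain b where b: "\<And>x y. P' x y = (\<Sum>e\<in>S. (b e \<bullet> x) * (b e \<bullet> y))" by blast
      define b0 where "b0 = (\<Sum>i\<in>Basis. (P e i / sqrt (P e e)) *\<^sub>R i)"
      have b0: "b0 \<bullet> x = P e x / sqrt (P e e)" for x
      proof -
        have "P e x = P e (\<Sum>i\<in>Basis. (x \<bullet> i) *\<^sub>R i)" by (simp add: euclidean_representation)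
        also have "\<dots> = (\<Sum>i\<in>Basis. (x \<bullet> i) * P e i)"
          by (simp add: linear_sum[OF lin2] simps)
        finally show ?thesis unfolding b0_def
          by (simp add: inner_sum_left sum_divide_distrib inner_commute[of x] mult.commute)
      qed
      have "P x y = (\<Sum>i\<in>insert e S. ((b(e := b0)) i \<bullet> x) * ((b(e := b0)) i \<bullet> y))" for x y
      proof -
        have "(\<Sum>i\<in>insert e S. ((b(e := b0)) i \<bullet> x) * ((b(e := b0)) i \<bullet> y))
            = (b0 \<bullet> x) * (b0 \<bullet> y) + P' x y"
          using insert.hyps unfolding b by (auto intro!: sum.cong)
        then show ?thesis unfolding b0 P'_def using pos by simp
      qed
      then show ?thesis by blast
    qed
  qed
  from this[OF finite_Basis subset_refl _ bil sym psd] show ?thesis by simp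
qed


lemma finite_measurable_partition:
  assumes "finite Y" "K \<in> sets M" "\<And>y. y \<in> Y \<Longrightarrow> U y \<in> sets M" "K \<subseteq> (\<Union>y\<in>Y. U y)"
  shows "\<exists>P. (\<forall>y\<in>Y. P y \<in> sets M \<and> P y \<subseteq> K \<inter> U y) \<and> disjoint_family_on P Y \<and> (\<Union>y\<in>Y. P y) = K"
  using assms
proof (induction Y arbitrary: K rule: finite_induct)
  case empty
  then show ?case by (auto simp: disjoint_family_on_def)
next
  case (insert a Y)
  have "\<exists>P. (\<forall>y\<in>Y. P y \<in> sets M \<and> P y \<subseteq> (K - U a) \<inter> U y) \<and> disjoint_family_on P Y \<and>
      (\<Union>y\<in>Y. P y) = K - U a"
    using insert.prems by (intro insert.IH) auto
  then obtain P where P: "\<And>y. y \<in> Y \<Longrightarrow> P y \<in> sets M" "\<And>y. y \<in> Y \<Longrightarrow> P y \<subseteq> (K - U a) \<inter> U y"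
    "disjoint_family_on P Y" "(\<Union>y\<in>Y. P y) = K - U a" by blast
  define P' where "P' = P(a := K \<inter> U a)"
  have "\<forall>y\<in>insert a Y. P' y \<in> sets M \<and> P' y \<subseteq> K \<inter> U y"
    using P insert.prems by (auto simp: P'_def)
  moreover have "disjoint_family_on P' (insert a Y)"
    using P(2,3) insert.hyps unfolding P'_def disjoint_family_on_def by auto
  moreover have "(\<Union>y\<in>insert a Y. P' y) = K"
  proof -
    have "(\<Union>y\<in>Y. P' y) = (\<Union>y\<in>Y. P y)" using insert.hyps unfolding P'_def by (intro SUP_cong) auto
    then show ?thesis using P(4) by (auto simp: P'_def)
  qed
  ultimately show ?case by blast
qed

section \<open>H-type groups in exponential coordinates\<close>

text \<open>An H-type algebra \<open>'a \<oplus> 'b\<close>, horizontal layer and centre, with orthonormal coordinates on both.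
  The map \<open>J z\<close> for \<open>z\<close> of arbitrary length is the orthogonal map of \<open>z / |z|\<close> scaled by \<open>|z|\<close>.\<close>

locale htype =
  fixes br :: "'a::euclidean_space \<Rightarrow> 'a \<Rightarrow> 'b::euclidean_space"
    and J :: "'b \<Rightarrow> 'a \<Rightarrow> 'a"
  assumes bilinear_br: "bilinear br"
    and br_self: "br v v = 0"
    and J_adj: "J z v \<bullet> w = z \<bullet> br v w"
    and norm_J: "norm (J z v) = norm z * norm v"
begin

lemma bounded_bilinear_br: "bounded_bilinear br"
  using bilinear_br bilinear_conv_bounded_bilinear by blast

sublocale br: bounded_bilinear br by (rule bounded_bilinear_br)

lemma br_anti: "br w v = - br v w"
proof -
  have "br w v + br v w = 0"
    using br_self[of "v + w"] unfolding br.add_left br.add_right by (simp add: br_self[of v] br_self[of w])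
  then show ?thesis by (simp only: eq_neg_iff_add_eq_0)
qed

lemma J_orthogonal: "J z v \<bullet> v = 0"
  by (simp add: J_adj br_self)

text \<open>With \<open>z = br v w\<close> the vectors \<open>v\<close> and \<open>J z v\<close> are orthogonal and \<open>w \<bullet> J z v = |z|\<^sup>2\<close>, so this is Bessel's
  inequality for \<open>w\<close>. The vector \<open>p\<close> in the proof is \<open>|v|\<^sup>2\<close> times the component of \<open>w\<close> orthogonal to
  both.\<close>

lemma inner_square_plus_br_square: "(v \<bullet> w)\<^sup>2 + (norm (br v w))\<^sup>2 \<le> (norm v)\<^sup>2 * (norm w)\<^sup>2"
proof (cases "v = 0")
  case True then show ?thesis by (simp add: br.zero_left)
next
  case False
  define z where "z = br v w"
  define a where "a = (norm v)\<^sup>2"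
  have a: "a > 0" using False by (simp add: a_def)
  have JJ: "J z v \<bullet> J z v = (z \<bullet> z) * a"
    by (metis dot_square_norm norm_J power_mult_distrib a_def)
  define p where "p = a *\<^sub>R w - (v \<bullet> w) *\<^sub>R v - J z v"
  have zz: "z \<bullet> z = (norm (br v w))\<^sup>2" by (simp add: z_def dot_square_norm)
  have Jw: "J z v \<bullet> w = z \<bullet> z" "w \<bullet> J z v = z \<bullet> z" by (auto simp: J_adj z_def inner_commute[of w])
  have Jv: "J z v \<bullet> v = 0" "v \<bullet> J z v = 0" by (auto simp: J_orthogonal inner_commute[of v])
  have vv: "v \<bullet> v = a" by (simp add: a_def dot_square_norm)
  have "p \<bullet> p = a * (a * (w \<bullet> w) - (v \<bullet> w)\<^sup>2 - z \<bullet> z)"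
    unfolding p_def
    by (simp add: inner_diff_left inner_diff_right Jw Jv JJ vv inner_commute[of w v] power2_eq_square algebra_simps)
  moreover have "p \<bullet> p \<ge> 0" by simp
  ultimately have "a * (w \<bullet> w) - (v \<bullet> w)\<^sup>2 - z \<bullet> z \<ge> 0"
    using a by (simp add: zero_le_mult_iff)
  then show ?thesis using zz by (simp add: a_def dot_square_norm)
qed

definition gmul :: "'a \<times> 'b \<Rightarrow> 'a \<times> 'b \<Rightarrow> 'a \<times> 'b" where
  "gmul x y = (fst x + fst y, snd x + snd y + (1/2) *\<^sub>R br (fst x) (fst y))"

text \<open>The number \<open>(|v|\<^sup>4 + 16 |z|\<^sup>2)\<^bsup>1/4\<^esup>\<close>, written as the square root of a Euclidean norm: in this form
  the triangle inequality for the gauge comes from the one for that norm.\<close>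

definition gnorm :: "'a \<times> 'b \<Rightarrow> real" where
  "gnorm p = sqrt (norm ((norm (fst p))\<^sup>2, 4 *\<^sub>R snd p))"

definition gdist :: "'a \<times> 'b \<Rightarrow> 'a \<times> 'b \<Rightarrow> real" where
  "gdist x y = gnorm (gmul (- x) y)"

definition gball :: "'a \<times> 'b \<Rightarrow> real \<Rightarrow> ('a \<times> 'b) set" where
  "gball x r = {y. gdist x y < r}"

definition gcball :: "'a \<times> 'b \<Rightarrow> real \<Rightarrow> ('a \<times> 'b) set" where
  "gcball x r = {y. gdist x y \<le> r}"

lemma gmul_assoc: "gmul (gmul x y) z = gmul x (gmul y z)"
  by (simp add: gmul_def br.add_left br.add_right algebra_simps)

lemma gmul_minus_cancel [simp]: "gmul (- x) (gmul x y) = y" "gmul x (gmul (- x) y) = y"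
  by (simp_all add: gmul_def br.add_right br.minus_left br.minus_right br.diff_right br_self prod_eq_iff)

lemma gmul_zero [simp]: "gmul 0 x = x" "gmul x 0 = x"
  by (simp_all add: gmul_def br.zero_left br.zero_right prod_eq_iff)

lemma gmul_minus_self [simp]: "gmul (- x) x = 0" "gmul x (- x) = 0"
  by (simp_all add: gmul_def br.minus_left br.minus_right br_self prod_eq_iff)

lemma minus_gmul: "- gmul x y = gmul (- y) (- x)"
  using br_anti[of "fst x" "fst y"]
  by (simp add: gmul_def br.minus_left br.minus_right prod_eq_iff algebra_simps)

lemma gnorm_nonneg [simp]: "gnorm p \<ge> 0" by (simp add: gnorm_def)

lemma gnorm_power4: "gnorm p ^ 4 = (norm (fst p)) ^ 4 + 16 * (norm (snd p))\<^sup>2"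
proof -
  have "gnorm p ^ 4 = (gnorm p ^ 2) ^ 2" by simp
  also have "\<dots> = (norm (fst p)) ^ 4 + 16 * (norm (snd p))\<^sup>2"
    unfolding gnorm_def by (simp add: norm_Pair power_mult_distrib flip: power_mult)
  finally show ?thesis .
qed

lemma gnorm_zero [simp]: "gnorm 0 = 0" by (simp add: gnorm_def flip: zero_prod_def)

lemma gnorm_eq_0_iff [simp]: "gnorm p = 0 \<longleftrightarrow> p = 0"
  by (auto simp: gnorm_def prod_eq_iff)

lemma gnorm_minus [simp]: "gnorm (- p) = gnorm p"
  by (simp add: gnorm_def norm_Pair)

lemma norm_fst_le_gnorm: "norm (fst p) \<le> gnorm p"
proof -
  have "(norm (fst p))\<^sup>2 \<le> norm ((norm (fst p))\<^sup>2, 4 *\<^sub>R snd p)"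
    by (simp add: norm_Pair real_le_rsqrt)
  then show ?thesis unfolding gnorm_def using real_le_rsqrt by blast
qed

lemma norm_snd_le_gnorm: "4 * norm (snd p) \<le> (gnorm p)\<^sup>2"
proof -
  have "norm (4 *\<^sub>R snd p) \<le> norm ((norm (fst p))\<^sup>2, 4 *\<^sub>R snd p)"
    by (simp add: norm_Pair real_le_rsqrt)
  then show ?thesis unfolding gnorm_def by simp
qed

text \<open>Cygan's inequality. Sending \<open>(v, z)\<close> to \<open>(|v|\<^sup>2, 4 z)\<close> turns the product into a sum plus the cross term
  \<open>2 (v \<bullet> w, br v w)\<close>, whose norm is at most \<open>2 |v| |w|\<close> by the inequality above. It makes \<open>gdist\<close> a
  genuine metric, so that no quasi-metric constants appear later.\<close>

lemma gnorm_triangle: "gnorm (gmul x y) \<le> gnorm x + gnorm y"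
proof -
  define v w where "v = fst x" and "w = fst y"
  let ?P = "\<lambda>p::'a \<times> 'b. ((norm (fst p))\<^sup>2, 4 *\<^sub>R snd p)"
  have N: "norm (?P p) = (gnorm p)\<^sup>2" for p by (simp add: gnorm_def)
  have eq: "?P (gmul x y) = ?P x + ?P y + (2 * (v \<bullet> w), 2 *\<^sub>R br v w)"
    using inner_commute[of w v]
    by (simp add: gmul_def v_def[symmetric] w_def[symmetric] power2_norm_eq_inner
        inner_add_left inner_add_right scaleR_add_right)
  have "(gnorm (gmul x y))\<^sup>2 \<le> (gnorm x)\<^sup>2 + (gnorm y)\<^sup>2 + norm (2 * (v \<bullet> w), 2 *\<^sub>R br v w)"
    using norm_triangle_ineq[of "?P x + ?P y" "(2 * (v \<bullet> w), 2 *\<^sub>R br v w)"]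
      norm_triangle_ineq[of "?P x" "?P y"] unfolding N
    unfolding eq[symmetric] N by linarith
  also have "norm (2 * (v \<bullet> w), 2 *\<^sub>R br v w) = 2 * sqrt ((v \<bullet> w)\<^sup>2 + (norm (br v w))\<^sup>2)"
  proof -
    have "(2 * (v \<bullet> w), 2 *\<^sub>R br v w) = 2 *\<^sub>R (v \<bullet> w, br v w)" by simp
    then show ?thesis unfolding norm_Pair[symmetric] by (simp only: norm_scaleR) (simp add: norm_Pair)
  qed
  also have "sqrt ((v \<bullet> w)\<^sup>2 + (norm (br v w))\<^sup>2) \<le> norm v * norm w"
    using real_sqrt_le_mono[OF inner_square_plus_br_square[of v w]] by (simp add: real_sqrt_mult)
  also have "norm v * norm w \<le> gnorm x * gnorm y"
    unfolding v_def w_def by (intro mult_mono norm_fst_le_gnorm) auto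
  finally have "(gnorm (gmul x y))\<^sup>2 \<le> (gnorm x + gnorm y)\<^sup>2"
    by (simp add: power2_sum)
  then show ?thesis by (simp add: power2_le_iff_abs_le)
qed

lemma gdist_nonneg [simp]: "gdist x y \<ge> 0" by (simp add: gdist_def)

lemma gdist_self [simp]: "gdist x x = 0" by (simp add: gdist_def)

lemma gdist_sym: "gdist x y = gdist y x"
  unfolding gdist_def by (metis gnorm_minus minus_gmul minus_minus)

lemma gdist_triangle: "gdist x z \<le> gdist x y + gdist y z"
  unfolding gdist_def
  using gnorm_triangle[of "gmul (- x) y" "gmul (- y) z"] by (simp add: gmul_assoc)

lemma gdist_eq_0_iff [simp]: "gdist x y = 0 \<longleftrightarrow> x = y"
proof
  assume "gdist x y = 0"
  then have "gmul (- x) y = 0" by (simp add: gdist_def)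
  then have "gmul x (gmul (- x) y) = gmul x 0" by simp
  then show "x = y" by simp
qed simp

lemma continuous_gmul [continuous_intros]:
  assumes "continuous_on S f" "continuous_on S g"
  shows "continuous_on S (\<lambda>x. gmul (f x) (g x))"
  unfolding gmul_def using assms
  by (intro continuous_intros continuous_on_Pair br.continuous_on)

lemma continuous_gnorm [continuous_intros]:
  assumes "continuous_on S f"
  shows "continuous_on S (\<lambda>x. gnorm (f x))"
  unfolding gnorm_def using assms by (intro continuous_intros)

lemma continuous_gdist [continuous_intros]:
  assumes "continuous_on S f" "continuous_on S g"
  shows "continuous_on S (\<lambda>x. gdist (f x) (g x))"
  unfolding gdist_def using assms by (intro continuous_intros)

lemma open_gball: "open (gball x r)"
  unfolding gball_def by (intro open_Collect_less continuous_intros)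

lemma closed_gcball: "closed (gcball x r)"
  unfolding gcball_def by (intro closed_Collect_le continuous_intros)

lemma mem_gcball_iff: "y \<in> gcball x r \<longleftrightarrow> gmul (- x) y \<in> gcball 0 r"
  by (simp add: gcball_def gdist_def)

lemma compact_gcball: "compact (gcball x r)"
proof -
  have "gcball 0 r \<subseteq> cball 0 r \<times> cball 0 (r\<^sup>2)"
  proof
    fix p assume p: "p \<in> gcball (0::'a \<times> 'b) r"
    then have "gnorm p \<le> r" by (simp add: gcball_def gdist_def)
    moreover have "(gnorm p)\<^sup>2 \<le> r\<^sup>2" using calculation by (intro power_mono) auto
    moreover have "norm (snd p) \<le> (gnorm p)\<^sup>2"
      using norm_snd_le_gnorm[of p] norm_ge_zero[of "snd p"] by linarith
    ultimately show "p \<in> cball 0 r \<times> cball 0 (r\<^sup>2)"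
      using norm_fst_le_gnorm[of p] by (auto simp: mem_Times_iff)
  qed
  moreover have "bounded (cball (0::'a) r \<times> cball (0::'b) (r\<^sup>2))" by (intro bounded_Times bounded_cball)
  ultimately have "bounded (gcball (0::'a \<times> 'b) r)" using bounded_subset by blast
  then have c: "compact (gcball (0::'a \<times> 'b) r)" using closed_gcball compact_eq_bounded_closed by blast
  have "gcball x r = gmul x ` gcball 0 r"
  proof (intro equalityI subsetI)
    fix y assume "y \<in> gcball x r"
    then show "y \<in> gmul x ` gcball 0 r" using mem_gcball_iff gmul_minus_cancel(2) by (metis image_eqI)
  next
    fix y assume "y \<in> gmul x ` gcball 0 r"
    then show "y \<in> gcball x r" by (subst mem_gcball_iff) auto
  qed
  moreover have "continuous_on (gcball 0 r) (gmul x)" by (intro continuous_intros)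
  ultimately show ?thesis using compact_continuous_image[OF _ c] by simp
qed

section \<open>The volume of gauge balls\<close>

text \<open>A left translation is a translation of the horizontal layer followed, over each horizontal point,
  by a translation of the centre; Fubini's theorem shows that both preserve Lebesgue measure.\<close>

lemma nn_integral_gmul:
  fixes f :: "'a \<times> 'b \<Rightarrow> ennreal"
  assumes [measurable]: "f \<in> borel_measurable borel"
  shows "(\<integral>\<^sup>+x. f (gmul a x) \<partial>lborel) = (\<integral>\<^sup>+x. f x \<partial>lborel)"
proof -
  have tr: "(\<integral>\<^sup>+w. h (c + w) \<partial>lborel) = (\<integral>\<^sup>+w. h w \<partial>lborel)"
    if [measurable]: "h \<in> borel_measurable borel" for h :: "'c::euclidean_space \<Rightarrow> ennreal" and c
    by (subst (2) lborel_distr_plus[of c, symmetric]) (simp add: nn_integral_distr)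
  have [measurable]: "gmul a \<in> borel \<rightarrow>\<^sub>M borel"
    by (intro borel_measurable_continuous_onI continuous_intros)
  have pm [measurable]: "(\<lambda>w. (v, w)) \<in> borel \<rightarrow>\<^sub>M (borel :: ('a \<times> 'b) measure)" for v
    by (intro borel_measurable_continuous_onI continuous_intros)
  have fm: "g \<in> borel_measurable (lborel \<Otimes>\<^sub>M lborel)" if "g \<in> borel_measurable borel"
    for g :: "'a \<times> 'b \<Rightarrow> ennreal"
    using that by (simp add: lborel_prod)
  have "(\<integral>\<^sup>+x. f (gmul a x) \<partial>lborel) = (\<integral>\<^sup>+v. \<integral>\<^sup>+w. f (gmul a (v, w)) \<partial>lborel \<partial>lborel)"
    by (subst lborel_prod[symmetric], subst lborel.nn_integral_fst[symmetric])
      (auto intro!: fm)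
  also have "\<dots> = (\<integral>\<^sup>+v. \<integral>\<^sup>+w. f (fst a + v, (snd a + (1/2) *\<^sub>R br (fst a) v) + w) \<partial>lborel \<partial>lborel)"
    by (simp add: gmul_def add.assoc add.commute add.left_commute)
  also have "\<dots> = (\<integral>\<^sup>+v. \<integral>\<^sup>+w. f (fst a + v, w) \<partial>lborel \<partial>lborel)"
    by (intro nn_integral_cong tr) measurable
  also have "\<dots> = (\<integral>\<^sup>+v. \<integral>\<^sup>+w. f (v, w) \<partial>lborel \<partial>lborel)"
  proof (rule tr)
    show "(\<lambda>v. \<integral>\<^sup>+w. f (v, w) \<partial>lborel) \<in> borel_measurable borel"
      using lborel.borel_measurable_nn_integral_fst[OF fm[OF assms]] by simp
  qed
  also have "\<dots> = (\<integral>\<^sup>+x. f x \<partial>lborel)"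
    by (subst lborel_prod[symmetric], subst lborel.nn_integral_fst[symmetric])
      (auto intro!: fm)
  finally show ?thesis .
qed

definition gdil :: "real \<Rightarrow> 'a \<times> 'b \<Rightarrow> 'a \<times> 'b" where
  "gdil t p = (t *\<^sub>R fst p, t\<^sup>2 *\<^sub>R snd p)"

lemma gnorm_gdil: "t \<ge> 0 \<Longrightarrow> gnorm (gdil t p) = t * gnorm p"
proof -
  assume t: "t \<ge> 0"
  have "((norm (fst (gdil t p)))\<^sup>2, 4 *\<^sub>R snd (gdil t p)) = t\<^sup>2 *\<^sub>R ((norm (fst p))\<^sup>2, 4 *\<^sub>R snd p)"
    by (simp add: gdil_def power_mult_distrib)
  then show ?thesis using t by (simp add: gnorm_def real_sqrt_mult del: scaleR_Pair)
qed

lemma nn_integral_gdil: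
  fixes f :: "'a \<times> 'b \<Rightarrow> ennreal"
  assumes [measurable]: "f \<in> borel_measurable borel" and t: "t > 0"
  shows "(\<integral>\<^sup>+x. f x \<partial>lborel) = ennreal (t ^ (DIM('a) + 2 * DIM('b))) * (\<integral>\<^sup>+x. f (gdil t x) \<partial>lborel)"
proof -
  define c :: "'a \<times> 'b \<Rightarrow> real" where "c = (\<lambda>j. if fst j = 0 then t\<^sup>2 else t)"
  have T: "gdil t p = 0 + (\<Sum>j\<in>Basis. (c j * (p \<bullet> j)) *\<^sub>R j)" for p
  proof (rule euclidean_eqI)
    fix b :: "'a \<times> 'b" assume b: "b \<in> Basis"
    have "(0 + (\<Sum>j\<in>Basis. (c j * (p \<bullet> j)) *\<^sub>R j)) \<bullet> b = c b * (p \<bullet> b)"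
      using b by (simp add: inner_sum_left inner_Basis if_distrib cong: if_cong)
    also have "\<dots> = gdil t p \<bullet> b"
      using b by (auto simp: Basis_prod_def c_def gdil_def inner_prod_def)
    finally show "gdil t p \<bullet> b = (0 + (\<Sum>j\<in>Basis. (c j * (p \<bullet> j)) *\<^sub>R j)) \<bullet> b" by simp
  qed
  have inj: "inj_on (\<lambda>u. (u, 0)) (Basis::'a set)" "inj_on (\<lambda>u. (0, u)) (Basis::'b set)"
    by (auto simp: inj_on_def)
  have "(\<Prod>j\<in>(Basis::('a \<times> 'b) set). \<bar>c j\<bar>) = t ^ (DIM('a) + 2 * DIM('b))"
    unfolding Basis_prod_def
    using t by (subst prod.union_disjoint)
       (auto simp: prod.reindex inj c_def power_add power_mult nonzero_Basis cong: prod.cong_simp)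
  then have L: "lborel = density (distr lborel borel (gdil t)) (\<lambda>_. ennreal (t ^ (DIM('a) + 2 * DIM('b))))"
    using lborel_affine_euclidean[of c 0] t unfolding T[symmetric] by (simp add: c_def T[abs_def])
  have [measurable]: "gdil t \<in> borel \<rightarrow>\<^sub>M borel"
    unfolding gdil_def by (intro borel_measurable_continuous_onI continuous_intros)
  show ?thesis
    by (subst L) (simp add: nn_integral_density nn_integral_distr nn_integral_cmult)
qed

lemma gcball_borel [measurable]: "gcball x r \<in> sets borel"
  using closed_gcball by (rule borel_closed)

definition unit_vol :: real where "unit_vol = measure lborel (gcball (0::'a \<times> 'b) 1)"

lemma emeasure_gcball:
  assumes "r > 0"
  shows "emeasure lborel (gcball x r) = ennreal (unit_vol * r ^ (DIM('a) + 2 * DIM('b)))"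
proof -
  have fin: "emeasure lborel (gcball (0::'a \<times> 'b) 1) \<noteq> \<infinity>"
    using emeasure_lborel_cbox_finite emeasure_compact_finite[OF compact_gcball] by (simp add: less_top)
  have "emeasure lborel (gcball x r) = (\<integral>\<^sup>+y. indicator (gcball x r) y \<partial>lborel)" by simp
  also have "\<dots> = (\<integral>\<^sup>+y. indicator (gcball 0 r) (gmul (- x) y) \<partial>lborel)"
    by (intro nn_integral_cong) (simp add: indicator_def mem_gcball_iff[symmetric])
  also have "\<dots> = (\<integral>\<^sup>+y. indicator (gcball 0 r) y \<partial>lborel)"
    by (rule nn_integral_gmul) measurable
  also have "\<dots> = ennreal (r ^ (DIM('a) + 2 * DIM('b))) * (\<integral>\<^sup>+y. indicator (gcball 0 r) (gdil r y) \<partial>lborel)"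
    by (rule nn_integral_gdil) (use assms in auto)
  also have "(\<integral>\<^sup>+y. indicator (gcball 0 r) (gdil r y) \<partial>lborel) = (\<integral>\<^sup>+y. indicator (gcball 0 1) y \<partial>lborel)"
    using assms by (intro nn_integral_cong)
      (auto simp: indicator_def gcball_def gdist_def gnorm_gdil mult_le_cancel_left1)
  also have "\<dots> = ennreal unit_vol"
    using fin unfolding unit_vol_def by (simp add: emeasure_eq_ennreal_measure)
  finally show ?thesis
    using assms ennreal_mult[of unit_vol "r ^ (DIM('a) + 2 * DIM('b))"]
    by (simp add: unit_vol_def mult.commute)
qed

lemma unit_vol_pos: "unit_vol > 0"
proof -
  have "emeasure lborel (gball (0::'a \<times> 'b) 1) > 0"
  proof -
    have "(0::'a \<times> 'b) \<in> gball 0 1" by (simp add: gball_def)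
    then have "\<not> negligible (gball (0::'a \<times> 'b) 1)" using open_not_negligible[OF open_gball] by blast
    then show ?thesis
      using open_gball[of 0 1] by (auto simp: negligible_iff_emeasure0 zero_less_iff_neq_zero)
  qed
  also have "\<dots> \<le> emeasure lborel (gcball (0::'a \<times> 'b) 1)"
    by (rule emeasure_mono) (simp_all add: gcball_borel, auto simp: gball_def gcball_def)
  finally show ?thesis using emeasure_gcball[of 1 0] by simp
qed

section \<open>The barrier and the comparison argument\<close>

text \<open>The equation \<open>\<Sum> a\<^sub>i\<^sub>j X\<^sub>i X\<^sub>j u = 0\<close> at the point \<open>x\<close>, together with the Landis condition on the matrix. The
  matrix enters through vectors with \<open>A = \<Sum> b\<^sub>e b\<^sub>e\<^sup>T\<close>: then \<open>\<Sum> (b\<^sub>e \<bullet> \<xi>)\<^sup>2\<close> is its quadratic form, \<open>\<Sum> |b\<^sub>e|\<^sup>2\<close> its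
  trace, \<open>\<mu>\<close> and \<open>M\<close> are bounds for its spectrum, and the operator is the sum of the second derivatives in
  the directions \<open>b\<^sub>e\<close> along horizontal curves. The coefficient \<open>2n + 2\<close> is \<open>Q + 2 - m\<close>.\<close>

definition landis_solution :: "real \<Rightarrow> ('a \<times> 'b \<Rightarrow> real) \<Rightarrow> 'a \<times> 'b \<Rightarrow> bool" where
  "landis_solution \<delta> u x \<longleftrightarrow> (\<exists>b D (\<mu>::real) (M::real). 0 < \<mu> \<and>
     (\<forall>\<xi>. \<mu> * (norm \<xi>)\<^sup>2 \<le> (\<Sum>e\<in>(Basis::'a set). (b e \<bullet> \<xi>)\<^sup>2) \<and> (\<Sum>e\<in>Basis. (b e \<bullet> \<xi>)\<^sup>2) \<le> M * (norm \<xi>)\<^sup>2) \<and>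
     (\<Sum>e\<in>Basis. (norm (b e))\<^sup>2) + (2 * real DIM('b) + 2) * M \<le> (real DIM('a) + 2 * real DIM('b) + 4 - \<delta>) * \<mu> \<and>
     (\<forall>e\<in>Basis. has_second_deriv (\<lambda>t. u (gmul x (t *\<^sub>R b e, 0))) (D e)) \<and> (\<Sum>e\<in>Basis. D e) = 0)"

lemma landis_solution_const_minus:
  assumes "landis_solution \<delta> u x"
  shows "landis_solution \<delta> (\<lambda>y. c - u y) x"
proof -
  obtain b D \<mu> M where *: "0 < \<mu>"
     "\<forall>\<xi>. \<mu> * (norm \<xi>)\<^sup>2 \<le> (\<Sum>e\<in>(Basis::'a set). (b e \<bullet> \<xi>)\<^sup>2) \<and> (\<Sum>e\<in>Basis. (b e \<bullet> \<xi>)\<^sup>2) \<le> M * (norm \<xi>)\<^sup>2"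
     "(\<Sum>e\<in>Basis. (norm (b e))\<^sup>2) + (2 * real DIM('b) + 2) * M \<le> (real DIM('a) + 2 * real DIM('b) + 4 - \<delta>) * \<mu>"
     and D: "\<And>e. e \<in> Basis \<Longrightarrow> has_second_deriv (\<lambda>t. u (gmul x (t *\<^sub>R b e, 0))) (D e)" "(\<Sum>e\<in>Basis. D e) = 0"
    using assms unfolding landis_solution_def by blast
  have "has_second_deriv (\<lambda>t. c - u (gmul x (t *\<^sub>R b e, 0))) (- D e)" if "e \<in> Basis" for e
    using has_second_deriv_add[OF has_second_deriv_const[of c] has_second_deriv_cmult[OF D(1)[OF that], of "-1"]]
    by simp
  moreover have "(\<Sum>e\<in>Basis. - D e) = 0" using D(2) by (simp add: sum_negf)
  ultimately show ?thesis using * unfolding landis_solution_def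
    by (intro exI[of _ b] exI[of _ "\<lambda>e. - D e"] exI[of _ \<mu>] exI[of _ M]) blast
qed

lemma gnorm_power4_curve:
  "gnorm (gmul p (t *\<^sub>R w, 0)) ^ 4 =
     gnorm p ^ 4 + (4 * (norm (fst p))\<^sup>2 * (fst p \<bullet> w) + 16 * (snd p \<bullet> br (fst p) w)) * t
     + (4 * (fst p \<bullet> w)\<^sup>2 + 2 * (norm (fst p))\<^sup>2 * (norm w)\<^sup>2 + 4 * (norm (br (fst p) w))\<^sup>2) * t\<^sup>2
     + (4 * (fst p \<bullet> w) * (norm w)\<^sup>2) * t ^ 3 + ((norm w)\<^sup>2)\<^sup>2 * t ^ 4"
proof -
  define v z where "v = fst p" and "z = snd p"
  have 1: "(norm (v + t *\<^sub>R w))\<^sup>2 = (norm v)\<^sup>2 + 2 * t * (v \<bullet> w) + t\<^sup>2 * (norm w)\<^sup>2"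
    using inner_commute[of w v] unfolding power2_norm_eq_inner
    by (simp add: inner_add_left inner_add_right power2_eq_square algebra_simps)
  have 2: "(norm (z + (t/2) *\<^sub>R br v w))\<^sup>2 = (norm z)\<^sup>2 + t * (z \<bullet> br v w) + t\<^sup>2 / 4 * (norm (br v w))\<^sup>2"
    using inner_commute[of "br v w" z] unfolding power2_norm_eq_inner
    by (simp add: inner_add_left inner_add_right power2_eq_square algebra_simps)
  have "gnorm (gmul p (t *\<^sub>R w, 0)) ^ 4 = ((norm (v + t *\<^sub>R w))\<^sup>2)\<^sup>2 + 16 * (norm (z + (t/2) *\<^sub>R br v w))\<^sup>2"
    unfolding gnorm_power4 by (simp add: gmul_def v_def z_def br.scaleR_right flip: power_mult)
  also have "\<dots> = ((norm v)\<^sup>2)\<^sup>2 + 16 * (norm z)\<^sup>2 + (4 * (norm v)\<^sup>2 * (v \<bullet> w) + 16 * (z \<bullet> br v w)) * t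
     + (4 * (v \<bullet> w)\<^sup>2 + 2 * (norm v)\<^sup>2 * (norm w)\<^sup>2 + 4 * (norm (br v w))\<^sup>2) * t\<^sup>2
     + (4 * (v \<bullet> w) * (norm w)\<^sup>2) * t ^ 3 + ((norm w)\<^sup>2)\<^sup>2 * t ^ 4"
    unfolding 1 2 by algebra
  finally show ?thesis unfolding gnorm_power4 v_def z_def by (simp flip: power_mult)
qed

lemma gnorm_powr: "gnorm p powr (- s) = (gnorm p ^ 4) powr (- (s / 4))"
proof (cases "gnorm p = 0")
  case False
  then have "gnorm p > 0" using gnorm_nonneg[of p] by linarith
  then show ?thesis by (simp add: powr_powr flip: powr_numeral)
qed auto

text \<open>Let \<open>F = |v|\<^sup>4 + 16 |z|\<^sup>2\<close>. Its horizontal gradient is \<open>G = 4 |v|\<^sup>2 v + 16 J z v\<close>, and orthogonality of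
  \<open>J\<close> gives \<open>|G|\<^sup>2 = 16 |v|\<^sup>2 F\<close>. For the power \<open>F\<^bsup>-s/4\<^esup>\<close> to be a subsolution one needs
  \<open>F (\<Sum> F'') \<le> (s/4 + 1) (\<Sum> (F')\<^sup>2)\<close>. The right side is at least \<open>4 (s + 4) \<mu> |v|\<^sup>2 F\<close>, and the left side
  is at most \<open>4 |v|\<^sup>2 F (tr A + (2n + 2) M)\<close>: one \<open>2 M\<close> comes from \<open>(v \<bullet> b\<^sub>e)\<^sup>2\<close>, and \<open>2 n M\<close> from the \<open>n\<close> components
  of the brackets \<open>br v b\<^sub>e\<close>. The assumption \<open>landis\<close> is the inequality between
  these two bounds.\<close>

lemma barrier_subsolution:
  fixes b :: "'a \<Rightarrow> 'a"
  assumes p: "p \<noteq> 0" and s: "s \<ge> 0"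
    and lower: "\<And>\<xi>. \<mu> * (norm \<xi>)\<^sup>2 \<le> (\<Sum>e\<in>Basis. (b e \<bullet> \<xi>)\<^sup>2)"
    and upper: "\<And>\<xi>. (\<Sum>e\<in>Basis. (b e \<bullet> \<xi>)\<^sup>2) \<le> M * (norm \<xi>)\<^sup>2"
    and landis: "(\<Sum>e\<in>Basis. (norm (b e))\<^sup>2) + (2 * real DIM('b) + 2) * M \<le> (s + 4) * \<mu>"
  shows "\<exists>E. (\<forall>e\<in>Basis. has_second_deriv (\<lambda>t. gnorm (gmul p (t *\<^sub>R b e, 0)) powr (- s)) (E e)) \<and>
             0 \<le> (\<Sum>e\<in>Basis. E e)"
proof -
  define v z a F where "v = fst p" and "z = snd p" and "a = s / 4" and "F = gnorm p ^ 4"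
  have F: "F > 0" unfolding F_def using p gnorm_nonneg[of p] by (simp add: less_le)
  define F1 where "F1 = (\<lambda>e. 4 * (norm v)\<^sup>2 * (v \<bullet> b e) + 16 * (z \<bullet> br v (b e)))"
  define F2 where "F2 = (\<lambda>e. 4 * (v \<bullet> b e)\<^sup>2 + 2 * (norm v)\<^sup>2 * (norm (b e))\<^sup>2 + 4 * (norm (br v (b e)))\<^sup>2)"
  define E where "E = (\<lambda>e. a * F powr (- a - 2) * ((a + 1) * (F1 e)\<^sup>2 - F * (2 * F2 e)))"
  have "has_second_deriv (\<lambda>t. gnorm (gmul p (t *\<^sub>R b e, 0)) powr (- s)) (E e)" for e
    unfolding gnorm_powr gnorm_power4_curve E_def F1_def F2_def F_def v_def z_def a_def[symmetric]
    by (rule has_second_deriv_powr) (use F F_def in simp)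
  moreover have "0 \<le> (\<Sum>e\<in>Basis. E e)"
  proof -
    define G where "G = (4 * (norm v)\<^sup>2) *\<^sub>R v + 16 *\<^sub>R J z v"
    have F1: "F1 e = b e \<bullet> G" for e
      unfolding F1_def G_def
      by (simp add: inner_add_right inner_commute[of "b e"] J_adj)
    have "(norm G)\<^sup>2 = 16 * (norm v)\<^sup>2 * ((norm v) ^ 4 + 16 * (norm z)\<^sup>2)"
    proof -
      have "(norm G)\<^sup>2 = (4 * (norm v)\<^sup>2)\<^sup>2 * (norm v)\<^sup>2 + 16\<^sup>2 * (norm (J z v))\<^sup>2"
        unfolding G_def power2_norm_eq_inner
        using J_orthogonal[of z v] inner_commute[of v "J z v"]
        by (simp add: inner_add_left inner_add_right power2_eq_square)
      then show ?thesis unfolding norm_J by algebra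
    qed
    then have G: "(norm G)\<^sup>2 = 16 * (norm v)\<^sup>2 * F" by (simp add: F_def v_def z_def gnorm_power4)
    have br: "(\<Sum>e\<in>Basis. (norm (br v (b e)))\<^sup>2) \<le> real DIM('b) * (M * (norm v)\<^sup>2)"
    proof -
      have "(\<Sum>e\<in>Basis. (norm (br v (b e)))\<^sup>2) = (\<Sum>e\<in>Basis. \<Sum>f\<in>(Basis::'b set). (b e \<bullet> J f v)\<^sup>2)"
      proof (intro sum.cong refl)
        fix e
        have "(norm (br v (b e)))\<^sup>2 = (\<Sum>f\<in>Basis. (br v (b e) \<bullet> f)\<^sup>2)"
          unfolding power2_norm_eq_inner by (subst euclidean_inner) (simp add: power2_eq_square)
        then show "(norm (br v (b e)))\<^sup>2 = (\<Sum>f\<in>Basis. (b e \<bullet> J f v)\<^sup>2)"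
          by (simp add: inner_commute[of "b e"] J_adj inner_commute[of "br v (b e)"])
      qed
      also have "\<dots> = (\<Sum>f\<in>(Basis::'b set). \<Sum>e\<in>Basis. (b e \<bullet> J f v)\<^sup>2)" by (rule sum.swap)
      also have "\<dots> \<le> (\<Sum>f\<in>(Basis::'b set). M * (norm v)\<^sup>2)"
      proof (rule sum_mono)
        fix f :: 'b assume "f \<in> Basis"
        then show "(\<Sum>e\<in>Basis. (b e \<bullet> J f v)\<^sup>2) \<le> M * (norm v)\<^sup>2"
          using upper[of "J f v"] by (simp add: norm_J)
      qed
      finally show ?thesis by simp
    qed
    have "(\<Sum>e\<in>Basis. 2 * F2 e) = 8 * (\<Sum>e\<in>Basis. (b e \<bullet> v)\<^sup>2) + 4 * (norm v)\<^sup>2 * (\<Sum>e\<in>Basis. (norm (b e))\<^sup>2)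
        + 8 * (\<Sum>e\<in>Basis. (norm (br v (b e)))\<^sup>2)"
      unfolding F2_def by (simp add: sum.distrib sum_distrib_left algebra_simps inner_commute)
    also have "\<dots> \<le> 8 * (M * (norm v)\<^sup>2) + 4 * (norm v)\<^sup>2 * (\<Sum>e\<in>Basis. (norm (b e))\<^sup>2) + 8 * (real DIM('b) * (M * (norm v)\<^sup>2))"
      using upper[of v] br by linarith
    also have "\<dots> = 4 * (norm v)\<^sup>2 * ((\<Sum>e\<in>Basis. (norm (b e))\<^sup>2) + (2 * real DIM('b) + 2) * M)"
      by (simp add: algebra_simps)
    also have "\<dots> \<le> 4 * (norm v)\<^sup>2 * ((s + 4) * \<mu>)"
      using landis by (intro mult_left_mono) auto
    finally have "F * (\<Sum>e\<in>Basis. 2 * F2 e) \<le> F * (4 * (norm v)\<^sup>2 * ((s + 4) * \<mu>))"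
      using F by simp
    also have "\<dots> = (a + 1) * (\<mu> * (norm G)\<^sup>2)" unfolding G a_def by (simp add: field_simps)
    also have "\<dots> \<le> (a + 1) * (\<Sum>e\<in>Basis. (F1 e)\<^sup>2)"
      unfolding F1 using lower[of G] s by (intro mult_left_mono) (auto simp: a_def)
    finally have "0 \<le> (\<Sum>e\<in>Basis. (a + 1) * (F1 e)\<^sup>2 - F * (2 * F2 e))"
      by (simp add: sum_subtractf sum_distrib_left)
    then show ?thesis
      unfolding E_def sum_distrib_left[symmetric] using s by (simp add: a_def)
  qed
  ultimately show ?thesis by blast
qed

lemma continuous_curve: "continuous_on UNIV (\<lambda>t. gmul x (t *\<^sub>R w, 0))"
  by (intro continuous_intros)

lemma sum_norm_square_pos:
  fixes b :: "'a \<Rightarrow> 'a"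
  assumes M: "\<mu> > 0" and lower: "\<And>\<xi>. \<mu> * (norm \<xi>)\<^sup>2 \<le> (\<Sum>e\<in>Basis. (b e \<bullet> \<xi>)\<^sup>2)"
  shows "(\<Sum>e\<in>Basis. (norm (b e))\<^sup>2) > 0"
proof -
  obtain i :: 'a where i: "i \<in> Basis" using nonempty_Basis by blast
  have "0 < \<mu> * (norm i)\<^sup>2" using M i by simp
  also have "\<dots> \<le> (\<Sum>e\<in>Basis. (b e \<bullet> i)\<^sup>2)" by (rule lower)
  also have "\<dots> \<le> (\<Sum>e\<in>Basis. (norm (b e))\<^sup>2)"
    using i Cauchy_Schwarz_ineq[of _ i]
    by (intro sum_mono) (auto simp: dot_square_norm)
  finally show ?thesis .
qed

text \<open>The weak maximum principle for a finite combination \<open>\<Phi>\<close> of barriers with nonnegative weights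
  against a solution \<open>u\<close> on a ball
  with small balls around the poles removed. The operator only sees horizontal directions, but so does
  the perturbation \<open>\<kappa> |v - v\<^sub>0|\<^sup>2\<close>: the second derivatives of \<open>\<Phi> - u + \<kappa> |v - v\<^sub>0|\<^sup>2\<close> along the curves through a
  point have positive sum, so no interior point is a maximum.\<close>

lemma barrier_comparison:
  fixes u :: "'a \<times> 'b \<Rightarrow> real" and Y :: "('a \<times> 'b) set"
  assumes Y: "finite Y" "\<And>y. y \<in> Y \<Longrightarrow> 0 \<le> m y" and s: "real DIM('a) + 2 * real DIM('b) - \<delta> \<ge> 0"
    and u: "continuous_on (gball x0 R) u" "\<And>x. x \<in> gball x0 R \<Longrightarrow> landis_solution \<delta> u x"
    and \<rho>: "\<rho> < R" and \<epsilon>: "\<epsilon> > 0"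
  defines "\<Phi> \<equiv> \<lambda>x. \<Sum>y\<in>Y. m y * gdist y x powr (- (real DIM('a) + 2 * real DIM('b) - \<delta>))"
    and "A \<equiv> {x. gdist x0 x \<le> \<rho> \<and> (\<forall>y\<in>Y. \<epsilon> \<le> gdist y x)}"
  assumes bdry: "\<And>x. x \<in> A \<Longrightarrow> gdist x0 x = \<rho> \<or> (\<exists>y\<in>Y. gdist y x = \<epsilon>) \<Longrightarrow> \<Phi> x \<le> u x + k"
    and x: "x \<in> A"
  shows "\<Phi> x \<le> u x + k"
proof -
  define s where "s = real DIM('a) + 2 * real DIM('b) - \<delta>"
  have s0: "s \<ge> 0" using s by (simp add: s_def)
  have Ac: "compact A"
  proof -
    have "A = gcball x0 \<rho> \<inter> (\<Inter>y\<in>Y. {x. \<epsilon> \<le> gdist y x})" by (auto simp: A_def gcball_def)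
    moreover have "closed (\<Inter>y\<in>Y. {x. \<epsilon> \<le> gdist y x})"
      by (intro closed_INT ballI closed_Collect_le continuous_intros)
    ultimately show ?thesis using compact_gcball compact_Int_closed by metis
  qed
  have AB: "A \<subseteq> gball x0 R" using \<rho> by (auto simp: A_def gball_def)
  have key: "\<Phi> x - u x - k \<le> \<kappa> * \<rho>\<^sup>2" if \<kappa>: "\<kappa> > 0" for \<kappa>
  proof -
    define g where "g = (\<lambda>x. \<Phi> x - u x - k + \<kappa> * (norm (fst x - fst x0))\<^sup>2)"
    have "continuous_on A g"
      unfolding g_def \<Phi>_def using \<epsilon>
      by (intro continuous_intros continuous_on_powr continuous_on_subset[OF u(1) AB])
        (fastforce simp: A_def)+
    then obtain p where p: "p \<in> A" "\<And>y. y \<in> A \<Longrightarrow> g y \<le> g p"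
      using continuous_attains_sup[OF Ac, of g] x by blast
    have small: "(norm (fst y - fst x0))\<^sup>2 \<le> \<rho>\<^sup>2" if "y \<in> A" for y
    proof (rule power_mono)
      have "norm (fst (gmul (- x0) y)) \<le> gdist x0 y" unfolding gdist_def by (rule norm_fst_le_gnorm)
      then show "norm (fst y - fst x0) \<le> \<rho>" using that by (auto simp: A_def gmul_def)
    qed auto
    have "g p \<le> \<kappa> * \<rho>\<^sup>2"
    proof (cases "gdist x0 p = \<rho> \<or> (\<exists>y\<in>Y. gdist y p = \<epsilon>)")
      case True
      then show ?thesis using bdry[OF p(1)] small[OF p(1)] \<kappa> mult_left_mono[OF small[OF p(1)], of \<kappa>] unfolding g_def by linarith
    next
      case False
      then have int: "gdist x0 p < \<rho>" "\<And>y. y \<in> Y \<Longrightarrow> \<epsilon> < gdist y p"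
        using p(1) unfolding A_def by force+
      obtain b D \<mu> M where \<mu>: "0 < \<mu>"
       and lower: "\<And>\<xi>. \<mu> * (norm \<xi>)\<^sup>2 \<le> (\<Sum>e\<in>(Basis::'a set). (b e \<bullet> \<xi>)\<^sup>2)"
       and upper: "\<And>\<xi>. (\<Sum>e\<in>Basis. (b e \<bullet> \<xi>)\<^sup>2) \<le> M * (norm \<xi>)\<^sup>2"
       and landis: "(\<Sum>e\<in>Basis. (norm (b e))\<^sup>2) + (2 * real DIM('b) + 2) * M \<le> (real DIM('a) + 2 * real DIM('b) + 4 - \<delta>) * \<mu>"
       and D: "\<And>e. e \<in> Basis \<Longrightarrow> has_second_deriv (\<lambda>t. u (gmul p (t *\<^sub>R b e, 0))) (D e)" "(\<Sum>e\<in>Basis. D e) = 0"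
        using u(2)[of p] p(1) AB unfolding landis_solution_def by blast
      have landis': "(\<Sum>e\<in>Basis. (norm (b e))\<^sup>2) + (2 * real DIM('b) + 2) * M \<le> (s + 4) * \<mu>"
        using landis unfolding s_def by (simp add: algebra_simps)
      have "\<exists>E. (\<forall>e\<in>Basis. has_second_deriv (\<lambda>t. gdist y (gmul p (t *\<^sub>R b e, 0)) powr (- s)) (E e)) \<and>
             0 \<le> (\<Sum>e\<in>Basis. E e)" if "y \<in> Y" for y
      proof -
        have "gmul (- y) p \<noteq> 0" using int(2)[OF that] \<epsilon> unfolding gdist_def by auto
        from barrier_subsolution[OF this s0 lower upper landis']
        show ?thesis unfolding gdist_def by (simp add: gmul_assoc)
      qed
      then obtain E where E: "\<And>y e. y \<in> Y \<Longrightarrow> e \<in> Basis \<Longrightarrow>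
          has_second_deriv (\<lambda>t. gdist y (gmul p (t *\<^sub>R b e, 0)) powr (- s)) (E y e)"
         "\<And>y. y \<in> Y \<Longrightarrow> 0 \<le> (\<Sum>e\<in>Basis. E y e)" by metis
      define T where "T = (\<lambda>e. (\<Sum>y\<in>Y. m y * E y e) + (- 1) * D e + (- k) * 0 + \<kappa> * (2 * (norm (b e))\<^sup>2))"
      have sd: "has_second_deriv (\<lambda>t. g (gmul p (t *\<^sub>R b e, 0))) (T e)" if e: "e \<in> Basis" for e
      proof -
        have q: "(norm (fst (gmul p (t *\<^sub>R b e, 0)) - fst x0))\<^sup>2 =
            (norm (fst p - fst x0))\<^sup>2 + 2 * ((fst p - fst x0) \<bullet> b e) * t + (norm (b e))\<^sup>2 * t\<^sup>2" for t
          unfolding power2_norm_eq_inner gmul_def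
          by (simp add: inner_add_left inner_add_right inner_diff_left inner_diff_right inner_commute power2_eq_square algebra_simps)
        have "g (gmul p (t *\<^sub>R b e, 0)) = (\<Sum>y\<in>Y. m y * gdist y (gmul p (t *\<^sub>R b e, 0)) powr (- s))
            + (- 1) * u (gmul p (t *\<^sub>R b e, 0)) + (- k) * 1
            + \<kappa> * ((norm (fst p - fst x0))\<^sup>2 + 2 * ((fst p - fst x0) \<bullet> b e) * t + (norm (b e))\<^sup>2 * t\<^sup>2)" for t
          unfolding q[symmetric] g_def \<Phi>_def s_def by simp
        then show ?thesis unfolding T_def
          by (simp only:) (intro has_second_deriv_add has_second_deriv_cmult has_second_deriv_sum
              has_second_deriv_const has_second_deriv_quadratic E D e)
      qed
      have "T e \<le> 0" if e: "e \<in> Basis" for e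
      proof (rule has_second_deriv_local_max[OF sd[OF e]])
        define c where "c = (\<lambda>t. gmul p (t *\<^sub>R b e, 0))"
        have c0: "c 0 = p" by (simp add: c_def flip: zero_prod_def)
        have cc: "continuous_on UNIV c" unfolding c_def by (rule continuous_curve)
        have "open {t. gdist x0 (c t) < \<rho>}" "open {t. \<epsilon> < gdist y (c t)}" for y
          by (intro open_Collect_less continuous_intros cc)+
        then have "open ({t. gdist x0 (c t) < \<rho>} \<inter> (\<Inter>y\<in>Y. {t. \<epsilon> < gdist y (c t)}))"
          using Y(1) by (intro open_Int open_INT) auto
        moreover have "0 \<in> {t. gdist x0 (c t) < \<rho>} \<inter> (\<Inter>y\<in>Y. {t. \<epsilon> < gdist y (c t)})"
          using int c0 by auto
        ultimately have "\<forall>\<^sub>F t in nhds 0. t \<in> {t. gdist x0 (c t) < \<rho>} \<inter> (\<Inter>y\<in>Y. {t. \<epsilon> < gdist y (c t)})"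
          by (rule eventually_nhds_in_open)
        then have "\<forall>\<^sub>F t in nhds 0. g (c t) \<le> g (c 0)"
          unfolding c0 by eventually_elim (rule p(2), auto simp: A_def less_imp_le)
        then show "\<forall>\<^sub>F t in nhds 0. g (gmul p (t *\<^sub>R b e, 0)) \<le> g (gmul p (0 *\<^sub>R b e, 0))"
          unfolding c_def .
      qed
      then have "(\<Sum>e\<in>Basis. T e) \<le> 0" by (rule sum_nonpos)
      moreover have "(\<Sum>e\<in>Basis. T e) = (\<Sum>y\<in>Y. m y * (\<Sum>e\<in>Basis. E y e)) + \<kappa> * (2 * (\<Sum>e\<in>Basis. (norm (b e))\<^sup>2))"
      proof -
        have "(\<Sum>e\<in>Basis. \<Sum>y\<in>Y. m y * E y e) = (\<Sum>y\<in>Y. m y * (\<Sum>e\<in>Basis. E y e))"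
          by (subst sum.swap) (simp add: sum_distrib_left)
        then show ?thesis using D(2) unfolding T_def by (simp add: sum.distrib sum_subtractf sum_distrib_left)
      qed
      moreover have "(\<Sum>y\<in>Y. m y * (\<Sum>e\<in>Basis. E y e)) \<ge> 0"
        using Y(2) E(2) by (simp add: sum_nonneg)
      moreover have "\<kappa> * (2 * (\<Sum>e\<in>Basis. (norm (b e))\<^sup>2)) > 0"
        using \<kappa> sum_norm_square_pos[OF \<mu> lower] by simp
      ultimately show ?thesis by linarith
    qed
    then have "g x \<le> \<kappa> * \<rho>\<^sup>2" using p(2)[OF x] by linarith
    moreover have "0 \<le> \<kappa> * (norm (fst x - fst x0))\<^sup>2" using \<kappa> by simp
    ultimately show ?thesis unfolding g_def by linarith
  qed
  have "\<Phi> x - u x - k \<le> 0"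
  proof (rule field_le_epsilon)
    fix e :: real assume e: "e > 0"
    have "\<Phi> x - u x - k \<le> e / (\<rho>\<^sup>2 + 1) * \<rho>\<^sup>2" using e by (intro key) (simp add: add_nonneg_pos)
    also have "\<dots> \<le> e"
    proof -
      have "0 < \<rho>\<^sup>2 + 1" by (simp add: add_nonneg_pos)
      then show ?thesis using e by (simp add: field_simps)
    qed
    finally show "\<Phi> x - u x - k \<le> 0 + e" by simp
  qed
  then show ?thesis by simp
qed

section \<open>The weak-type estimate\<close>

text \<open>The shells \<open>r/2\<^bsup>j+1\<^esup> < d \<le> r/2\<^sup>j\<close> contribute at most \<open>(r/2\<^bsup>j+1\<^esup>)\<^bsup>-s\<^esup>\<close> times the volume of a ball of radius
  \<open>r/2\<^sup>j\<close>, which is a geometric series of ratio \<open>2\<^bsup>-\<delta>\<^esup>\<close> since \<open>Q - s = \<delta>\<close>. The centre \<open>x\<close> of the singularity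
  is unrelated to the ball of integration; points with \<open>d \<ge> r\<close> are covered by the trivial bound.\<close>

lemma potential_bound:
  assumes \<delta>: "0 < \<delta>" and s: "s = real DIM('a) + 2 * real DIM('b) - \<delta>" "s \<ge> 0"
  shows "\<exists>C>0. \<forall>x x0 r. r > 0 \<longrightarrow>
    (\<integral>\<^sup>+y\<in>gcball x0 r. ennreal (gdist x y powr (- s)) \<partial>lborel) \<le> ennreal (C * r powr \<delta>)"
proof -
  define q where "q = 2 powr (- \<delta>)"
  have q: "0 < q" "q < 1" using \<delta> by (auto simp: q_def powr_less_one)
  define C where "C = unit_vol * (1 + 2 powr s / (1 - q))"
  have "C > 0" unfolding C_def using unit_vol_pos q by (intro mult_pos_pos add_pos_nonneg) auto
  moreover have "(\<integral>\<^sup>+y\<in>gcball x0 r. ennreal (gdist x y powr (- s)) \<partial>lborel) \<le> ennreal (C * r powr \<delta>)"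
    if r: "r > 0" for x x0 r
  proof -
    let ?Q = "DIM('a) + 2 * DIM('b)"
    define c where "c = (\<lambda>j::nat. (r / 2 ^ Suc j) powr (- s))"
    have pw: "ennreal (gdist x y powr (- s)) * indicator (gcball x0 r) y \<le>
       ennreal (r powr (- s)) * indicator (gcball x0 r) y + (\<Sum>j. ennreal (c j) * indicator (gcball x (r / 2 ^ j)) y)"
      (is "?l \<le> ?a + ?b") for y
    proof -
      define d where "d = gdist x y"
      consider "y \<notin> gcball x0 r" | "d = 0" | "r \<le> d" "y \<in> gcball x0 r" | "0 < d" "d < r" "y \<in> gcball x0 r"
        using gdist_nonneg[of x y] unfolding d_def by linarith
      then show ?thesis
      proof cases
        case 1 then show ?thesis by simp
      next
        case 2 then show ?thesis unfolding d_def by simp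
      next
        case 3
        then have "d powr (- s) \<le> r powr (- s)" using r s by (intro powr_mono2') auto
        then have "?l \<le> ?a" using 3 unfolding d_def by (simp add: ennreal_leI)
        then show ?thesis by (simp add: add_increasing2)
      next
        case 4
        (* the index of the shell that contains y *)
        define j where "j = (LEAST j. r / 2 ^ Suc j < d)"
        have ex: "\<exists>j. r / 2 ^ Suc j < d"
        proof -
          obtain n where "(1/2::real) ^ n < d / r"
            using real_arch_pow_inv[of "d / r" "1/2"] 4 r by auto
          then have "r / 2 ^ n < d" using r by (simp add: field_simps power_one_over)
          moreover have "r / 2 ^ Suc n \<le> r / 2 ^ n" using r by (simp add: field_simps)
          ultimately show ?thesis by (metis order_le_less_trans)
        qed
        then have j1: "r / 2 ^ Suc j < d" unfolding j_def by (rule LeastI_ex)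
        have j2: "d \<le> r / 2 ^ j"
        proof (cases j)
          case 0 then show ?thesis using 4 by simp
        next
          case (Suc k)
          then have "\<not> r / 2 ^ Suc k < d" unfolding j_def by (metis lessI not_less_Least)
          then show ?thesis using Suc by simp
        qed
        have "d powr (- s) \<le> c j" unfolding c_def using j1 r s by (intro powr_mono2') auto
        then have "?l \<le> ennreal (c j) * indicator (gcball x (r / 2 ^ j)) y"
          using 4 j2 unfolding d_def by (simp add: gcball_def ennreal_leI)
        also have "\<dots> = (\<Sum>i\<in>{j}. ennreal (c i) * indicator (gcball x (r / 2 ^ i)) y)"
          by (subst sum.insert) simp_all
        also have "\<dots> \<le> ?b" by (intro sum_le_suminf) auto
        finally show ?thesis by (simp add: add_increasing)
      qed
    qed
    have rQ: "r powr (- s) * r ^ ?Q = r powr \<delta>"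
      using r s powr_add[of r "- s" "real ?Q"] by (simp add: powr_realpow[symmetric] add.commute)
    have cj: "c j * (unit_vol * (r / 2 ^ j) ^ ?Q) = unit_vol * (2 powr s * r powr \<delta>) * q ^ j" for j
    proof -
      define R where "R = r / 2 ^ j"
      have R: "R > 0" using r by (simp add: R_def)
      have "c j = R powr (- s) * 2 powr s"
      proof -
        have "r / 2 ^ Suc j = R * (1/2)" by (simp add: R_def)
        then have "c j = (R * (1/2)) powr (- s)" by (simp only: c_def)
        then show ?thesis using R by (simp add: powr_mult powr_divide powr_minus_divide)
      qed
      moreover have "R powr (- s) * R ^ ?Q = R powr \<delta>"
        using R s powr_add[of R "- s" "real ?Q"] by (simp add: powr_realpow[symmetric] add.commute)
      moreover have "R powr \<delta> = r powr \<delta> * q ^ j"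
      proof -
        have "R = r * 2 powr (- real j)" by (simp add: R_def powr_minus_divide powr_realpow)
        then show ?thesis using r
          by (simp add: powr_mult powr_powr q_def mult.commute flip: powr_realpow)
      qed
      ultimately show ?thesis unfolding R_def[symmetric] by (simp add: algebra_simps)
    qed
    have "(\<integral>\<^sup>+y\<in>gcball x0 r. ennreal (gdist x y powr (- s)) \<partial>lborel) \<le>
       (\<integral>\<^sup>+y. ennreal (r powr (- s)) * indicator (gcball x0 r) y + (\<Sum>j. ennreal (c j) * indicator (gcball x (r / 2 ^ j)) y) \<partial>lborel)"
      by (intro nn_integral_mono pw)
    also have "\<dots> = ennreal (r powr (- s)) * emeasure lborel (gcball x0 r)
         + (\<Sum>j. ennreal (c j) * emeasure lborel (gcball x (r / 2 ^ j)))"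
      by (subst nn_integral_add) (auto simp: nn_integral_suminf nn_integral_cmult_indicator gcball_borel)
    also have "\<dots> = ennreal (unit_vol * r powr \<delta>) + (\<Sum>j. ennreal (unit_vol * (2 powr s * r powr \<delta>) * q ^ j))"
    proof -
      have "ennreal (r powr (- s)) * emeasure lborel (gcball x0 r) = ennreal (unit_vol * r powr \<delta>)"
        using unit_vol_pos r by (simp add: emeasure_gcball rQ[symmetric] ac_simps flip: ennreal_mult')
      moreover have "ennreal (c j) * emeasure lborel (gcball x (r / 2 ^ j)) =
          ennreal (unit_vol * (2 powr s * r powr \<delta>) * q ^ j)" for j
      proof -
        have "emeasure lborel (gcball x (r / 2 ^ j)) = ennreal (unit_vol * (r / 2 ^ j) ^ ?Q)"
          using r by (intro emeasure_gcball) simp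
        moreover have "c j \<ge> 0" by (simp add: c_def)
        ultimately show ?thesis unfolding cj[symmetric] by (simp only: ennreal_mult')
      qed
      ultimately show ?thesis by (simp only:)
    qed
    also have "(\<Sum>j. ennreal (unit_vol * (2 powr s * r powr \<delta>) * q ^ j)) = ennreal (unit_vol * (2 powr s * r powr \<delta>) * (1 / (1 - q)))"
      using q unit_vol_pos by (intro suminf_ennreal_eq sums_mult geometric_sums) auto
    also have "ennreal (unit_vol * r powr \<delta>) + ennreal (unit_vol * (2 powr s * r powr \<delta>) * (1 / (1 - q)))
       = ennreal (C * r powr \<delta>)"
      unfolding C_def using q unit_vol_pos
      by (subst ennreal_plus[symmetric]) (auto simp: algebra_simps)
    finally show ?thesis .
  qed
  ultimately show ?thesis by blast
qed

lemma compact_level: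
  fixes u :: "'a \<times> 'b \<Rightarrow> real"
  assumes u: "continuous_on S u" and sub: "gcball x r \<subseteq> S" and V: "closed V"
  shows "compact {y \<in> gcball x r. u y \<in> V}"
proof -
  have "closed (gcball x r \<inter> u -` V)"
    using continuous_on_subset[OF u sub] closed_gcball V by (rule continuous_closed_preimage)
  then have "compact (gcball x r \<inter> (gcball x r \<inter> u -` V))"
    by (rule compact_Int_closed[OF compact_gcball])
  moreover have "gcball x r \<inter> (gcball x r \<inter> u -` V) = {y \<in> gcball x r. u y \<in> V}" by auto
  ultimately show ?thesis by simp
qed

text \<open>The compact sets \<open>{u \<ge> t}\<close> and \<open>{u \<le> t/2}\<close> have positive distance. Radius \<open>2 r\<close> for the second one
  leaves room for neighbourhoods of the first.\<close>

lemma uniform_neighbourhood: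
  fixes u :: "'a \<times> 'b \<Rightarrow> real"
  assumes u: "continuous_on (gball x0 (6 * r)) u" and r: "r > 0" and t: "t > 0"
  shows "\<exists>\<epsilon>>0. \<epsilon> \<le> r \<and> (\<forall>y x. y \<in> gcball x0 r \<longrightarrow> t \<le> u y \<longrightarrow> gdist y x \<le> \<epsilon> \<longrightarrow> t / 2 \<le> u x)"
proof -
  define K where "K = {y \<in> gcball x0 r. t \<le> u y}"
  define L where "L = {y \<in> gcball x0 (2 * r). u y \<le> t / 2}"
  have sub: "gcball x0 r \<subseteq> gball x0 (6 * r)" "gcball x0 (2 * r) \<subseteq> gball x0 (6 * r)"
    using r by (auto simp: gcball_def gball_def)
  have K: "compact K"
    using compact_level[OF u sub(1) closed_atLeast[of t]] by (simp add: K_def)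
  have L: "compact L"
    using compact_level[OF u sub(2) closed_atMost[of "t / 2"]] by (simp add: L_def)
  have "\<exists>\<epsilon>>0. \<forall>y\<in>K. \<forall>x\<in>L. \<epsilon> < gdist y x"
  proof (cases "K \<times> L = {}")
    case True
    then show ?thesis by (intro exI[of _ 1]) auto
  next
    case False
    have "continuous_on (K \<times> L) (\<lambda>p. gdist (fst p) (snd p))" by (intro continuous_intros)
    then obtain p where p: "p \<in> K \<times> L" "\<And>p'. p' \<in> K \<times> L \<Longrightarrow> gdist (fst p) (snd p) \<le> gdist (fst p') (snd p')"
      using continuous_attains_inf[OF compact_Times[OF K L], of "\<lambda>p. gdist (fst p) (snd p)"] False by blast
    have "fst p \<noteq> snd p" using p(1) t unfolding K_def L_def by auto
    then have pos: "gdist (fst p) (snd p) > 0" using gdist_nonneg[of "fst p" "snd p"] by (simp add: less_le)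
    show ?thesis
    proof (intro exI[of _ "gdist (fst p) (snd p) / 2"] conjI ballI)
      fix y x assume "y \<in> K" "x \<in> L"
      then show "gdist (fst p) (snd p) / 2 < gdist y x" using p(2)[of "(y, x)"] pos by simp
    qed (use pos in simp)
  qed
  then obtain \<epsilon> where \<epsilon>: "\<epsilon> > 0" "\<And>y x. y \<in> K \<Longrightarrow> x \<in> L \<Longrightarrow> \<epsilon> < gdist y x" by blast
  show ?thesis
  proof (intro exI[of _ "min \<epsilon> r"] conjI allI impI)
    fix y x assume y: "y \<in> gcball x0 r" "t \<le> u y" and xy: "gdist y x \<le> min \<epsilon> r"
    then have "gdist x0 x \<le> 2 * r" using gdist_triangle[of x0 x y] by (simp add: gcball_def)
    moreover have "x \<notin> L" using \<epsilon>(2)[of y x] y xy by (auto simp: K_def)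
    ultimately show "t / 2 \<le> u x" by (auto simp: L_def gcball_def)
  qed (use \<epsilon> r in auto)
qed

text \<open>Let \<open>K = {u \<ge> t}\<close> in the ball of radius \<open>r\<close>. It is cut into finitely many pieces \<open>P y\<close>,
  each within \<open>\<epsilon>/2\<close> of a pole \<open>y \<in> K\<close>, where \<open>\<epsilon>\<close> is such that \<open>u \<ge> t/2\<close> within distance \<open>\<epsilon>\<close> of \<open>K\<close>. The Riemann sum
  \<open>\<Phi> = \<Sum> |P y| d(y, x)\<^bsup>-s\<^esup>\<close> of the potential of \<open>K\<close> is bounded by \<open>C r\<^sup>\<delta>\<close> at distance at least \<open>\<epsilon>\<close> from the
  poles, hence its multiple \<open>c0 \<Phi>\<close> lies below \<open>t/2 \<le> u\<close> on the spheres of radius \<open>\<epsilon>\<close> about the poles. On the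
  sphere of radius \<open>5 r\<close>, all poles are at distance at least \<open>4 r\<close> and \<open>c0 \<Phi>\<close> is at most the constant \<open>k\<close>. Comparison
  gives \<open>u \<ge> c0 \<Phi> - k\<close>. In the ball of radius \<open>r\<close> the poles are within \<open>2 r\<close>, so that
  \<open>c0 \<Phi> - k \<ge> c0 |K| ((2 r)\<^bsup>-s\<^esup> - (4 r)\<^bsup>-s\<^esup>)\<close>, which is a fixed multiple of \<open>t |K| / r\<^sup>Q\<close>.\<close>

lemma weak_estimate:
  assumes \<delta>: "0 < \<delta>" "\<delta> \<le> 2"
  shows "\<exists>c>0. \<forall>x0 r u t. r > 0 \<longrightarrow> t > 0 \<longrightarrow> continuous_on (gball x0 (6 * r)) u \<longrightarrow>
     (\<forall>x\<in>gball x0 (6 * r). 0 \<le> u x \<and> landis_solution \<delta> u x) \<longrightarrow>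
     (\<forall>x\<in>gcball x0 r. c * t * measure lborel {y \<in> gcball x0 r. t \<le> u y} \<le> u x * r ^ (DIM('a) + 2 * DIM('b)))"
proof -
  define s where "s = real DIM('a) + 2 * real DIM('b) - \<delta>"
  have "real DIM('a) \<ge> 1" "real DIM('b) \<ge> 1" using DIM_positive[where 'a='a] DIM_positive[where 'a='b] by linarith+
  then have s: "s > 0" using \<delta> unfolding s_def by linarith
  let ?Q = "DIM('a) + 2 * DIM('b)"
  obtain C0 where C0: "C0 > 0" "\<And>x x0 r. r > 0 \<Longrightarrow>
      (\<integral>\<^sup>+y\<in>gcball x0 r. ennreal (gdist x y powr (- s)) \<partial>lborel) \<le> ennreal (C0 * r powr \<delta>)"
    using potential_bound[OF \<delta>(1) s_def less_imp_le[OF s]] by blast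
  define C where "C = 2 powr s * C0"
  have C: "C > 0" using C0 by (simp add: C_def)
  define c where "c = min (1 / (2 * unit_vol)) ((2 powr (- s) - 4 powr (- s)) / (2 * C))"
  have "4 powr (- s) < 2 powr (- s)" using s by (intro powr_less_mono2_neg) auto
  then have c: "c > 0" using unit_vol_pos C by (simp add: c_def)
  have "c * t * measure lborel {y \<in> gcball x0 r. t \<le> u y} \<le> u x * r ^ ?Q"
    if r: "r > 0" and t: "t > 0" and u: "continuous_on (gball x0 (6 * r)) u"
      "\<And>x. x \<in> gball x0 (6 * r) \<Longrightarrow> 0 \<le> u x" "\<And>x. x \<in> gball x0 (6 * r) \<Longrightarrow> landis_solution \<delta> u x"
      and x: "x \<in> gcball x0 r" for x0 r u t x
  proof -
    define K where "K = {y \<in> gcball x0 r. t \<le> u y}"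
    define mK where "mK = measure lborel K"
    have sub: "gcball x0 r \<subseteq> gball x0 (6 * r)" using r by (auto simp: gcball_def gball_def)
    have Kc: "compact K"
      using compact_level[OF u(1) sub closed_atLeast[of t]] by (simp add: K_def)
    then have Kcl: "closed K" by (rule compact_imp_closed)
    have Kb: "K \<in> sets lborel" using Kcl by simp
    have fin: "emeasure lborel B \<noteq> \<infinity>" if "B \<subseteq> K" for B
      using emeasure_mono[OF that Kb] emeasure_compact_finite[OF Kc] by (auto simp: top_unique less_top)
    have mK: "0 \<le> mK" "mK \<le> unit_vol * r ^ ?Q"
    proof -
      have "emeasure lborel K \<le> emeasure lborel (gcball x0 r)"
        by (intro emeasure_mono) (auto simp: K_def gcball_borel)
      then show "mK \<le> unit_vol * r ^ ?Q"
        using fin[of K] unit_vol_pos r unfolding mK_def emeasure_gcball[OF r]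
        by (simp add: emeasure_eq_ennreal_measure)
    qed (simp add: mK_def)
    obtain \<epsilon> where \<epsilon>: "\<epsilon> > 0" "\<epsilon> \<le> r" "\<And>y x. y \<in> K \<Longrightarrow> gdist y x \<le> \<epsilon> \<Longrightarrow> t / 2 \<le> u x"
      using uniform_neighbourhood[OF u(1) r t] unfolding K_def by blast
    have "K \<subseteq> (\<Union>y\<in>K. gball y (\<epsilon> / 2))" using \<epsilon> by (auto simp: gball_def intro!: bexI)
    then obtain Y where Y: "Y \<subseteq> K" "finite Y" "K \<subseteq> (\<Union>y\<in>Y. gball y (\<epsilon> / 2))"
      using compactE_image[OF Kc, of K "\<lambda>y. gball y (\<epsilon> / 2)"] open_gball by metis
    obtain P where P: "\<And>y. y \<in> Y \<Longrightarrow> P y \<in> sets lborel" "\<And>y. y \<in> Y \<Longrightarrow> P y \<subseteq> K \<inter> gball y (\<epsilon> / 2)"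
       "disjoint_family_on P Y" "(\<Union>y\<in>Y. P y) = K"
      using finite_measurable_partition[OF Y(2) Kb _ Y(3)] open_gball by (metis borel_open sets_lborel)
    define m where "m = (\<lambda>y. measure lborel (P y))"
    have m0: "m y \<ge> 0" for y by (simp add: m_def)
    have em: "emeasure lborel (P y) = ennreal (m y)" if "y \<in> Y" for y
      using fin[of "P y"] P(2)[OF that] by (auto simp: m_def emeasure_eq_ennreal_measure)
    have summ: "(\<Sum>y\<in>Y. m y) = mK"
    proof -
      have "(\<Sum>y\<in>Y. emeasure lborel (P y)) = emeasure lborel K"
        unfolding P(4)[symmetric] using P(1,3) Y(2) by (intro sum_emeasure) auto
      moreover have "(\<Sum>y\<in>Y. emeasure lborel (P y)) = ennreal (\<Sum>y\<in>Y. m y)"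
        using em m0 by (simp add: sum_ennreal)
      moreover have "emeasure lborel K = ennreal mK" unfolding mK_def using fin[of K] by (simp add: emeasure_eq_ennreal_measure)
      ultimately show ?thesis using m0 mK by (simp add: sum_nonneg)
    qed
    define \<Phi> where "\<Phi> = (\<lambda>x. \<Sum>y\<in>Y. m y * gdist y x powr (- s))"
    have \<Phi>_bound: "\<Phi> x \<le> C * r powr \<delta>" if far: "\<And>y. y \<in> Y \<Longrightarrow> \<epsilon> \<le> gdist y x" for x
    proof -
      have "ennreal (\<Phi> x) = (\<Sum>y\<in>Y. ennreal (m y * gdist y x powr (- s)))"
        unfolding \<Phi>_def using m0 by (simp add: sum_ennreal)
      also have "\<dots> = (\<Sum>y\<in>Y. \<integral>\<^sup>+z. ennreal (gdist y x powr (- s)) * indicator (P y) z \<partial>lborel)"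
      proof (intro sum.cong refl)
        fix y assume y: "y \<in> Y"
        have "(\<integral>\<^sup>+z. ennreal (gdist y x powr (- s)) * indicator (P y) z \<partial>lborel) = ennreal (gdist y x powr (- s)) * ennreal (m y)"
          using em[OF y] P(1)[OF y] by (simp add: nn_integral_cmult_indicator)
        then show "ennreal (m y * gdist y x powr (- s)) = (\<integral>\<^sup>+z. ennreal (gdist y x powr (- s)) * indicator (P y) z \<partial>lborel)"
          using m0 by (simp add: ennreal_mult mult.commute)
      qed
      also have "\<dots> \<le> (\<Sum>y\<in>Y. \<integral>\<^sup>+z. ennreal (2 powr s * gdist x z powr (- s)) * indicator (P y) z \<partial>lborel)"
      proof (intro sum_mono nn_integral_mono)
        fix y z assume y: "y \<in> Y"
        show "ennreal (gdist y x powr (- s)) * indicator (P y) z \<le> ennreal (2 powr s * gdist x z powr (- s)) * indicator (P y) z"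
        proof (cases "z \<in> P y")
          case True
          then have yz: "gdist y z < \<epsilon> / 2" using P(2)[OF y] by (auto simp: gball_def)
          have 1: "gdist x z \<le> 2 * gdist y x"
            using gdist_triangle[of x z y] gdist_sym[of x y] far[OF y] yz \<epsilon>(1) by linarith
          have 2: "0 < gdist x z"
            using gdist_triangle[of y x z] gdist_sym[of x z] far[OF y] yz \<epsilon>(1) by linarith
          have "gdist y x powr (- s) \<le> (gdist x z / 2) powr (- s)"
            using 1 2 s by (intro powr_mono2') auto
          also have "\<dots> = 2 powr s * gdist x z powr (- s)"
            using 2 by (simp add: powr_divide powr_minus_divide)
          finally show ?thesis using True by (simp add: ennreal_leI)
        qed simp
      qed
      also have "\<dots> = (\<integral>\<^sup>+z. (\<Sum>y\<in>Y. ennreal (2 powr s * gdist x z powr (- s)) * indicator (P y) z) \<partial>lborel)"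
      proof (rule nn_integral_sum[symmetric])
        fix y assume y: "y \<in> Y"
        have "(\<lambda>z. gdist x z) \<in> borel_measurable borel"
          by (intro borel_measurable_continuous_onI continuous_intros)
        then show "(\<lambda>z. ennreal (2 powr s * gdist x z powr (- s)) * indicator (P y) z) \<in> borel_measurable lborel"
          using P(1)[OF y] by measurable
      qed
      also have "\<dots> \<le> (\<integral>\<^sup>+z. ennreal (2 powr s) * (ennreal (gdist x z powr (- s)) * indicator (gcball x0 r) z) \<partial>lborel)"
      proof (intro nn_integral_mono)
        fix z
        have "(\<Sum>y\<in>Y. indicator (P y) z :: ennreal) = indicator (\<Union>y\<in>Y. P y) z"
          by (rule indicator_UN_disjoint[OF Y(2) P(3), symmetric])
        also have "\<dots> \<le> indicator (gcball x0 r) z"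
          unfolding P(4) by (auto simp: indicator_def K_def)
        finally show "(\<Sum>y\<in>Y. ennreal (2 powr s * gdist x z powr (- s)) * indicator (P y) z)
            \<le> ennreal (2 powr s) * (ennreal (gdist x z powr (- s)) * indicator (gcball x0 r) z)"
          unfolding sum_distrib_left[symmetric] by (simp add: ennreal_mult mult.assoc mult_left_mono)
      qed
      also have "\<dots> = ennreal (2 powr s) * (\<integral>\<^sup>+z\<in>gcball x0 r. ennreal (gdist x z powr (- s)) \<partial>lborel)"
      proof (rule nn_integral_cmult)
        have "(\<lambda>z. gdist x z) \<in> borel_measurable borel"
          by (intro borel_measurable_continuous_onI continuous_intros)
        then show "(\<lambda>z. ennreal (gdist x z powr (- s)) * indicator (gcball x0 r) z) \<in> borel_measurable lborel"
          using gcball_borel[of x0 r] by measurable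
      qed
      also have "\<dots> \<le> ennreal (2 powr s) * ennreal (C0 * r powr \<delta>)"
        using C0(2)[OF r] by (intro mult_left_mono) auto
      also have "\<dots> = ennreal (C * r powr \<delta>)"
        using C0(1) by (simp add: C_def ennreal_mult mult.assoc)
      finally show ?thesis using C by (simp add: ennreal_le_iff)
    qed
    (* chosen so that c0 times the bound on the potential is t / 2 *)
    define c0 where "c0 = t / (2 * (C * r powr \<delta>))"
    have Cr: "C * r powr \<delta> > 0" using C r by simp
    have c0: "c0 > 0" "c0 * (C * r powr \<delta>) = t / 2"
      using t Cr by (auto simp: c0_def)
    have KY: "gdist x0 y \<le> r" if "y \<in> Y" for y using Y(1) that by (auto simp: K_def gcball_def)
    show ?thesis
    proof (cases "\<exists>y\<in>Y. gdist y x < \<epsilon>")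
      (* within epsilon of K the level t / 2 already suffices, as |K| is at most the ball's volume *)
      case True
      then have ux: "t / 2 \<le> u x" using \<epsilon>(3) Y(1) by (metis less_imp_le subsetD)
      have "c * t * mK \<le> 1 / (2 * unit_vol) * t * (unit_vol * r ^ ?Q)"
        using mK t c unit_vol_pos by (intro mult_mono) (auto simp: c_def)
      also have "\<dots> = t / 2 * r ^ ?Q" using unit_vol_pos by simp
      also have "\<dots> \<le> u x * r ^ ?Q" using ux r by (intro mult_right_mono) auto
      finally show ?thesis unfolding mK_def K_def .
    next
      case False
      define k where "k = c0 * mK * (4 * r) powr (- s)"
      have k0: "k \<ge> 0" using c0 mK by (simp add: k_def)
      have scal: "(\<Sum>y\<in>Y. c0 * m y * gdist y x powr (- s)) = c0 * \<Phi> x" for x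
        by (simp add: \<Phi>_def sum_distrib_left mult.assoc)
      have main: "(\<Sum>y\<in>Y. c0 * m y * gdist y x powr (- s)) \<le> u x + k"
      proof (rule barrier_comparison[where m = "\<lambda>y. c0 * m y" and R = "6 * r" and \<rho> = "5 * r" and \<epsilon> = \<epsilon> and \<delta> = \<delta> and ?x0.0 = x0,
            folded s_def])
        show "finite Y" by fact
        show "0 \<le> c0 * m y" for y using c0 m0 by simp
        show "0 \<le> s" using s by simp
        show "5 * r < 6 * r" using r by simp
        show "x \<in> {x. gdist x0 x \<le> 5 * r \<and> (\<forall>y\<in>Y. \<epsilon> \<le> gdist y x)}"
          using x r False by (force simp: gcball_def)
      next
        fix x assume xA: "x \<in> {x. gdist x0 x \<le> 5 * r \<and> (\<forall>y\<in>Y. \<epsilon> \<le> gdist y x)}"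
          and bd: "gdist x0 x = 5 * r \<or> (\<exists>y\<in>Y. gdist y x = \<epsilon>)"
        have u0: "0 \<le> u x" using u(2)[of x] xA r by (auto simp: gball_def)
        show "(\<Sum>y\<in>Y. c0 * m y * gdist y x powr (- s)) \<le> u x + k"
          unfolding scal using bd
        proof
          assume "gdist x0 x = 5 * r"
          then have "4 * r \<le> gdist y x" if "y \<in> Y" for y
            using KY[OF that] gdist_triangle[of x0 x y] by linarith
          then have "\<Phi> x \<le> (\<Sum>y\<in>Y. m y * (4 * r) powr (- s))"
            unfolding \<Phi>_def using m0 r s by (intro sum_mono mult_left_mono powr_mono2') auto
          also have "\<dots> = mK * (4 * r) powr (- s)" by (simp add: summ flip: sum_distrib_right)
          finally have "c0 * \<Phi> x \<le> k" unfolding k_def using c0 by (simp add: mult.assoc)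
          then show "c0 * \<Phi> x \<le> u x + k" using u0 by linarith
        next
          assume "\<exists>y\<in>Y. gdist y x = \<epsilon>"
          then have "t / 2 \<le> u x" using \<epsilon>(3) Y(1) by (metis order_refl subsetD)
          moreover have "c0 * \<Phi> x \<le> c0 * (C * r powr \<delta>)"
            using xA c0(1) by (intro mult_left_mono \<Phi>_bound) auto
          ultimately show "c0 * \<Phi> x \<le> u x + k" using c0(2) k0 by linarith
        qed
      qed (use u \<epsilon> in auto)
      have "\<Phi> x \<ge> mK * (2 * r) powr (- s)"
      proof -
        have "gdist y x \<le> 2 * r" if "y \<in> Y" for y
          using KY[OF that] gdist_triangle[of y x x0] gdist_sym[of y x0] x by (simp add: gcball_def)
        moreover have "0 < gdist y x" if "y \<in> Y" for y using False \<epsilon>(1) that by force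
        ultimately have "(\<Sum>y\<in>Y. m y * (2 * r) powr (- s)) \<le> \<Phi> x"
          unfolding \<Phi>_def using m0 s by (intro sum_mono mult_left_mono powr_mono2') auto
        then show ?thesis by (simp add: summ flip: sum_distrib_right)
      qed
      then have "c0 * (mK * (2 * r) powr (- s)) \<le> u x + k"
        using main c0(1) unfolding scal by (meson mult_left_mono less_imp_le order_trans)
      then have "c0 * mK * ((2 * r) powr (- s) - (4 * r) powr (- s)) \<le> u x"
        unfolding k_def by (simp add: algebra_simps)
      then have ux: "c0 * mK * (r powr (- s) * (2 powr (- s) - 4 powr (- s))) \<le> u x"
        using r by (simp add: powr_mult algebra_simps)
      have rr: "r powr (- s) * r ^ ?Q = r powr \<delta>"
        using r powr_add[of r "- s" "real ?Q"] by (simp add: s_def powr_realpow[symmetric] add.commute)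
      have "c * t * mK \<le> (2 powr (- s) - 4 powr (- s)) / (2 * C) * t * mK"
        using mK t by (intro mult_right_mono) (auto simp: c_def)
      also have "\<dots> = c0 * mK * (r powr (- s) * (2 powr (- s) - 4 powr (- s))) * r ^ ?Q"
      proof -
        have "c0 * mK * (r powr (- s) * (2 powr (- s) - 4 powr (- s))) * r ^ ?Q
            = c0 * mK * (2 powr (- s) - 4 powr (- s)) * (r powr (- s) * r ^ ?Q)"
          by (simp only: ac_simps)
        also have "\<dots> = c0 * r powr \<delta> * mK * (2 powr (- s) - 4 powr (- s))"
          unfolding rr by (simp only: ac_simps)
        also have "c0 * r powr \<delta> = t / (2 * C)" using r by (simp add: c0_def)
        finally show ?thesis by simp
      qed
      also have "\<dots> \<le> u x * r ^ ?Q" using ux r by (intro mult_right_mono) auto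
      finally show ?thesis unfolding mK_def K_def .
    qed
  qed
  then show ?thesis using c by blast
qed

section \<open>The Harnack inequality in exponential coordinates\<close>

text \<open>The weight \<open>(2 R - d(x\<^sub>0, x))\<^sup>Q\<close> carries the power in which the weak-type estimate loses when it passes from
  radius \<open>r = \<kappa> \<sigma>\<close> to radius \<open>2 R\<close>, so one maximum point replaces an iteration over shrinking balls. The
  constant \<open>\<nu>\<close> makes the set \<open>E1\<close>, where \<open>(1 + \<nu>) K - u \<ge> K/2\<close>, occupy at most half of the ball of radius \<open>r\<close>
  about \<open>p\<close>. The constant \<open>\<kappa>\<close> keeps \<open>u\<close> below \<open>(1 + \<nu>) K\<close> on the ball of radius \<open>6 r\<close>, by Bernoulli's
  inequality. The factor \<open>12\<close> is \<open>6\<close>, from the weak-type estimate, times the radius \<open>2 R\<close>.\<close>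

theorem harnack:
  assumes \<delta>: "0 < \<delta>" "\<delta> \<le> 2"
  shows "\<exists>C>0. \<forall>x0 R u. R > 0 \<longrightarrow> continuous_on (gball x0 (12 * R)) u \<longrightarrow>
     (\<forall>x\<in>gball x0 (12 * R). 0 \<le> u x \<and> landis_solution \<delta> u x) \<longrightarrow>
     (\<forall>x\<in>gball x0 R. \<forall>y\<in>gball x0 R. u x \<le> C * u y)"
proof -
  let ?Q = "DIM('a) + 2 * DIM('b)"
  obtain c where c: "c > 0" and weak_all: "\<forall>x0 r u t. r > 0 \<longrightarrow> t > 0 \<longrightarrow> continuous_on (gball x0 (6 * r)) u \<longrightarrow>
     (\<forall>x\<in>gball x0 (6 * r). 0 \<le> u x \<and> landis_solution \<delta> u x) \<longrightarrow>
     (\<forall>x\<in>gcball x0 r. c * t * measure lborel {y \<in> gcball x0 r. t \<le> u y} \<le> u x * r ^ ?Q)"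
    using weak_estimate[OF \<delta>] by (elim exE conjE) (rule that)
  have weak: "c * t * measure lborel {y \<in> gcball x0 r. t \<le> u y} \<le> u x * r ^ ?Q"
    if "r > 0" "t > 0" "continuous_on (gball x0 (6 * r)) u"
       "\<And>x. x \<in> gball x0 (6 * r) \<Longrightarrow> 0 \<le> u x \<and> landis_solution \<delta> u x" "x \<in> gcball x0 r"
    for x0 r u t x
    using weak_all[rule_format, of r t x0 u x] that by blast
  have Q: "?Q > 0" by simp
  define q where "q = real ?Q"
  have q1: "1 \<le> q" using Q unfolding q_def by (simp only: real_of_nat_ge_one_iff)
  then have q0: "0 < q" by simp
  define \<nu> where "\<nu> = unit_vol * c / 4"
  have \<nu>: "\<nu> > 0" using c unit_vol_pos by (simp add: \<nu>_def)
  define \<kappa> where "\<kappa> = \<nu> / (6 * q * (1 + \<nu>))"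
  have \<kappa>0: "\<kappa> > 0" using \<nu> q0 by (simp add: \<kappa>_def)
  have \<kappa>Q: "6 * \<kappa> * q = \<nu> / (1 + \<nu>)" using \<nu> q0 by (simp add: \<kappa>_def)
  have \<kappa>1: "6 * \<kappa> < 1"
  proof -
    have "6 * \<kappa> * 1 \<le> 6 * \<kappa> * q" using \<kappa>0 Q by (intro mult_left_mono q1) auto
    also have "\<dots> < 1" unfolding \<kappa>Q using \<nu> by simp
    finally show ?thesis by simp
  qed
  have bern: "1 / (1 + \<nu>) \<le> (1 - 6 * \<kappa>) ^ ?Q"
  proof -
    have "1 / (1 + \<nu>) = 1 + q * (- (6 * \<kappa>))" using \<kappa>Q \<nu> by (simp add: field_simps)
    also have "\<dots> \<le> (1 + (- (6 * \<kappa>))) ^ ?Q" unfolding q_def using \<kappa>1 by (intro Bernoulli_inequality) simp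
    finally show ?thesis by simp
  qed
  define C where "C = 4 * 2 ^ ?Q / (c * unit_vol * \<kappa> ^ ?Q)"
  have C: "C > 0" using c unit_vol_pos \<kappa>0 by (simp add: C_def)
  have "u x \<le> C * u y"
    if R: "R > 0" and u: "continuous_on (gball x0 (12 * R)) u"
      "\<And>x. x \<in> gball x0 (12 * R) \<Longrightarrow> 0 \<le> u x \<and> landis_solution \<delta> u x"
    and x: "x \<in> gball x0 R" and y: "y \<in> gball x0 R" for x0 R u x y
  proof -
    define \<psi> where "\<psi> = (\<lambda>x. u x * (2 * R - gdist x0 x) ^ ?Q)"
    have sub: "gcball x0 (2 * R) \<subseteq> gball x0 (12 * R)" using R by (auto simp: gball_def gcball_def)
    have "continuous_on (gcball x0 (2 * R)) \<psi>" unfolding \<psi>_def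
      by (intro continuous_intros continuous_on_subset[OF u(1) sub])
    moreover have xin: "x \<in> gcball x0 (2 * R)" and yin: "y \<in> gcball x0 (2 * R)"
      using x y R by (auto simp: gball_def gcball_def)
    ultimately obtain p where p: "p \<in> gcball x0 (2 * R)" "\<And>y. y \<in> gcball x0 (2 * R) \<Longrightarrow> \<psi> y \<le> \<psi> p"
      using continuous_attains_sup[OF compact_gcball, of x0 "2 * R" \<psi>] by blast
    define \<sigma> K where "\<sigma> = 2 * R - gdist x0 p" and "K = u p"
    have \<sigma>0: "\<sigma> \<ge> 0" using p(1) by (simp add: \<sigma>_def gcball_def)
    have K0: "K \<ge> 0" using u(2) p(1) sub unfolding K_def by blast
    have uy: "u y \<ge> 0" using u(2) yin sub by blast
    have "u x * R ^ ?Q \<le> u x * (2 * R - gdist x0 x) ^ ?Q"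
      using x R u(2)[of x] xin sub by (intro mult_left_mono power_mono) (auto simp: gball_def)
    also have "\<dots> \<le> K * \<sigma> ^ ?Q" using p(2)[OF xin] by (simp add: \<psi>_def \<sigma>_def K_def)
    finally have ux: "u x * R ^ ?Q \<le> K * \<sigma> ^ ?Q" .
    show ?thesis
    proof (cases "K = 0 \<or> \<sigma> = 0")
      case True
      then have "K * \<sigma> ^ ?Q = 0" using Q by auto
      then have "u x * R ^ ?Q \<le> 0" using ux by linarith
      moreover have "R ^ ?Q > 0" using R by simp
      ultimately have "u x \<le> 0" by (simp only: mult_le_0_iff) linarith
      moreover have "0 \<le> C * u y" using C uy by simp
      ultimately show ?thesis by linarith
    next
      case False
      with K0 \<sigma>0 have K: "K > 0" and \<sigma>: "\<sigma> > 0" by auto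
      define r where "r = \<kappa> * \<sigma>"
      have r: "r > 0" using \<kappa>0 \<sigma> by (simp add: r_def)
      have r6: "6 * r < \<sigma>" using \<kappa>1 \<sigma> by (simp add: r_def mult.assoc[symmetric])
      have sub2: "gball p (6 * r) \<subseteq> gcball x0 (2 * R)"
      proof
        fix q assume "q \<in> gball p (6 * r)"
        then show "q \<in> gcball x0 (2 * R)"
          using gdist_triangle[of x0 q p] r6 by (simp add: gball_def gcball_def \<sigma>_def)
      qed
      have up: "u q \<le> (1 + \<nu>) * K" if q: "q \<in> gball p (6 * r)" for q
      proof -
        have qd: "(1 - 6 * \<kappa>) * \<sigma> \<le> 2 * R - gdist x0 q"
          using q gdist_triangle[of x0 q p] by (simp add: gball_def \<sigma>_def r_def algebra_simps)
        have uq: "u q \<ge> 0" using u(2) q sub2 sub by blast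
        have "u q * (1 / (1 + \<nu>) * \<sigma> ^ ?Q) \<le> u q * ((1 - 6 * \<kappa>) * \<sigma>) ^ ?Q"
          unfolding power_mult_distrib using bern uq \<sigma> by (intro mult_left_mono mult_right_mono) auto
        also have "\<dots> \<le> \<psi> q"
          unfolding \<psi>_def using qd uq \<sigma> \<kappa>1 by (intro mult_left_mono power_mono) auto
        also have "\<dots> \<le> \<psi> p" using p(2) q sub2 by blast
        also have "\<dots> = K * \<sigma> ^ ?Q" by (simp add: \<psi>_def K_def \<sigma>_def)
        finally have "u q * (1 / (1 + \<nu>)) * \<sigma> ^ ?Q \<le> K * \<sigma> ^ ?Q" by (simp add: mult.assoc)
        then have "u q * (1 / (1 + \<nu>)) \<le> K" by (rule mult_right_le_imp_le) (use \<sigma> in simp)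
        then show ?thesis using \<nu> by (simp add: field_simps)
      qed
      define w where "w = (\<lambda>q. (1 + \<nu>) * K - u q)"
      have sub3: "gball p (6 * r) \<subseteq> gball x0 (12 * R)" using sub sub2 by blast
      define E1 where "E1 = {q \<in> gcball p r. K / 2 \<le> w q}"
      define E2 where "E2 = {q \<in> gcball x0 (2 * R). K / 2 \<le> u q}"
      have "c * (K / 2) * measure lborel E1 \<le> w p * r ^ ?Q"
        unfolding E1_def
      proof (rule weak)
        show "continuous_on (gball p (6 * r)) w"
          unfolding w_def by (intro continuous_intros continuous_on_subset[OF u(1) sub3])
        show "0 \<le> w q \<and> landis_solution \<delta> w q" if "q \<in> gball p (6 * r)" for q
          using up[OF that] u(2)[of q] that sub3 unfolding w_def
          by (auto intro: landis_solution_const_minus)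
        show "p \<in> gcball p r" using r by (simp add: gcball_def)
      qed (use r K in auto)
      also have "w p = \<nu> * K" by (simp add: w_def K_def algebra_simps)
      finally have E1: "measure lborel E1 \<le> unit_vol / 2 * r ^ ?Q"
        using c K by (simp add: \<nu>_def field_simps)
      have c1: "gcball p r \<subseteq> gball p (6 * r)" using r by (auto simp: gcball_def gball_def)
      have E2c: "compact E2" unfolding E2_def
        using compact_level[OF u(1) sub closed_atLeast[of "K / 2"]] by simp
      have E1c: "compact E1"
      proof -
        have "continuous_on (gball p (6 * r)) w"
          unfolding w_def by (intro continuous_intros continuous_on_subset[OF u(1) sub3])
        then show ?thesis unfolding E1_def using compact_level[OF _ c1 closed_atLeast[of "K / 2"]] by simp
      qed
      have fm: "E \<in> fmeasurable lborel" if "compact E" for E :: "('a \<times> 'b) set"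
        using that emeasure_compact_finite[OF that] by (auto intro!: fmeasurableI simp: compact_imp_closed borel_closed)
      have "unit_vol * r ^ ?Q = measure lborel (gcball p r)"
        using emeasure_gcball[OF r, of p] unit_vol_pos r by (simp add: measure_def)
      also have "\<dots> \<le> measure lborel (E1 \<union> E2)"
      proof (rule measure_mono_fmeasurable)
        show "gcball p r \<subseteq> E1 \<union> E2"
        proof
          fix q assume q: "q \<in> gcball p r"
          have "K / 2 \<le> w q \<or> K / 2 \<le> u q"
          proof -
            have "w q + u q = K + \<nu> * K" by (simp add: w_def algebra_simps)
            moreover have "\<nu> * K > 0" using \<nu> K by simp
            ultimately show ?thesis by linarith
          qed
          then show "q \<in> E1 \<union> E2" using q c1 sub2 by (auto simp: E1_def E2_def)
        qed
      qed (use gcball_borel fm E1c E2c compact_Un in auto)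
      also have "\<dots> \<le> measure lborel E1 + measure lborel E2"
        using fm[OF E1c] fm[OF E2c] by (intro measure_Un_le) (auto simp: fmeasurable_def)
      finally have E2: "unit_vol / 2 * r ^ ?Q \<le> measure lborel E2" using E1 by (simp add: field_simps)
      have "c * (K / 2) * (unit_vol / 2 * r ^ ?Q) \<le> c * (K / 2) * measure lborel E2"
        using c K E2 by (intro mult_left_mono) auto
      also have "\<dots> \<le> u y * (2 * R) ^ ?Q"
        unfolding E2_def
        by (rule weak) (use R K u yin in auto)
      finally have "c * (K / 2) * (unit_vol / 2 * r ^ ?Q) \<le> u y * (2 * R) ^ ?Q" .
      then have "(c * unit_vol * \<kappa> ^ ?Q) * (K * \<sigma> ^ ?Q) \<le> (4 * 2 ^ ?Q) * (u y * R ^ ?Q)"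
        unfolding r_def power_mult_distrib by (simp add: algebra_simps)
      then have "K * \<sigma> ^ ?Q \<le> C * (u y * R ^ ?Q)"
        using c unit_vol_pos \<kappa>0 unfolding C_def
        by (simp add: pos_le_divide_eq mult.commute)
      then have "u x * R ^ ?Q \<le> (C * u y) * R ^ ?Q" using ux by (simp add: mult.assoc)
      then show ?thesis by (rule mult_right_le_imp_le) (use R in simp)
    qed
  qed
  then show ?thesis using C by blast
qed

end

section \<open>Homogeneous group laws\<close>

text \<open>Here and below \<open>P\<close> and \<open>S\<close> are the projections onto the layers of weight one and two, so that
  \<open>t P + t\<^sup>2 S\<close> is the dilation by \<open>t\<close>. A function of degree one equals its one-sided derivative at \<open>0\<close> along the
  curve \<open>t \<mapsto> t P p + t\<^sup>2 S p\<close>, which starts with velocity \<open>P p\<close>.\<close>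

lemma homogeneous_degree_one:
  fixes f :: "'a::euclidean_space \<Rightarrow> 'c::real_normed_vector"
  assumes P: "bounded_linear P" "bounded_linear S"
    and hom: "\<And>t p. t > 0 \<Longrightarrow> f (t *\<^sub>R P p + t\<^sup>2 *\<^sub>R S p) = t *\<^sub>R f p"
    and f': "(f has_derivative F) (at 0)"
  shows "f p = F (P p)"
proof -
  define c where "c = (\<lambda>t::real. t *\<^sub>R P p + t\<^sup>2 *\<^sub>R S p)"
  have "f (2 *\<^sub>R P 0 + 2\<^sup>2 *\<^sub>R S 0) = 2 *\<^sub>R f 0" by (rule hom) simp
  then have f0: "f 0 = 0"
    using P by (simp add: linear_simps scaleR_2)
  have "(c has_vector_derivative P p) (at 0 within {0..})"
    unfolding c_def by (auto intro!: derivative_eq_intros)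
  moreover have "(f has_derivative F) (at (c 0) within c ` {0..})"
    using f' by (simp add: c_def has_derivative_at_withinI)
  ultimately have "(f \<circ> c has_vector_derivative F (P p)) (at 0 within {0..})"
    using vector_derivative_diff_chain_within by blast
  moreover have "((f \<circ> c) has_vector_derivative f p) (at 0 within {0..})"
  proof (rule has_vector_derivative_transform)
    show "((\<lambda>t. t *\<^sub>R f p) has_vector_derivative f p) (at 0 within {0..})"
      by (auto intro!: derivative_eq_intros)
    show "(f \<circ> c) t = t *\<^sub>R f p" if "t \<in> {0..}" for t
      using that hom[of t p] f0 by (cases "t = 0") (auto simp: c_def)
  qed simp
  ultimately show ?thesis
    by (intro vector_derivative_unique_within[of 0 "{0..}" "f \<circ> c"])
       (simp_all add: at_within_Ici_at_right)
qed

lemma homogeneous_degree_zero: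
  fixes f :: "'a::euclidean_space \<Rightarrow> 'c::real_normed_vector"
  assumes hom: "\<And>t p. t > 0 \<Longrightarrow> f (t *\<^sub>R P p + t\<^sup>2 *\<^sub>R S p) = f p"
    and f: "isCont f 0"
  shows "f p = f 0"
proof -
  have "((\<lambda>t::real. t *\<^sub>R P p + t\<^sup>2 *\<^sub>R S p) \<longlongrightarrow> 0 *\<^sub>R P p + 0\<^sup>2 *\<^sub>R S p) (at_right 0)"
    by (intro tendsto_intros)
  then have "((\<lambda>t. f (t *\<^sub>R P p + t\<^sup>2 *\<^sub>R S p)) \<longlongrightarrow> f 0) (at_right 0)"
    by (intro isCont_tendsto_compose[OF f]) simp
  moreover have "\<forall>\<^sub>F t in at_right (0::real). f (t *\<^sub>R P p + t\<^sup>2 *\<^sub>R S p) = f p"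
    using hom by (auto simp: eventually_at_right_less eventually_at_filter)
  ultimately have "((\<lambda>t::real. f p) \<longlongrightarrow> f 0) (at_right 0)"
    by (rule Lim_transform_eventually)
  then show ?thesis by (simp add: tendsto_const_iff)
qed

text \<open>Differentiating the homogeneity relation shows that the derivative of \<open>f\<close> in a direction of weight one has
  degree one, hence is linear in \<open>P p\<close>, and that the derivative in a direction of weight two has degree zero,
  hence is constant. So the derivative of \<open>t \<mapsto> f (t p)\<close> is affine in \<open>t\<close>, and integration gives \<open>f\<close>.\<close>

lemma homogeneous_degree_two:
  fixes f :: "'a::euclidean_space \<Rightarrow> 'c::real_normed_vector"
  assumes P: "bounded_linear P" "bounded_linear S" "\<And>x. P x + S x = x" "\<And>x. P (P x) = P x"
    and hom: "\<And>t p. t > 0 \<Longrightarrow> f (t *\<^sub>R P p + t\<^sup>2 *\<^sub>R S p) = t\<^sup>2 *\<^sub>R f p"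
    and f': "\<And>p. (f has_derivative F p) (at p)"
    and F': "\<And>e. ((\<lambda>p. F p e) has_derivative G e) (at 0)"
  shows "f p = (1/2) *\<^sub>R G (P p) (P p) + F 0 (S p)"
proof -
  interpret P: bounded_linear P by fact
  interpret S: bounded_linear S by fact
  have SP: "S (P x) = 0" and PS: "P (S x) = 0" and SS: "S (S x) = S x" for x
  proof -
    show 1: "S (P x) = 0" using P(3)[of "P x"] P(4)[of x] by simp
    have "P (P x + S x) = P x" using P(3) by simp
    then show 2: "P (S x) = 0" by (simp add: P.add P(4))
    show "S (S x) = S x" using P(3)[of "S x"] 2 by simp
  qed
  define d where "d = (\<lambda>t p. t *\<^sub>R P p + t\<^sup>2 *\<^sub>R S p)"
  have Flin: "linear (F p)" for p using f' has_derivative_linear by blast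
  have Fd: "F (d t p) (d t e) = t\<^sup>2 *\<^sub>R F p e" if t: "t > 0" for t p e
  proof -
    have "(d t has_derivative d t) (at p)"
      unfolding d_def by (auto intro!: derivative_eq_intros P.has_derivative S.has_derivative)
    then have "((\<lambda>p. f (d t p)) has_derivative (\<lambda>e. F (d t p) (d t e))) (at p)"
      using f' by (rule has_derivative_compose)
    moreover have "((\<lambda>p. f (d t p)) has_derivative (\<lambda>e. t\<^sup>2 *\<^sub>R F p e)) (at p)"
      using hom[OF t] unfolding d_def by (auto intro!: derivative_eq_intros f')
    ultimately show ?thesis using has_derivative_unique by metis
  qed
  have F1: "F p (P e) = G (P e) (P p)" for p e
  proof (rule homogeneous_degree_one[OF P(1,2) _ F'])
    fix t :: real and q assume t: "t > 0"
    have "d t (P e) = t *\<^sub>R P e" by (simp add: d_def P(4) SP)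
    then have "t *\<^sub>R F (d t q) (P e) = t\<^sup>2 *\<^sub>R F q (P e)"
      using Fd[OF t, of q "P e"] Flin by (simp add: linear_cmul)
    then have "t *\<^sub>R F (d t q) (P e) = t *\<^sub>R (t *\<^sub>R F q (P e))" by (simp add: power2_eq_square)
    then show "F (t *\<^sub>R P q + t\<^sup>2 *\<^sub>R S q) (P e) = t *\<^sub>R F q (P e)"
      using t unfolding d_def by (simp only: scaleR_cancel_left) simp
  qed
  have F2: "F p (S e) = F 0 (S e)" for p e
  proof (rule homogeneous_degree_zero[where f = "\<lambda>p. F p (S e)" and P = P and S = S])
    fix t :: real and q assume t: "t > 0"
    have "d t (S e) = t\<^sup>2 *\<^sub>R S e" by (simp add: d_def PS SS)
    then have "t\<^sup>2 *\<^sub>R F (d t q) (S e) = t\<^sup>2 *\<^sub>R F q (S e)"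
      using Fd[OF t, of q "S e"] Flin by (simp add: linear_cmul)
    then show "F (t *\<^sub>R P q + t\<^sup>2 *\<^sub>R S q) (S e) = F q (S e)"
      using t unfolding d_def by simp
  next
    show "isCont (\<lambda>p. F p (S e)) 0" using F' has_derivative_continuous by blast
  qed
  have Glin: "linear (G e)" for e using F' has_derivative_linear by blast
  define g where "g = (\<lambda>t::real. f (t *\<^sub>R p) - ((t\<^sup>2/2) *\<^sub>R G (P p) (P p) + t *\<^sub>R F 0 (S p)))"
  have "(g has_vector_derivative 0) (at t within UNIV)" for t
  proof -
    have "((\<lambda>t. t *\<^sub>R p) has_vector_derivative p) (at t)" by (auto intro!: derivative_eq_intros)
    then have "(f \<circ> (\<lambda>t. t *\<^sub>R p) has_vector_derivative F (t *\<^sub>R p) p) (at t)"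
      using f' vector_derivative_diff_chain_within[of "\<lambda>t. t *\<^sub>R p" p t UNIV f "F (t *\<^sub>R p)"]
      by (simp add: has_derivative_at_withinI)
    moreover have "F (t *\<^sub>R p) p = t *\<^sub>R G (P p) (P p) + F 0 (S p)"
    proof -
      have "F (t *\<^sub>R p) p = F (t *\<^sub>R p) (P p) + F (t *\<^sub>R p) (S p)"
        using P(3)[of p] linear_add[OF Flin, of "t *\<^sub>R p" "P p" "S p"] by simp
      then show ?thesis unfolding F1 F2[of "t *\<^sub>R p"] by (simp add: P.scaleR linear_cmul[OF Glin])
    qed
    ultimately have "((\<lambda>t. f (t *\<^sub>R p)) has_vector_derivative t *\<^sub>R G (P p) (P p) + F 0 (S p)) (at t)"
      by (simp add: o_def)
    moreover have "((\<lambda>t. (t\<^sup>2/2) *\<^sub>R G (P p) (P p) + t *\<^sub>R F 0 (S p)) has_vector_derivative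
        t *\<^sub>R G (P p) (P p) + F 0 (S p)) (at t)"
      by (auto intro!: derivative_eq_intros)
    ultimately show ?thesis
      unfolding g_def using has_vector_derivative_diff by fastforce
  qed
  then obtain c where "\<And>t. g t = c"
    using has_vector_derivative_zero_constant[of UNIV g] by auto
  then have "g 1 = g 0" by simp
  moreover have "f 0 = 0"
    using hom[of 2 0] scaleR_cancel_right[of 1 "f 0" 4] by (simp add: P.zero S.zero)
  ultimately show ?thesis by (simp add: g_def)
qed

text \<open>The first component has degree one and the second degree two on the pairs \<open>(x, y)\<close>, so they are linear and
  quadratic respectively. The neutral element \<open>0\<close> fixes all coefficients except the mixed
  ones \<open>B\<close>.\<close>

lemma group_law:
  fixes mul :: "('m::finite, 'n::finite) pt \<Rightarrow> ('m, 'n) pt \<Rightarrow> ('m, 'n) pt"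
  assumes hg: "homogeneous_lie_group mul iv"
  shows "\<exists>B. bilinear B \<and> (\<forall>x y. mul x y = (fst x + fst y, snd x + snd y + B (fst x) (fst y)))"
proof -
  interpret group mul 0 iv using hg unfolding homogeneous_lie_group_def by blast
  have dil: "dilation t (mul x y) = mul (dilation t x) (dilation t y)" if "t > 0" for t x y
    using hg that unfolding homogeneous_lie_group_def by blast
  define f where "f = (\<lambda>p. mul (fst p) (snd p))"
  define F where "F = (\<lambda>p. frechet_derivative f (at p))"
  have "Ck_on (Suc (Suc 0)) UNIV f"
    using hg unfolding homogeneous_lie_group_def smooth_on_def f_def by blast
  then have d1: "f differentiable (at p)" and d2: "(\<lambda>p. F p e) differentiable (at p)" for p e
    unfolding F_def Ck_on.simps by blast+
  have f': "(f has_derivative F p) (at p)" for p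
    using d1 frechet_derivative_works unfolding F_def by blast
  define G where "G = (\<lambda>e. frechet_derivative (\<lambda>p. F p e) (at 0))"
  have F': "((\<lambda>p. F p e) has_derivative G e) (at 0)" for e
    using d2 frechet_derivative_works unfolding G_def by blast
  have Flin: "linear (F p)" for p using f' has_derivative_linear by blast
  have Glin: "linear (G e)" for e using F' has_derivative_linear by blast
  have Gadd: "G (a + b) = (\<lambda>q. G a q + G b q)" for a b
  proof -
    have "((\<lambda>p. F p (a + b)) has_derivative (\<lambda>q. G a q + G b q)) (at 0)"
      unfolding linear_add[OF Flin] by (intro has_derivative_add F')
    then show ?thesis using F' has_derivative_unique by blast
  qed
  have Gscale: "G (c *\<^sub>R a) = (\<lambda>q. c *\<^sub>R G a q)" for a c
  proof -
    have "((\<lambda>p. F p (c *\<^sub>R a)) has_derivative (\<lambda>q. c *\<^sub>R G a q)) (at 0)"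
      unfolding linear_cmul[OF Flin] by (intro has_derivative_scaleR_right F')
    then show ?thesis using F' has_derivative_unique by blast
  qed
  define P S :: "('m, 'n) pt \<times> ('m, 'n) pt \<Rightarrow> ('m, 'n) pt \<times> ('m, 'n) pt"
    where "P = (\<lambda>p. ((fst (fst p), 0), (fst (snd p), 0)))"
      and "S = (\<lambda>p. ((0, snd (fst p)), (0, snd (snd p))))"
  have P: "bounded_linear P" "bounded_linear S" "P x + S x = x" "P (P x) = P x" for x
    unfolding P_def S_def linear_conv_bounded_linear[symmetric]
    by (auto intro!: linearI simp: prod_eq_iff)
  have fd: "f (t *\<^sub>R P p + t\<^sup>2 *\<^sub>R S p) = dilation t (f p)" if "t > 0" for t p
  proof -
    have "t *\<^sub>R P p + t\<^sup>2 *\<^sub>R S p = (dilation t (fst p), dilation t (snd p))"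
      by (simp add: P_def S_def dilation_def prod_eq_iff)
    then show ?thesis unfolding f_def using dil[OF that] by simp
  qed
  have f1: "fst (f p) = fst (F 0 (P p))" for p
  proof (rule homogeneous_degree_one[where f = "\<lambda>p. fst (f p)", OF P(1,2)])
    show "fst (f (t *\<^sub>R P p + t\<^sup>2 *\<^sub>R S p)) = t *\<^sub>R fst (f p)" if "t > 0" for t p
      using fd[OF that] by (simp add: dilation_def)
    show "((\<lambda>p. fst (f p)) has_derivative (\<lambda>e. fst (F 0 e))) (at 0)"
      by (intro has_derivative_fst f')
  qed
  have f2: "snd (f p) = (1/2) *\<^sub>R snd (G (P p) (P p)) + snd (F 0 (S p))" for p
  proof (rule homogeneous_degree_two[where f = "\<lambda>p. snd (f p)" and F = "\<lambda>p e. snd (F p e)" and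
        G = "\<lambda>e q. snd (G e q)", OF P])
    show "snd (f (t *\<^sub>R P p + t\<^sup>2 *\<^sub>R S p)) = t\<^sup>2 *\<^sub>R snd (f p)" if "t > 0" for t p
      using fd[OF that] by (simp add: dilation_def)
    show "((\<lambda>p. snd (f p)) has_derivative (\<lambda>e. snd (F p e))) (at p)" for p
      by (intro has_derivative_snd f')
    show "((\<lambda>p. snd (F p e)) has_derivative (\<lambda>q. snd (G e q))) (at 0)" for e
      by (intro has_derivative_snd F')
  qed
  define i j :: "real ^ 'm \<Rightarrow> ('m, 'n) pt \<times> ('m, 'n) pt"
    where "i = (\<lambda>a. ((a, 0), 0))" and "j = (\<lambda>a. (0, (a, 0)))"
  have Pij: "P (x, y) = i (fst x) + j (fst y)" for x y
    by (simp add: P_def i_def j_def)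
  have Sij: "S (x, y) = ((0, snd x), 0) + (0, (0, snd y))" for x y
    by (simp add: S_def)
  have ij: "i (a + b) = i a + i b" "j (a + b) = j a + j b" "i (c *\<^sub>R a) = c *\<^sub>R i a" "j (c *\<^sub>R a) = c *\<^sub>R j a"
     "i 0 = 0" "j 0 = 0" for a b c
    by (auto simp: i_def j_def zero_prod_def)
  have G0: "G 0 q = 0" "G e 0 = 0" for q e
    using Gscale[of 0 0] linear_0[OF Glin] by auto
  have fx: "f (x, 0) = x" "f (0, x) = x" for x by (auto simp: f_def)
  have 1: "fst (F 0 (i a)) = a" "fst (F 0 (j a)) = a" for a
    using f1[of "((a, 0), 0)"] f1[of "(0, (a, 0))"] fx[of "(a, 0)"] by (auto simp: Pij ij)
  have 2: "snd (F 0 ((0, b), 0)) = b" "snd (F 0 (0, (0, b))) = b" for b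
    using f2[of "((0, b), 0)"] f2[of "(0, (0, b))"] fx[of "(0, b)"]
    by (auto simp: Pij Sij ij G0 simp flip: zero_prod_def)
  have 3: "snd (G (i a) (i a)) = 0" "snd (G (j a) (j a)) = 0" for a
    using f2[of "((a, 0), 0)"] f2[of "(0, (a, 0))"] fx[of "(a, 0)"] linear_0[OF Flin]
    by (auto simp: Pij Sij ij simp flip: zero_prod_def)
  define B where "B = (\<lambda>a b. (1/2) *\<^sub>R snd (G (i a) (j b) + G (j b) (i a)))"
  have "bilinear B"
    unfolding bilinear_def B_def
    by (auto intro!: linearI simp: ij Gadd Gscale linear_add[OF Glin] linear_cmul[OF Glin] algebra_simps)
  moreover have "mul x y = (fst x + fst y, snd x + snd y + B (fst x) (fst y))" for x y
  proof -
    have "fst (f (x, y)) = fst x + fst y"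
      unfolding f1 Pij by (simp add: linear_add[OF Flin] 1)
    moreover have "snd (f (x, y)) = snd x + snd y + B (fst x) (fst y)"
      unfolding f2 Pij Sij B_def
      by (simp only: linear_add[OF Flin] linear_add[OF Glin] Gadd snd_add 2 3) (simp add: algebra_simps)
    ultimately show ?thesis by (simp add: f_def prod_eq_iff)
  qed
  ultimately show ?thesis by blast
qed


section \<open>The structure of an H-type group in given coordinates\<close>

lemma Ck_on_const: "Ck_on k S (\<lambda>x. c)"
  by (induction k arbitrary: c) auto

lemma Ck_on_affine:
  assumes "bounded_linear L"
  shows "Ck_on k S (\<lambda>x. c + L x)"
proof (cases k)
  case 0
  have "continuous_on S (\<lambda>x. c + L x)"
    by (intro continuous_intros linear_continuous_on assms)
  then show ?thesis using 0 by simp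
next
  case (Suc j)
  have "((\<lambda>x. c + L x) has_derivative L) (at x)" for x
    using assms by (auto intro!: derivative_eq_intros bounded_linear_imp_has_derivative)
  then have "frechet_derivative (\<lambda>x. c + L x) (at x) = L" "(\<lambda>x. c + L x) differentiable at x" for x
    by (auto simp: frechet_derivative_at[symmetric] differentiable_def)
  then show ?thesis using Suc by (simp add: Ck_on_const)
qed

text \<open>The bilinear map \<open>B\<close> of the group law, which need not be antisymmetric, is a parameter here:
  the coordinates on \<open>\<real>\<^sup>N\<close> need not be exponential ones.\<close>

locale h_type_coordinates =
  fixes mul :: "('m::finite, 'n::finite) pt \<Rightarrow> ('m, 'n) pt \<Rightarrow> ('m, 'n) pt"
    and iv :: "('m, 'n) pt \<Rightarrow> ('m, 'n) pt"
    and ip :: "(('m, 'n) pt \<Rightarrow> ('m, 'n) pt) \<Rightarrow> (('m, 'n) pt \<Rightarrow> ('m, 'n) pt) \<Rightarrow> real"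
    and X :: "'m \<Rightarrow> ('m, 'n) pt \<Rightarrow> ('m, 'n) pt"
    and B :: "real ^ 'm \<Rightarrow> real ^ 'm \<Rightarrow> real ^ 'n"
  assumes h_type: "h_type_group mul iv ip"
    and basis: "orthonormal_horizontal_basis mul ip X"
    and bilinear_B: "bilinear B"
    and mul_eq: "mul x y = (fst x + fst y, snd x + snd y + B (fst x) (fst y))"
begin

sublocale B: bounded_bilinear B
  using bilinear_B bilinear_conv_bounded_bilinear by blast

text \<open>The left-invariant field with value \<open>(a, c)\<close> at the origin.\<close>

definition fld :: "real ^ 'm \<Rightarrow> real ^ 'n \<Rightarrow> ('m, 'n) pt \<Rightarrow> ('m, 'n) pt" where
  "fld a c = (\<lambda>x. (a, c + B (fst x) a))"

definition comm :: "real ^ 'm \<Rightarrow> real ^ 'm \<Rightarrow> real ^ 'n" where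
  "comm a b = B a b - B b a"

lemma fld_add: "fld a c + fld a' c' = fld (a + a') (c + c')"
  by (simp add: fld_def plus_fun_def B.add_right fun_eq_iff)

lemma fld_scaleR: "r *\<^sub>R fld a c = fld (r *\<^sub>R a) (r *\<^sub>R c)"
  by (simp add: fld_def scaleR_fun_def B.scaleR_right fun_eq_iff scaleR_add_right)

lemma fld_zero: "fld 0 0 = 0"
  by (simp add: fld_def zero_fun_def B.zero_right fun_eq_iff zero_prod_def)

lemma fld_at_zero: "fld a c 0 = (a, c)"
  by (simp add: fld_def B.zero_left)

lemma fld_inject [simp]: "fld a c = fld a' c' \<longleftrightarrow> a = a' \<and> c = c'"
  by (metis fld_at_zero prod.inject)

lemma has_derivative_mul: "(mul c has_derivative (\<lambda>w. (fst w, snd w + B (fst c) (fst w)))) (at x)"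
  unfolding mul_eq[abs_def]
  by (auto intro!: derivative_eq_intros B.FDERIV has_derivative_Pair simp: B.zero_left)

lemma has_derivative_fld: "(fld a c has_derivative (\<lambda>w. (0, B (fst w) a))) (at x)"
  unfolding fld_def
  by (auto intro!: derivative_eq_intros B.FDERIV has_derivative_Pair simp: B.zero_right)

lemmas frechet_derivative_mul = frechet_derivative_at[OF has_derivative_mul, symmetric]
lemmas frechet_derivative_fld = frechet_derivative_at[OF has_derivative_fld, symmetric]

lemma lie_algebra_eq: "lie_algebra mul = range (\<lambda>(a, c). fld a c)"
proof (intro equalityI subsetI)
  fix V assume "V \<in> lie_algebra mul"
  then have "\<forall>a x. frechet_derivative (mul a) (at x) (V x) = V (mul a x)"
    unfolding lie_algebra_def mem_Collect_eq by (rule conjunct2)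
  note V = this[rule_format]
  have "V a = fld (fst (V 0)) (snd (V 0)) a" for a
    using V[of a 0] unfolding frechet_derivative_mul
    by (simp add: mul_eq fld_def B.zero_right)
  then have "V = fld (fst (V 0)) (snd (V 0))" by (rule ext)
  then show "V \<in> range (\<lambda>(a, c). fld a c)"
    unfolding case_prod_beta by (rule range_eqI[where x = "V 0"])
next
  fix V assume "V \<in> range (\<lambda>(a, c). fld a c)"
  then obtain a c where V: "V = fld a c" by auto
  have "bounded_linear (\<lambda>x::('m, 'n) pt. (0 :: real ^ 'm, B (fst x) a))"
    unfolding linear_conv_bounded_linear[symmetric]
    by (auto intro!: linearI simp: B.add_left B.scaleR_left)
  from Ck_on_affine[OF this, of _ UNIV "(a, c)"] have "smooth_on UNIV V"
    unfolding V fld_def smooth_on_def by simp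
  moreover have "frechet_derivative (mul b) (at x) (V x) = V (mul b x)" for b x
    unfolding frechet_derivative_mul V
    by (simp add: fld_def mul_eq B.add_left)
  ultimately show "V \<in> lie_algebra mul" by (simp add: lie_algebra_def)
qed

lemma fld_in_lie_algebra [simp]: "fld a c \<in> lie_algebra mul"
  unfolding lie_algebra_eq by auto

lemma lie_bracket_fld: "lie_bracket (fld a c) (fld a' c') = fld 0 (comm a a')"
  unfolding lie_bracket_def frechet_derivative_fld
  by (simp add: fld_def comm_def B.zero_right fun_eq_iff)

text \<open>Of the two ways in which the horizontal layer is given, as the orthogonal complement of the centre and as the
  fields of degree one, the second identifies it: the factor \<open>t\<^sup>2\<close> on the centre forces \<open>c = 0\<close>.\<close>

lemma horizontal_eq: "horizontal mul ip = range (\<lambda>a. fld a 0)"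
proof -
  have h: "horizontal mul ip = {V \<in> lie_algebra mul. \<forall>t>0. \<forall>x. dilation t (V x) = t *\<^sub>R V (dilation t x)}"
    using h_type unfolding h_type_group_def by blast
  show ?thesis
  proof (intro equalityI subsetI)
    fix V assume V: "V \<in> horizontal mul ip"
    then obtain a c where Vf: "V = fld a c" unfolding h lie_algebra_eq by auto
    have "dilation 2 (V 0) = 2 *\<^sub>R V (dilation 2 0)" using V unfolding h mem_Collect_eq
      by (meson zero_less_numeral)
    then have "4 *\<^sub>R c = 2 *\<^sub>R c" by (simp add: Vf fld_at_zero dilation_def fld_def B.zero_left)
    then have "c = 0" by (simp only: scaleR_cancel_right) simp
    then show "V \<in> range (\<lambda>a. fld a 0)" using Vf by simp
  next
    fix V assume "V \<in> range (\<lambda>a. fld a 0)"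
    then obtain a where Vf: "V = fld a 0" by auto
    then show "V \<in> horizontal mul ip" unfolding h
      using fld_in_lie_algebra[of a 0]
      by (simp add: fld_def dilation_def B.scaleR_left power2_eq_square)
  qed
qed

text \<open>The group law alone would allow a horizontal field to be central. That the centre is spanned by
  brackets excludes it, since brackets have no horizontal component.\<close>

lemma lie_center_eq: "lie_center mul = range (fld 0)"
proof (intro equalityI subsetI)
  have "subspace (range (fld 0))"
  proof (rule subspaceI)
    show "0 \<in> range (fld 0)" using fld_zero by (metis rangeI)
    show "x + y \<in> range (fld 0)" if "x \<in> range (fld 0)" "y \<in> range (fld 0)" for x y
      using that by (auto simp: fld_add)
    show "r *\<^sub>R x \<in> range (fld 0)" if "x \<in> range (fld 0)" for r x
      using that by (auto simp: fld_scaleR)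
  qed
  moreover have "{lie_bracket V W | V W. V \<in> horizontal mul ip \<and> W \<in> horizontal mul ip} \<subseteq> range (fld 0)"
    unfolding horizontal_eq by (auto simp: lie_bracket_fld)
  ultimately have "span {lie_bracket V W | V W. V \<in> horizontal mul ip \<and> W \<in> horizontal mul ip} \<subseteq> range (fld 0)"
    by (intro span_minimal)
  then have "lie_center mul \<subseteq> range (fld 0)"
    using h_type unfolding h_type_group_def h_type_inner_product_def by (elim conjE) (simp only:)
  then show "Z \<in> range (fld 0)" if "Z \<in> lie_center mul" for Z using that by blast
next
  fix Z assume "Z \<in> range (fld 0)"
  then show "Z \<in> lie_center mul"
    unfolding lie_center_def lie_algebra_eq
    by (auto simp: lie_bracket_fld comm_def B.zero_left B.zero_right fld_zero)
qed

text \<open>Integral curves can be solved for explicitly, first component first; uniqueness holds because a function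
  with vanishing derivative is constant.\<close>

lemma lie_exp_fld: "lie_exp (fld a c) = (a, c + (1/2) *\<^sub>R B a a)"
proof -
  define \<gamma>0 where "\<gamma>0 = (\<lambda>t::real. (t *\<^sub>R a, t *\<^sub>R c + (t\<^sup>2 / 2) *\<^sub>R B a a))"
  have \<gamma>0: "(\<gamma>0 has_vector_derivative fld a c (\<gamma>0 t)) (at t)" for t
    unfolding \<gamma>0_def fld_def
    by (auto intro!: derivative_eq_intros has_vector_derivative_Pair simp: B.scaleR_left)
  have uniq: "\<gamma> = \<gamma>0" if g0: "\<gamma> 0 = 0" and g: "\<And>t. (\<gamma> has_vector_derivative fld a c (\<gamma> t)) (at t)"
    for \<gamma> :: "real \<Rightarrow> ('m, 'n) pt"
  proof -
    have const: "f t = f 0" if "\<And>t. (f has_vector_derivative 0) (at t)"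
      for f :: "real \<Rightarrow> 'z::real_normed_vector" and t
      using has_vector_derivative_zero_constant[of UNIV f] that by (metis UNIV_I convex_UNIV has_vector_derivative_at_within)
    have fs: "((\<lambda>t. fst (\<gamma> t)) has_vector_derivative a) (at t)" for t
      using has_derivative_fst[OF g[unfolded has_vector_derivative_def]]
      unfolding has_vector_derivative_def by (simp add: fld_def)
    have "((\<lambda>t. fst (\<gamma> t) - t *\<^sub>R a) has_vector_derivative 0) (at t)" for t
      by (auto intro!: derivative_eq_intros fs)
    from const[OF this] have f: "fst (\<gamma> t) = t *\<^sub>R a" for t using g0 by simp
    have sn: "((\<lambda>t. snd (\<gamma> t)) has_vector_derivative c + t *\<^sub>R B a a) (at t)" for t
      using has_derivative_snd[OF g[unfolded has_vector_derivative_def]]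
      unfolding has_vector_derivative_def by (simp add: fld_def f B.scaleR_left)
    have "((\<lambda>t. snd (\<gamma> t) - (t *\<^sub>R c + (t\<^sup>2 / 2) *\<^sub>R B a a)) has_vector_derivative 0) (at t)" for t
      by (auto intro!: derivative_eq_intros sn)
    from const[OF this] have s: "snd (\<gamma> t) = t *\<^sub>R c + (t\<^sup>2 / 2) *\<^sub>R B a a" for t using g0 by simp
    show ?thesis using f s by (auto simp: \<gamma>0_def prod_eq_iff)
  qed
  show ?thesis unfolding lie_exp_def
  proof (rule the_equality)
    show "\<exists>\<gamma>. \<gamma> 0 = 0 \<and> (\<forall>t. (\<gamma> has_vector_derivative fld a c (\<gamma> t)) (at t)) \<and>
        \<gamma> 1 = (a, c + (1/2) *\<^sub>R B a a)"
      using \<gamma>0 by (intro exI[of _ \<gamma>0]) (simp add: \<gamma>0_def zero_prod_def)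
    show "y = (a, c + (1/2) *\<^sub>R B a a)"
      if ex: "\<exists>\<gamma>. \<gamma> 0 = 0 \<and> (\<forall>t. (\<gamma> has_vector_derivative fld a c (\<gamma> t)) (at t)) \<and> \<gamma> 1 = y" for y
    proof -
      obtain \<gamma> where \<gamma>: "\<gamma> 0 = 0" "\<And>t. (\<gamma> has_vector_derivative fld a c (\<gamma> t)) (at t)" "\<gamma> 1 = y"
        using ex by (elim exE conjE) (rule that, assumption, erule spec, assumption)
      have "\<gamma> = \<gamma>0" using \<gamma>(1,2) by (rule uniq)
      then show ?thesis using \<gamma>(3) by (simp add: \<gamma>0_def)
    qed
  qed
qed

lemma v_part_eq: "v_part mul ip x = fld (fst x) 0"
  unfolding v_part_def horizontal_eq lie_center_eq
proof (rule the_equality)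
  show "fld (fst x) 0 \<in> range (\<lambda>a. fld a 0) \<and> (\<exists>Z\<in>range (fld 0). x = lie_exp (fld (fst x) 0 + Z))"
    by (auto simp: fld_add lie_exp_fld prod_eq_iff intro!: exI[of _ "snd x - (1/2) *\<^sub>R B (fst x) (fst x)"])
qed (auto simp: fld_add lie_exp_fld)

lemma z_part_eq: "z_part mul ip x = fld 0 (snd x - (1/2) *\<^sub>R B (fst x) (fst x))"
  unfolding z_part_def horizontal_eq lie_center_eq
proof (rule the_equality)
  show "fld 0 (snd x - (1/2) *\<^sub>R B (fst x) (fst x)) \<in> range (fld 0) \<and>
      (\<exists>V\<in>range (\<lambda>a. fld a 0). x = lie_exp (V + fld 0 (snd x - (1/2) *\<^sub>R B (fst x) (fst x))))"
    by (auto simp: fld_add lie_exp_fld prod_eq_iff intro!: exI[of _ "fst x"])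
qed (auto simp: fld_add lie_exp_fld)

definition ipV :: "real ^ 'm \<Rightarrow> real ^ 'm \<Rightarrow> real" where "ipV a b = ip (fld a 0) (fld b 0)"
definition ipZ :: "real ^ 'n \<Rightarrow> real ^ 'n \<Rightarrow> real" where "ipZ c d = ip (fld 0 c) (fld 0 d)"

lemma ip_on: "inner_product_on (lie_algebra mul) ip"
  using h_type unfolding h_type_group_def h_type_inner_product_def by blast

lemma ip_sym: "ip (fld a c) (fld a' c') = ip (fld a' c') (fld a c)"
  using ip_on unfolding inner_product_on_def by simp

lemma ip_add: "ip (fld a c + fld a' c') (fld b d) = ip (fld a c) (fld b d) + ip (fld a' c') (fld b d)"
  using ip_on unfolding inner_product_on_def by simp

lemma ip_scaleR: "ip (r *\<^sub>R fld a c) (fld b d) = r * ip (fld a c) (fld b d)"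
  using ip_on unfolding inner_product_on_def by simp

lemma ip_pos: "fld a c \<noteq> 0 \<Longrightarrow> ip (fld a c) (fld a c) > 0"
  using ip_on unfolding inner_product_on_def by simp

lemma ipV_bilinear: "bilinear ipV" and ipV_sym: "ipV a b = ipV b a"
proof -
  show sym: "ipV a b = ipV b a" for a b unfolding ipV_def by (rule ip_sym)
  have "linear (\<lambda>a. ipV a b)" for b
    by (rule linearI) (use ip_add[of _ 0 _ 0] ip_scaleR[of _ _ 0] in \<open>simp_all add: ipV_def fld_add fld_scaleR\<close>)
  then show "bilinear ipV" unfolding bilinear_def using sym by (metis (no_types, lifting) ext)
qed

lemma ipZ_bilinear: "bilinear ipZ" and ipZ_sym: "ipZ a b = ipZ b a"
proof -
  show sym: "ipZ a b = ipZ b a" for a b unfolding ipZ_def by (rule ip_sym)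
  have "linear (\<lambda>a. ipZ a b)" for b
    by (rule linearI) (use ip_add[of 0 _ 0] ip_scaleR[of _ 0] in \<open>simp_all add: ipZ_def fld_add fld_scaleR\<close>)
  then show "bilinear ipZ" unfolding bilinear_def using sym by (metis (no_types, lifting) ext)
qed

lemma ipZ_pos: "c \<noteq> 0 \<Longrightarrow> ipZ c c > 0"
  unfolding ipZ_def using ip_pos[of 0 c] fld_zero by (metis fld_inject)

text \<open>The isometry from \<open>\<real>\<^sup>m\<close> with its Euclidean inner product onto the horizontal layer that takes the standard
  basis to \<open>X\<close>.\<close>

definition T :: "real ^ 'm \<Rightarrow> real ^ 'm" where "T \<xi> = (\<Sum>i\<in>UNIV. \<xi> $ i *\<^sub>R fst (X i 0))"

lemma X_eq: "X i = fld (fst (X i 0)) 0"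
proof -
  have "X i \<in> horizontal mul ip"
    using basis unfolding orthonormal_horizontal_basis_def by (metis rangeI span_base)
  then obtain a where "X i = fld a 0" unfolding horizontal_eq by blast
  then show ?thesis by (simp add: fld_at_zero)
qed

lemma linear_T: "linear T"
  unfolding T_def by (rule linearI) (simp_all add: sum.distrib scaleR_add_left scaleR_sum_right)

lemma ipV_T: "ipV (T \<xi>) (T \<eta>) = \<xi> \<bullet> \<eta>"
proof -
  have l1: "linear (\<lambda>a. ipV a b)" and l2: "linear (ipV b)" for b
    using ipV_bilinear unfolding bilinear_def by blast+
  have X: "ipV (fst (X i 0)) (fst (X j 0)) = (if i = j then 1 else 0)" for i j
    unfolding ipV_def X_eq[symmetric] using basis unfolding orthonormal_horizontal_basis_def by blast
  have "ipV (T \<xi>) (T \<eta>) = (\<Sum>i\<in>UNIV. \<Sum>j\<in>UNIV. \<xi> $ i * (\<eta> $ j * (if i = j then 1 else 0)))"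
    unfolding T_def
    unfolding linear_sum[OF l1] linear_cmul[OF l1] linear_sum[OF l2] linear_cmul[OF l2] X
      real_scaleR_def sum_distrib_left
    by (subst sum.swap, intro sum.cong refl) simp
  then show ?thesis by (simp add: inner_vec_def if_distrib sum.delta cong: if_cong)
qed

lemma bij_T: "bij T"
proof -
  have "inj T"
    using linear_T
  proof (rule linear_injective_0[THEN iffD2, rule_format])
    fix \<xi> assume "T \<xi> = 0"
    then have "ipV (T \<xi>) (T \<xi>) = ipV (T 0) (T \<xi>)" using linear_0[OF linear_T] by simp
    then show "\<xi> = 0" unfolding ipV_T by simp
  qed
  then show ?thesis using linear_injective_imp_surjective[OF linear_T] by (simp add: bij_def)
qed

definition Ti where "Ti = inv T"

lemma T_Ti [simp]: "T (Ti a) = a" and Ti_T [simp]: "Ti (T \<xi>) = \<xi>"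
  unfolding Ti_def using bij_T by (simp_all add: bij_is_surj surj_f_inv_f bij_is_inj)

lemma linear_Ti: "linear Ti"
proof (rule linearI)
  show "Ti (a + b) = Ti a + Ti b" for a b
    by (metis T_Ti Ti_T linear_add[OF linear_T])
  show "Ti (r *\<^sub>R a) = r *\<^sub>R Ti a" for a r
    by (metis T_Ti Ti_T linear_cmul[OF linear_T])
qed

text \<open>An isometry from the centre onto \<open>\<real>\<^sup>n\<close>, obtained as a square root of the Gram matrix of \<open>ip\<close>.\<close>

definition M :: "real ^ 'n \<Rightarrow> real ^ 'n" where
  "M = (SOME M. linear M \<and> (\<forall>c d. ipZ c d = M c \<bullet> M d))"

lemma linear_M: "linear M" and ipZ_M: "ipZ c d = M c \<bullet> M d"
proof -
  have "ipZ c c \<ge> 0" for c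
    using ipZ_pos[of c] linear_0[of "\<lambda>a. ipZ a c"] ipZ_bilinear unfolding bilinear_def
    by (cases "c = 0") (auto simp: less_imp_le)
  from psd_form_sum_of_squares[OF ipZ_bilinear ipZ_sym this]
  obtain b where b: "\<And>c d. ipZ c d = (\<Sum>e\<in>(Basis :: (real ^ 'n) set). (b e \<bullet> c) * (b e \<bullet> d))"
    by blast
  define M' where "M' = (\<lambda>c. \<Sum>e\<in>(Basis :: (real ^ 'n) set). (b e \<bullet> c) *\<^sub>R e)"
  have "linear M'"
    unfolding M'_def by (rule linearI) (simp_all add: inner_add_right scaleR_add_left sum.distrib scaleR_sum_right)
  moreover have "M' c \<bullet> e = b e \<bullet> c" if "e \<in> Basis" for c e
    unfolding M'_def using that by simp
  then have "ipZ c d = M' c \<bullet> M' d" for c d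
    unfolding b by (subst euclidean_inner) (auto intro!: sum.cong)
  ultimately have "\<exists>M :: real ^ 'n \<Rightarrow> real ^ 'n. linear M \<and> (\<forall>c d. ipZ c d = M c \<bullet> M d)" by blast
  then have "linear M \<and> (\<forall>c d. ipZ c d = M c \<bullet> M d)" unfolding M_def by (rule someI_ex)
  then show "linear M" "ipZ c d = M c \<bullet> M d" by auto
qed

lemma bij_M: "bij M"
proof -
  have "inj M"
    using linear_M
  proof (rule linear_injective_0[THEN iffD2, rule_format])
    fix c assume "M c = 0"
    then have "ipZ c c = 0" unfolding ipZ_M by simp
    then show "c = 0" using ipZ_pos[of c] by (cases "c = 0") auto
  qed
  then show ?thesis using linear_injective_imp_surjective[OF linear_M] by (simp add: bij_def)
qed

definition Mi where "Mi = inv M"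

lemma M_Mi [simp]: "M (Mi a) = a" and Mi_M [simp]: "Mi (M c) = c"
  unfolding Mi_def using bij_M by (simp_all add: bij_is_surj surj_f_inv_f bij_is_inj)

lemma linear_Mi: "linear Mi"
proof (rule linearI)
  show "Mi (a + b) = Mi a + Mi b" for a b
    by (metis M_Mi Mi_M linear_add[OF linear_M])
  show "Mi (r *\<^sub>R a) = r *\<^sub>R Mi a" for a r
    by (metis M_Mi Mi_M linear_cmul[OF linear_M])
qed

definition br :: "real ^ 'm \<Rightarrow> real ^ 'm \<Rightarrow> real ^ 'n" where
  "br \<xi> \<eta> = M (comm (T \<xi>) (T \<eta>))"

definition J :: "real ^ 'n \<Rightarrow> real ^ 'm \<Rightarrow> real ^ 'm" where
  "J z \<xi> = (\<Sum>e\<in>Basis. (z \<bullet> br \<xi> e) *\<^sub>R e)"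

lemma bilinear_br: "bilinear br"
  unfolding bilinear_def br_def comm_def
  by (auto intro!: linearI simp: linear_add[OF linear_T] linear_cmul[OF linear_T] linear_add[OF linear_M]
      linear_cmul[OF linear_M] linear_diff[OF linear_M] B.add_left B.add_right B.scaleR_left B.scaleR_right
      scaleR_diff_right)

lemma J_adjoint: "J z \<xi> \<bullet> \<eta> = z \<bullet> br \<xi> \<eta>"
proof -
  have l: "linear (br \<xi>)" using bilinear_br unfolding bilinear_def by blast
  have "z \<bullet> br \<xi> \<eta> = z \<bullet> br \<xi> (\<Sum>e\<in>Basis. (\<eta> \<bullet> e) *\<^sub>R e)" by (simp add: euclidean_representation)
  also have "\<dots> = (\<Sum>e\<in>Basis. (\<eta> \<bullet> e) * (z \<bullet> br \<xi> e))"
    by (simp only: linear_sum[OF l] linear_cmul[OF l] inner_sum_right inner_scaleR_right)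
  finally show ?thesis
    unfolding J_def by (simp add: inner_sum_left inner_commute[of \<eta>] mult.commute)
qed

lemma J_map_fld:
  "J_map mul ip (fld 0 (Mi z)) (fld (T \<xi>) 0) = fld (T (J z \<xi>)) 0"
  unfolding J_map_def horizontal_eq
proof (rule the_equality)
  have *: "ip (fld 0 (Mi z)) (lie_bracket (fld (T \<xi>) 0) (fld (T \<eta>) 0)) = z \<bullet> br \<xi> \<eta>" for \<eta>
    unfolding lie_bracket_fld ipZ_def[symmetric] ipZ_M br_def by simp
  have **: "ip (fld (T \<zeta>) 0) (fld (T \<eta>) 0) = \<zeta> \<bullet> \<eta>" for \<zeta> \<eta>
    unfolding ipV_def[symmetric] by (rule ipV_T)
  show "fld (T (J z \<xi>)) 0 \<in> range (\<lambda>a. fld a 0) \<and> (\<forall>W\<in>range (\<lambda>a. fld a 0).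
      ip (fld (T (J z \<xi>)) 0) W = ip (fld 0 (Mi z)) (lie_bracket (fld (T \<xi>) 0) W))"
  proof (intro conjI ballI)
    fix W assume "W \<in> range (\<lambda>a. fld a 0)"
    then obtain a where "W = fld (T (Ti a)) 0" by auto
    then show "ip (fld (T (J z \<xi>)) 0) W = ip (fld 0 (Mi z)) (lie_bracket (fld (T \<xi>) 0) W)"
      using * ** J_adjoint by metis
  qed auto
  fix U assume U: "U \<in> range (\<lambda>a. fld a 0) \<and> (\<forall>W\<in>range (\<lambda>a. fld a 0).
      ip U W = ip (fld 0 (Mi z)) (lie_bracket (fld (T \<xi>) 0) W))"
  then obtain a where a: "U = fld (T (Ti a)) 0" by auto
  have "Ti a \<bullet> \<eta> = J z \<xi> \<bullet> \<eta>" for \<eta>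
  proof -
    have "ip U (fld (T \<eta>) 0) = ip (fld 0 (Mi z)) (lie_bracket (fld (T \<xi>) 0) (fld (T \<eta>) 0))"
      using U by blast
    then show ?thesis unfolding a * ** J_adjoint .
  qed
  then have "Ti a = J z \<xi>" using vector_eq_rdot by blast
  then show "U = fld (T (J z \<xi>)) 0" using a by simp
qed

text \<open>The H-type condition is about central elements of length one and the abstract map \<open>J_map\<close>. By
  \<open>J_map_fld\<close> it says that \<open>J z\<close> is orthogonal for unit \<open>z\<close>; the rest is homogeneity in \<open>z\<close>.\<close>

lemma norm_J: "norm (J z \<xi>) = norm z * norm \<xi>"
proof -
  have unit: "norm (J z \<xi>) = norm \<xi>" if "norm z = 1" for z
  proof -
    have Z: "fld 0 (Mi z) \<in> lie_center mul" unfolding lie_center_eq by blast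
    have "ip (fld 0 (Mi z)) (fld 0 (Mi z)) = 1"
      unfolding ipZ_def[symmetric] ipZ_M using that by (simp add: dot_square_norm)
    then have "ip (J_map mul ip (fld 0 (Mi z)) (fld (T \<xi>) 0)) (J_map mul ip (fld 0 (Mi z)) (fld (T \<xi>) 0))
        = ip (fld (T \<xi>) 0) (fld (T \<xi>) 0)"
      using h_type Z unfolding h_type_group_def h_type_inner_product_def horizontal_eq by blast
    then have "J z \<xi> \<bullet> J z \<xi> = \<xi> \<bullet> \<xi>"
      unfolding J_map_fld ipV_def[symmetric] ipV_T .
    then show ?thesis by (simp add: norm_eq_sqrt_inner)
  qed
  show ?thesis
  proof (cases "z = 0")
    case True then show ?thesis by (simp add: J_def)
  next
    case False
    have "J z \<xi> = norm z *\<^sub>R J ((1 / norm z) *\<^sub>R z) \<xi>"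
      using False unfolding J_def by (simp add: scaleR_sum_right)
    then show ?thesis using unit[of "(1 / norm z) *\<^sub>R z"] False by simp
  qed
qed

sublocale model: htype br J
proof
  show "bilinear br" by (rule bilinear_br)
  show "br v v = 0" for v unfolding br_def comm_def using linear_0[OF linear_M] by simp
  show "J z v \<bullet> w = z \<bullet> br v w" for z v w by (rule J_adjoint)
  show "norm (J z v) = norm z * norm v" for z v by (rule norm_J)
qed

text \<open>Exponential coordinates with respect to orthonormal bases; the term \<open>B x\<^sub>1 x\<^sub>1 / 2\<close> comes from the exponential
  map and replaces \<open>B\<close> by its antisymmetric part, which is half the bracket.\<close>

definition \<Psi> :: "('m, 'n) pt \<Rightarrow> ('m, 'n) pt" where
  "\<Psi> x = (Ti (fst x), M (snd x - (1/2) *\<^sub>R B (fst x) (fst x)))"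

definition \<Psi>i :: "('m, 'n) pt \<Rightarrow> ('m, 'n) pt" where
  "\<Psi>i y = (T (fst y), Mi (snd y) + (1/2) *\<^sub>R B (T (fst y)) (T (fst y)))"

lemma \<Psi>_\<Psi>i [simp]: "\<Psi> (\<Psi>i y) = y" and \<Psi>i_\<Psi> [simp]: "\<Psi>i (\<Psi> x) = x"
  by (simp_all add: \<Psi>_def \<Psi>i_def)

lemma \<Psi>_mul: "\<Psi> (mul x y) = model.gmul (\<Psi> x) (\<Psi> y)"
proof -
  have "snd x + snd y + B (fst x) (fst y) - (1/2) *\<^sub>R B (fst x + fst y) (fst x + fst y)
     = (snd x - (1/2) *\<^sub>R B (fst x) (fst x)) + (snd y - (1/2) *\<^sub>R B (fst y) (fst y)) + (1/2) *\<^sub>R comm (fst x) (fst y)"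
  proof -
    have "B (fst x) (fst y) = (1/2) *\<^sub>R B (fst x) (fst y) + (1/2) *\<^sub>R B (fst x) (fst y)"
      by (simp flip: scaleR_add_left)
    then show ?thesis
      unfolding comm_def B.add_left B.add_right scaleR_add_right scaleR_diff_right by (simp add: algebra_simps)
  qed
  then have "M (snd x + snd y + B (fst x) (fst y) - (1/2) *\<^sub>R B (fst x + fst y) (fst x + fst y))
      = M (snd x - (1/2) *\<^sub>R B (fst x) (fst x)) + M (snd y - (1/2) *\<^sub>R B (fst y) (fst y))
        + (1/2) *\<^sub>R M (comm (fst x) (fst y))"
    by (simp only: linear_add[OF linear_M] linear_cmul[OF linear_M])
  then show ?thesis
    unfolding \<Psi>_def mul_eq model.gmul_def br_def by (simp add: linear_add[OF linear_Ti])
qed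

lemma \<Psi>_iv: "\<Psi> (iv x) = - \<Psi> x"
proof -
  interpret group mul 0 iv
    using h_type unfolding h_type_group_def homogeneous_lie_group_def by blast
  have "\<Psi> 0 = 0" by (simp add: \<Psi>_def linear_0[OF linear_Ti] linear_0[OF linear_M] B.zero_left zero_prod_def)
  then have e: "model.gmul (\<Psi> (iv x)) (\<Psi> x) = 0" unfolding \<Psi>_mul[symmetric] by simp
  have "\<Psi> (iv x) = model.gmul (model.gmul (\<Psi> (iv x)) (\<Psi> x)) (- \<Psi> x)"
    by (simp add: model.gmul_assoc)
  then show ?thesis unfolding e by simp
qed

lemma gauge_eq: "gauge mul ip x = model.gnorm (\<Psi> x)"
proof -
  have "ip_norm ip (v_part mul ip x) = norm (fst (\<Psi> x))"
  proof -
    have "ip (fld (fst x) 0) (fld (fst x) 0) = Ti (fst x) \<bullet> Ti (fst x)"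
      using ipV_T[of "Ti (fst x)" "Ti (fst x)"] by (simp add: ipV_def)
    then show ?thesis by (simp add: ip_norm_def v_part_eq \<Psi>_def norm_eq_sqrt_inner)
  qed
  moreover have "ip_norm ip (z_part mul ip x) = norm (snd (\<Psi> x))"
    unfolding ip_norm_def z_part_eq ipZ_def[symmetric] ipZ_M by (simp add: \<Psi>_def norm_eq_sqrt_inner)
  ultimately have "gauge mul ip x = root 4 (model.gnorm (\<Psi> x) ^ 4)"
    unfolding gauge_def model.gnorm_power4 by simp
  then show ?thesis by (simp add: real_root_power_cancel)
qed

lemma gauge_ball_eq: "gauge_ball mul iv ip x0 R = \<Psi> -` model.gball (\<Psi> x0) R"
  unfolding gauge_ball_def model.gball_def model.gdist_def gauge_eq \<Psi>_mul \<Psi>_iv by auto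

end

section \<open>Transfer to the given group\<close>

text \<open>In the extended reals, so that an empty set or an unbounded function needs no separate treatment.\<close>

lemma SUP_le_cmult_INF_ereal:
  fixes u :: "'a \<Rightarrow> real"
  assumes C: "C > 0" and le: "\<And>x y. x \<in> S \<Longrightarrow> y \<in> S \<Longrightarrow> u x \<le> C * u y"
  shows "(SUP x\<in>S. ereal (u x)) \<le> ereal C * (INF x\<in>S. ereal (u x))"
proof (rule SUP_least)
  fix x assume x: "x \<in> S"
  have "ereal (u x / C) \<le> (INF y\<in>S. ereal (u y))"
  proof (rule INF_greatest)
    fix y assume "y \<in> S"
    then show "ereal (u x / C) \<le> ereal (u y)" using le[OF x, of y] C by (simp add: field_simps)
  qed
  then have "ereal C * ereal (u x / C) \<le> ereal C * (INF y\<in>S. ereal (u y))"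
    using C by (intro ereal_mult_left_mono) auto
  then show "ereal (u x) \<le> ereal C * (INF y\<in>S. ereal (u y))" using C by simp
qed

text \<open>The class \<open>Ck_on\<close> speaks of derivatives in constant directions; expanding \<open>V\<close> in the standard basis
  reduces to these. The expansion needs linearity of the derivative, hence holds only inside \<open>S\<close>.\<close>

lemma Ck_on_2_deriv_along_differentiable:
  fixes u :: "'a::euclidean_space \<Rightarrow> real"
  assumes S: "open S" "x \<in> S" and u: "Ck_on 2 S u" and V: "V differentiable (at x)"
  shows "deriv_along V u differentiable (at x)"
proof -
  have d1: "\<And>y. y \<in> S \<Longrightarrow> u differentiable (at y)"
    and d2: "\<And>y v. y \<in> S \<Longrightarrow> (\<lambda>y. frechet_derivative u (at y) v) differentiable (at y)"
    using u unfolding numeral_2_eq_2 Ck_on.simps by blast+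
  obtain V' where V': "(V has_derivative V') (at x)" using V by (auto simp: differentiable_def)
  define g where "g = (\<lambda>y. \<Sum>b\<in>Basis. (V y \<bullet> b) * frechet_derivative u (at y) b)"
  have "g differentiable (at x)"
    unfolding g_def
  proof (intro differentiable_sum differentiable_mult finite_Basis ballI d2 S(2))
    show "(\<lambda>y. V y \<bullet> b) differentiable (at x)" for b
      using has_derivative_inner_left[OF V', of b] by (auto simp: differentiable_def)
  qed
  then obtain g' where g': "(g has_derivative g') (at x)" by (auto simp: differentiable_def)
  have "g y = deriv_along V u y" if "y \<in> S" for y
  proof -
    have l: "linear (frechet_derivative u (at y))"
      using d1[OF that] linear_frechet_derivative by blast
    have "deriv_along V u y = frechet_derivative u (at y) (\<Sum>b\<in>Basis. (V y \<bullet> b) *\<^sub>R b)"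
      by (simp add: deriv_along_def euclidean_representation)
    then show ?thesis unfolding g_def by (simp only: linear_sum[OF l] linear_cmul[OF l] real_scaleR_def)
  qed
  then have "(deriv_along V u has_derivative g') (at x)"
    using has_derivative_transform_within_open[OF g' S] by blast
  then show ?thesis by (auto simp: differentiable_def)
qed

context h_type_coordinates begin

lemma continuous_\<Psi>: "continuous_on UNIV \<Psi>" and continuous_\<Psi>i: "continuous_on UNIV \<Psi>i"
proof -
  note l = linear_Ti linear_M linear_T linear_Mi
  note c = l[unfolded linear_conv_bounded_linear, THEN bounded_linear.continuous_on]
  show "continuous_on UNIV \<Psi>" unfolding \<Psi>_def
    by (intro continuous_on_Pair c continuous_on_diff continuous_on_scaleR B.continuous_on continuous_on_const
        continuous_on_fst continuous_on_snd continuous_on_id)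
  show "continuous_on UNIV \<Psi>i" unfolding \<Psi>i_def
    by (intro continuous_on_Pair c continuous_on_add continuous_on_scaleR B.continuous_on continuous_on_const
        continuous_on_fst continuous_on_snd continuous_on_id)
qed

lemma open_gauge_ball: "open (gauge_ball mul iv ip x0 R)"
  unfolding gauge_ball_eq by (rule open_vimage[OF model.open_gball continuous_\<Psi>])

lemma fld_T: "fld (T \<xi>) 0 y = (\<Sum>i\<in>UNIV. \<xi> $ i *\<^sub>R X i y)"
proof -
  have "X i y = (fst (X i 0), B (fst y) (fst (X i 0)))" for i
    by (subst X_eq) (simp add: fld_def)
  then show ?thesis
    by (simp add: fld_def T_def B.sum_right B.scaleR_right prod_eq_iff fst_sum snd_sum)
qed

text \<open>In the original coordinates the model curve is the integral curve \<open>x \<circ> Exp (t \<xi>)\<close> of \<open>\<Sum> \<xi>\<^sub>i X\<^sub>i\<close>, so each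
  differentiation in \<open>t\<close> applies this field. The fields do not commute, but only the quadratic form of the matrix
  \<open>X\<^sub>i X\<^sub>j u\<close> enters.\<close>

lemma has_second_deriv_along:
  fixes u :: "('m, 'n) pt \<Rightarrow> real"
  assumes S: "open S" "x \<in> S" and u: "Ck_on 2 S u"
  shows "has_second_deriv (\<lambda>t. (u \<circ> \<Psi>i) (model.gmul (\<Psi> x) (t *\<^sub>R \<xi>, 0)))
    (\<Sum>i\<in>UNIV. \<Sum>j\<in>UNIV. \<xi> $ i * \<xi> $ j * deriv_along (X i) (deriv_along (X j) u) x)"
proof -
  define \<gamma> where "\<gamma> = (\<lambda>t::real. (fst x + t *\<^sub>R T \<xi>, snd x + (t\<^sup>2/2) *\<^sub>R B (T \<xi>) (T \<xi>) + t *\<^sub>R B (fst x) (T \<xi>)))"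
  have \<gamma>: "\<Psi>i (model.gmul (\<Psi> x) (t *\<^sub>R \<xi>, 0)) = \<gamma> t" for t
  proof -
    have "model.gmul (\<Psi> x) (t *\<^sub>R \<xi>, 0) = \<Psi> (mul x (\<Psi>i (t *\<^sub>R \<xi>, 0)))" by (simp add: \<Psi>_mul)
    then have e: "\<Psi>i (model.gmul (\<Psi> x) (t *\<^sub>R \<xi>, 0)) = mul x (\<Psi>i (t *\<^sub>R \<xi>, 0))" by simp
    show ?thesis
      unfolding e by (simp add: \<gamma>_def mul_eq \<Psi>i_def linear_cmul[OF linear_T] linear_0[OF linear_Mi]
          B.scaleR_left B.scaleR_right power2_eq_square)
  qed
  have \<gamma>0: "\<gamma> 0 = x" by (simp add: \<gamma>_def)
  have \<gamma>': "(\<gamma> has_vector_derivative (\<Sum>i\<in>UNIV. \<xi> $ i *\<^sub>R X i (\<gamma> t))) (at t)" for t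
  proof -
    have "(\<gamma> has_vector_derivative (T \<xi>, t *\<^sub>R B (T \<xi>) (T \<xi>) + B (fst x) (T \<xi>))) (at t)"
      unfolding \<gamma>_def by (auto intro!: derivative_eq_intros has_vector_derivative_Pair)
    moreover have "(T \<xi>, t *\<^sub>R B (T \<xi>) (T \<xi>) + B (fst x) (T \<xi>)) = fld (T \<xi>) 0 (\<gamma> t)"
      by (simp add: fld_def \<gamma>_def B.add_left B.scaleR_left)
    ultimately show ?thesis unfolding fld_T by simp
  qed
  have d1: "\<And>y. y \<in> S \<Longrightarrow> u differentiable (at y)"
    using u unfolding numeral_2_eq_2 Ck_on.simps by blast
  have chain: "((\<lambda>t. g (\<gamma> t)) has_real_derivative (\<Sum>i\<in>UNIV. \<xi> $ i * deriv_along (X i) g (\<gamma> t))) (at t)"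
    if g: "g differentiable (at (\<gamma> t))" for g and t
  proof -
    have gd: "(g has_derivative frechet_derivative g (at (\<gamma> t))) (at (\<gamma> t))"
      using g frechet_derivative_works by blast
    then have l: "linear (frechet_derivative g (at (\<gamma> t)))" using has_derivative_linear by blast
    have "(g \<circ> \<gamma> has_vector_derivative frechet_derivative g (at (\<gamma> t)) (\<Sum>i\<in>UNIV. \<xi> $ i *\<^sub>R X i (\<gamma> t))) (at t)"
      using vector_derivative_diff_chain_within[of \<gamma> _ t UNIV g] \<gamma>' gd has_derivative_at_withinI by blast
    moreover have "frechet_derivative g (at (\<gamma> t)) (\<Sum>i\<in>UNIV. \<xi> $ i *\<^sub>R X i (\<gamma> t))
        = (\<Sum>i\<in>UNIV. \<xi> $ i * deriv_along (X i) g (\<gamma> t))"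
      by (simp only: linear_sum[OF l] linear_cmul[OF l] deriv_along_def real_scaleR_def)
    ultimately show ?thesis by (simp add: has_real_derivative_iff_has_vector_derivative o_def)
  qed
  have fst_d: "\<forall>\<^sub>F t in nhds 0. ((\<lambda>t. u (\<gamma> t)) has_real_derivative
      (\<Sum>j\<in>UNIV. \<xi> $ j * deriv_along (X j) u (\<gamma> t))) (at t)"
  proof -
    have "isCont \<gamma> 0" using \<gamma>' has_vector_derivative_continuous by blast
    then have "(\<gamma> \<longlongrightarrow> x) (nhds 0)" unfolding isCont_def \<gamma>0 using tendsto_at_iff_tendsto_nhds[of \<gamma> 0] \<gamma>0 by simp
    then have "\<forall>\<^sub>F t in nhds 0. \<gamma> t \<in> S" using S topological_tendstoD by blast
    then show ?thesis by eventually_elim (rule chain[OF d1])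
  qed
  have snd_d: "((\<lambda>t. \<Sum>j\<in>UNIV. \<xi> $ j * deriv_along (X j) u (\<gamma> t)) has_real_derivative
      (\<Sum>j\<in>UNIV. \<xi> $ j * (\<Sum>i\<in>UNIV. \<xi> $ i * deriv_along (X i) (deriv_along (X j) u) (\<gamma> 0)))) (at 0)"
  proof (intro DERIV_sum DERIV_cmult chain)
    fix j
    have "X j differentiable (at x)"
      by (subst X_eq) (unfold differentiable_def, rule exI, rule has_derivative_fld)
    then show "deriv_along (X j) u differentiable (at (\<gamma> 0))"
      unfolding \<gamma>0 by (rule Ck_on_2_deriv_along_differentiable[OF S u])
  qed
  have "(\<Sum>j\<in>UNIV. \<xi> $ j * (\<Sum>i\<in>UNIV. \<xi> $ i * deriv_along (X i) (deriv_along (X j) u) (\<gamma> 0)))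
     = (\<Sum>i\<in>UNIV. \<Sum>j\<in>UNIV. \<xi> $ i * \<xi> $ j * deriv_along (X i) (deriv_along (X j) u) x)"
    unfolding \<gamma>0 sum_distrib_left by (subst sum.swap) (simp add: ac_simps)
  then show ?thesis
    unfolding has_second_deriv_def o_def \<gamma> using fst_d snd_d by auto
qed

text \<open>The coefficient matrix is written as \<open>\<Sum> b\<^sub>e b\<^sub>e\<^sup>T\<close>. Its extreme values on the unit sphere serve as \<open>\<mu>\<close> and \<open>N\<close>, so
  that the Landis condition is literally the inequality required of a solution in the model.\<close>

lemma landis_solution_transfer:
  fixes A :: "('m, 'n) pt \<Rightarrow> real ^ 'm ^ 'm"
  assumes S: "open S" "x \<in> S" and u: "Ck_on 2 S u"
    and A: "A x \<in> elliptic_matrices lam Lam" and lam: "0 < lam"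
    and landis: "landis_condition \<delta> \<Omega> A" "x \<in> \<Omega>"
    and eq: "nondiv_op X A u x = 0"
  shows "model.landis_solution \<delta> (u \<circ> \<Psi>i) (\<Psi> x)"
proof -
  have trA: "transpose (A x) = A x"
    and ell: "\<And>\<xi>. lam * (norm \<xi>)\<^sup>2 \<le> (A x *v \<xi>) \<bullet> \<xi>" "\<And>\<xi>. (A x *v \<xi>) \<bullet> \<xi> \<le> Lam * (norm \<xi>)\<^sup>2"
    using A unfolding elliptic_matrices_def by auto
  define P where "P = (\<lambda>\<xi> \<eta>. (A x *v \<xi>) \<bullet> \<eta>)"
  have "bilinear P"
    unfolding bilinear_def P_def
    by (auto intro!: linearI simp: matrix_vector_right_distrib inner_add_left inner_add_right
        matrix_vector_mult_scaleR)
  moreover have "P \<xi> \<eta> = P \<eta> \<xi>" for \<xi> \<eta>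
    unfolding P_def using dot_lmul_matrix[of \<eta> "A x" \<xi>] trA
    by (metis inner_commute transpose_matrix_vector)
  moreover have "P \<xi> \<xi> \<ge> 0" for \<xi>
    using ell(1)[of \<xi>] lam unfolding P_def by (metis mult_nonneg_nonneg less_imp_le order_trans zero_le_power2)
  ultimately have "\<exists>b. \<forall>\<xi> \<eta>. P \<xi> \<eta> = (\<Sum>e\<in>(Basis :: (real ^ 'm) set). (b e \<bullet> \<xi>) * (b e \<bullet> \<eta>))"
    by (rule psd_form_sum_of_squares)
  then obtain b where b: "\<And>\<xi> \<eta>. P \<xi> \<eta> = (\<Sum>e\<in>(Basis :: (real ^ 'm) set). (b e \<bullet> \<xi>) * (b e \<bullet> \<eta>))"
    by blast
  have Aij: "A x $ i $ j = (\<Sum>e\<in>Basis. b e $ i * b e $ j)" for i j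
  proof -
    have "A x $ i $ j = P (axis j 1) (axis i 1)"
      by (simp add: P_def matrix_vector_mult_basis column_def inner_axis)
    then show ?thesis unfolding b by (simp add: inner_axis mult.commute)
  qed
  have sq: "(\<Sum>e\<in>Basis. (b e \<bullet> \<xi>)\<^sup>2) = (A x *v \<xi>) \<bullet> \<xi>" for \<xi>
    using b[of \<xi> \<xi>] by (simp add: P_def power2_eq_square)
  have tr: "(\<Sum>e\<in>Basis. (norm (b e))\<^sup>2) = trace (A x)"
    unfolding trace_def Aij power2_norm_eq_inner inner_vec_def by (subst sum.swap) simp
  define q where "q = (\<lambda>\<xi>. (A x *v \<xi>) \<bullet> \<xi>)"
  define \<mu> N where "\<mu> = (INF \<xi>\<in>sphere 0 1. q \<xi>)" and "N = (SUP \<xi>\<in>sphere 0 1. q \<xi>)"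
  have ne: "sphere (0 :: real ^ 'm) 1 \<noteq> {}" by simp
  have bb: "bdd_below (q ` sphere 0 1)" "bdd_above (q ` sphere 0 1)"
    using ell unfolding q_def by (auto intro!: bdd_belowI2[of _ lam] bdd_aboveI2[of _ _ Lam]) (metis mult.right_neutral power_one)+
  have "lam \<le> \<mu>" unfolding \<mu>_def
  proof (rule cINF_greatest[OF ne])
    show "lam \<le> q \<xi>" if "\<xi> \<in> sphere 0 1" for \<xi>
      using ell(1)[of \<xi>] that by (simp add: q_def)
  qed
  with lam have \<mu>: "\<mu> > 0" by simp
  have bounds: "\<mu> * (norm \<xi>)\<^sup>2 \<le> q \<xi> \<and> q \<xi> \<le> N * (norm \<xi>)\<^sup>2" for \<xi>
  proof (cases "\<xi> = 0")
    case True
    then show ?thesis by (simp add: q_def)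
  next
    case False
    define \<zeta> where "\<zeta> = (1 / norm \<xi>) *\<^sub>R \<xi>"
    have z: "\<zeta> \<in> sphere 0 1" using False by (simp add: \<zeta>_def)
    have "\<xi> = norm \<xi> *\<^sub>R \<zeta>" using False by (simp add: \<zeta>_def)
    then have "q \<xi> = q (norm \<xi> *\<^sub>R \<zeta>)" by simp
    also have "\<dots> = q \<zeta> * (norm \<xi>)\<^sup>2"
      by (simp add: q_def matrix_vector_mult_scaleR power2_eq_square)
    finally have "q \<xi> = q \<zeta> * (norm \<xi>)\<^sup>2" .
    moreover have "\<mu> \<le> q \<zeta>" "q \<zeta> \<le> N"
      unfolding \<mu>_def N_def using z bb by (auto intro: cINF_lower cSUP_upper)
    ultimately show ?thesis by (simp add: mult_right_mono)
  qed
  have L: "(\<Sum>e\<in>Basis. (norm (b e))\<^sup>2) + (2 * real DIM(real ^ 'n) + 2) * N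
      \<le> (real DIM(real ^ 'm) + 2 * real DIM(real ^ 'n) + 4 - \<delta>) * \<mu>"
    using landis unfolding landis_condition_def homogeneous_dimension_def Let_def tr \<mu>_def N_def q_def
    by (auto simp: algebra_simps)
  define H where "H = (\<lambda>i j. deriv_along (X i) (deriv_along (X j) u) x)"
  have "(\<Sum>e\<in>Basis. \<Sum>i\<in>UNIV. \<Sum>j\<in>UNIV. b e $ i * b e $ j * H i j) = nondiv_op X A u x"
  proof -
    have "(\<Sum>e\<in>Basis. \<Sum>i\<in>UNIV. \<Sum>j\<in>UNIV. b e $ i * b e $ j * H i j)
        = (\<Sum>i\<in>UNIV. \<Sum>e\<in>Basis. \<Sum>j\<in>UNIV. b e $ i * b e $ j * H i j)" by (rule sum.swap)
    also have "\<dots> = (\<Sum>i\<in>UNIV. \<Sum>j\<in>UNIV. \<Sum>e\<in>Basis. b e $ i * b e $ j * H i j)"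
      by (intro sum.cong refl sum.swap)
    also have "\<dots> = nondiv_op X A u x"
      unfolding nondiv_op_def H_def Aij sum_distrib_right ..
    finally show ?thesis .
  qed
  then have z: "(\<Sum>e\<in>Basis. \<Sum>i\<in>UNIV. \<Sum>j\<in>UNIV. b e $ i * b e $ j * H i j) = 0" using eq by simp
  show ?thesis
    unfolding model.landis_solution_def
    by (rule exI[of _ b], rule exI[of _ "\<lambda>e. \<Sum>i\<in>UNIV. \<Sum>j\<in>UNIV. b e $ i * b e $ j * H i j"],
        rule exI[of _ \<mu>], rule exI[of _ N])
      (use \<mu> bounds L z has_second_deriv_along[OF S u] in \<open>auto simp: sq q_def H_def\<close>)
qed

end

theorem theorem1p1:
  fixes mul :: "('m::finite, 'n::finite) pt \<Rightarrow> ('m, 'n) pt \<Rightarrow> ('m, 'n) pt"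
    and iv :: "('m, 'n) pt \<Rightarrow> ('m, 'n) pt"
    and ip :: "(('m, 'n) pt \<Rightarrow> ('m, 'n) pt) \<Rightarrow> (('m, 'n) pt \<Rightarrow> ('m, 'n) pt) \<Rightarrow> real"
    and X :: "'m \<Rightarrow> ('m, 'n) pt \<Rightarrow> ('m, 'n) pt"
    and lam Lam \<delta> :: real
  assumes "h_type_group mul iv ip"
    and "orthonormal_horizontal_basis mul ip X"
    and "0 < lam" and "lam \<le> Lam"
    and "0 < \<delta>" and "\<delta> \<le> 2"
  shows "\<exists>C>0. \<exists>\<eta>\<ge>1.
    \<forall>(\<Omega> :: ('m, 'n) pt set) (A :: ('m, 'n) pt \<Rightarrow> real ^ 'm ^ 'm) (x0 :: ('m, 'n) pt) (R :: real)
      (u :: ('m, 'n) pt \<Rightarrow> real).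
      open \<Omega> \<longrightarrow>
      (\<forall>i j. smooth_on \<Omega> (\<lambda>x. A x $ i $ j)) \<longrightarrow>
      (\<forall>x\<in>\<Omega>. A x \<in> elliptic_matrices lam Lam) \<longrightarrow>
      landis_condition \<delta> \<Omega> A \<longrightarrow>
      R > 0 \<longrightarrow>
      gauge_ball mul iv ip x0 (\<eta> * R) \<subseteq> \<Omega> \<longrightarrow>
      Ck_on 2 (gauge_ball mul iv ip x0 (\<eta> * R)) u \<longrightarrow>
      (\<forall>x\<in>gauge_ball mul iv ip x0 (\<eta> * R). u x \<ge> 0 \<and> nondiv_op X A u x = 0) \<longrightarrow>
      (SUP x\<in>gauge_ball mul iv ip x0 R. ereal (u x))
        \<le> ereal C * (INF x\<in>gauge_ball mul iv ip x0 R. ereal (u x))"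
proof -
  have "homogeneous_lie_group mul iv" using assms(1) unfolding h_type_group_def by blast
  from group_law[OF this] obtain B where B: "bilinear B"
    "\<And>x y. mul x y = (fst x + fst y, snd x + snd y + B (fst x) (fst y))" by blast
  interpret h_type_coordinates mul iv ip X B
    by unfold_locales (rule assms B)+
  obtain C where C: "C > 0" and harnack: "\<forall>x0 R u. R > 0 \<longrightarrow> continuous_on (model.gball x0 (12 * R)) u \<longrightarrow>
     (\<forall>x\<in>model.gball x0 (12 * R). 0 \<le> u x \<and> model.landis_solution \<delta> u x) \<longrightarrow>
     (\<forall>x\<in>model.gball x0 R. \<forall>y\<in>model.gball x0 R. u x \<le> C * u y)"
    using model.harnack[OF assms(5,6)] by (elim exE conjE) (rule that)
  show ?thesis
  proof (rule exI[of _ C], rule conjI[OF C], rule exI[of _ 12], intro conjI allI impI)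
    fix \<Omega> :: "('m, 'n) pt set" and A :: "('m, 'n) pt \<Rightarrow> real ^ 'm ^ 'm" and x0 R and u :: "('m, 'n) pt \<Rightarrow> real"
    let ?S = "gauge_ball mul iv ip x0 (12 * R)"
    assume A: "\<forall>x\<in>\<Omega>. A x \<in> elliptic_matrices lam Lam" and landis: "landis_condition \<delta> \<Omega> A"
      and R: "R > 0" and S: "?S \<subseteq> \<Omega>" and u: "Ck_on 2 ?S u"
      and sol: "\<forall>x\<in>?S. u x \<ge> 0 \<and> nondiv_op X A u x = 0"
    have mem: "\<Psi>i y \<in> ?S" if "y \<in> model.gball (\<Psi> x0) (12 * R)" for y
      using that by (simp add: gauge_ball_eq)
    have "\<And>y. y \<in> ?S \<Longrightarrow> u differentiable (at y)"
      using u unfolding numeral_2_eq_2 Ck_on.simps by blast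
    then have uc: "continuous_on ?S u"
      by (simp add: continuous_at_imp_continuous_on differentiable_imp_continuous_within)
    have 1: "continuous_on (model.gball (\<Psi> x0) (12 * R)) (u \<circ> \<Psi>i)"
      by (rule continuous_on_compose[OF continuous_on_subset[OF continuous_\<Psi>i] continuous_on_subset[OF uc]])
        (use mem in auto)
    have 2: "0 \<le> (u \<circ> \<Psi>i) y \<and> model.landis_solution \<delta> (u \<circ> \<Psi>i) y"
      if "y \<in> model.gball (\<Psi> x0) (12 * R)" for y
    proof -
      have "\<Psi>i y \<in> ?S" using mem[OF that] .
      then have "model.landis_solution \<delta> (u \<circ> \<Psi>i) (\<Psi> (\<Psi>i y))"
        using open_gauge_ball u A assms(3) landis S sol
        by (intro landis_solution_transfer[where S = ?S and A = A and \<Omega> = \<Omega> and lam = lam and Lam = Lam]) auto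
      then show ?thesis using sol mem[OF that] by simp
    qed
    have "(u \<circ> \<Psi>i) x \<le> C * (u \<circ> \<Psi>i) y"
      if "x \<in> model.gball (\<Psi> x0) R" "y \<in> model.gball (\<Psi> x0) R" for x y
      using harnack[rule_format, OF R 1 2] that by blast
    from this[of "\<Psi> _" "\<Psi> _"] have "u x \<le> C * u y"
      if "x \<in> gauge_ball mul iv ip x0 R" "y \<in> gauge_ball mul iv ip x0 R" for x y
      using that unfolding gauge_ball_eq by simp
    then show "(SUP x\<in>gauge_ball mul iv ip x0 R. ereal (u x))
        \<le> ereal C * (INF x\<in>gauge_ball mul iv ip x0 R. ereal (u x))"
      by (rule SUP_le_cmult_INF_ereal[OF C])
  qed simp
qed


end
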